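(* In each of the following three cases, let $S_1,S_2\subset\mathbb{H}^3$ be the two standard biconservative surfaces with common boundary curve $B\subset\mathbb{H}^3$ defined in the context: (a) $\tilde C_{-1}$ is an arbitrary positive constant; (b) $\tilde C_{-1}$ is an arbitrary negative constant; (c) $\tilde C_{-1}=0$. Then, by gluing $S_1$ and $S_2$ along their common boundary $B$, i.e. taking $S=S_1\cup B\cup S_2$, one obtains a complete biconservative regular surface in $\mathbb{H}^3$. Moreover, the gradient of the mean curvature function of $S$ vanishes along $B$, and $B$ is a geodesic of $S$.
   Context: Hyperboloid model: $\mathbb{R}^4_1$ is $\mathbb{R}^4$ with $\langle x,y\rangle=x^1y^1+x^2y^2+x^3y^3-x^4y^4$, and $\mathbb{H}^3=\{x\in\mathbb{R}^4_1:\langle x,x\rangle=-1,\ x^4>0\}$ with the induced Riemannian metric. A regular surface in $\mathbb{H}^3$ is an embedded $2$-dimensional submanifold (of class at least $C^3$). A surface in $\mathbb{H}^3$ is biconservative if $A(\operatorname{grad}f)=-\frac f2\operatorname{grad}f$, where $A$ is its shape operator and $f=\operatorname{trace}A$ its mean curvature function. Complete means complete for the induced metric. Standard biconservative surfaces. They are the images of the following maps $X(\kappa,v)$, $(\kappa,v)\in(0,\kappa_{01})\times\mathbb{R}$, where $\kappa_{01}>0$ is the positive zero of $\frac{16}{9}\kappa^2-16\kappa^4+\tilde C_{-1}\kappa^{7/2}$ (this function is positive on $(0,\kappa_{01})$; $\kappa_{01}=1/3$ if $\tilde C_{-1}=0$). In each case $\kappa_{00}\in(0,\kappa_{01})$ is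 arbitrarily fixed, and $\mu(\kappa)=\pm\mu_0(\kappa)+c_0$ for a choice of sign and a constant $c_0\in\mathbb{R}$, with $\mu_0$ as given below. In each case the limit $\mu_{0,1}=\lim_{\kappa\nearrow\kappa_{01}}\mu_0(\kappa)$ exists and is finite. (a) $\tilde C_{-1}>0$: $$\mu_0(\kappa)=\int_{\kappa_{00}}^{\kappa}\frac{36\sqrt{\tilde C_{-1}}\,\tau^{7/4}}{(9\tilde C_{-1}\tau^{3/2}+16)\sqrt{\frac{16}{9}\tau^2-16\tau^4+\tilde C_{-1}\tau^{7/2}}}\,d\tau,\qquad R(\kappa)=\frac{\sqrt{9\tilde C_{-1}\kappa^{3/2}+16}}{3\sqrt{\tilde C_{-1}}\,\kappa^{3/4}},$$ $$X(\kappa,v)=\left(\frac{4\cos v}{3\sqrt{\tilde C_{-1}}\kappa^{3/4}},\ \frac{4\sin v}{3\sqrt{\tilde C_{-1}}\kappa^{3/4}},\ R(\kappa)\sinh\mu(\kappa),\ R(\kappa)\cosh\mu(\kappa)\right).$$ (b) $\tilde C_{-1}<0$: $$\mu_0(\kappa)=\int_{\kappa_{00}}^{\kappa}\frac{36\sqrt{-\tilde C_{-1}}\,\tau^{7/4}}{(9\tilde C_{-1}\tau^{3/2}+16)\sqrt{\frac{16}{9}\tau^2-16\tau^4+\tilde C_{-1}\tau^{7/2}}}\,d\tau,\qquad R(\kappa)=\frac{\sqrt{9\tilde C_{-1}\kappa^{3/2}+16}}{3\sqrt{-\tilde C_{-1}}\,\kappa^{3/4}},$$ $$X(\kappa,v)=\left(\sqrt2R(\kappa)\sin\mu(\kappa)+\frac{4\cosh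 v}{3\sqrt{-\tilde C_{-1}}\kappa^{3/4}},\ \frac{4\sinh v}{3\sqrt{-\tilde C_{-1}}\kappa^{3/4}},\ R(\kappa)\cos\mu(\kappa),\ R(\kappa)\sin\mu(\kappa)+\frac{4\sqrt2\cosh v}{3\sqrt{-\tilde C_{-1}}\kappa^{3/4}}\right).$$ (c) $\tilde C_{-1}=0$: $$\mu_0(\kappa)=\frac94\int_{\kappa_{00}}^{\kappa}\frac{\tau^{3/4}}{\sqrt{1-9\tau^2}}\,d\tau,\qquad x(\kappa)=\frac{\mu(\kappa)}{\kappa^{3/4}},$$ $$X(\kappa,v)=\left(2^{3/4}\kappa^{3/4}(1+x^2(\kappa)+v^2)-\frac{1}{2^{11/4}\kappa^{3/4}},\ v,\ x(\kappa),\ 2^{3/4}\kappa^{3/4}(1+x^2(\kappa)+v^2)+\frac{1}{2^{11/4}\kappa^{3/4}}\right).$$ The two surfaces to be glued (for the same constant $\tilde C_{-1}$): $S_1$ is the image of $X$ for the choice $\mu=\mu_0$ (sign $+$, $c_0=0$), and $S_2$ is the image of $X$ for the choice $\mu=-\mu_0+2\mu_{0,1}$ (sign $-$, $c_0=2\mu_{0,1}$). Their common boundary $B$ is the image of the curve $v\mapsto X(\kappa_{01},v)$, $v\in\mathbb{R}$, obtained by putting $\kappa=\kappa_{01}$ and $\mu=\mu_{0,1}$ in the formula for $X$. *)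

theory Defs
  imports "HOL-Analysis.Analysis"
begin

section \<open>The hyperboloid model\<close>

definition lor :: "real^4 \<Rightarrow> real^4 \<Rightarrow> real" where
  "lor x y = x$1 * y$1 + x$2 * y$2 + x$3 * y$3 - x$4 * y$4"

definition hyp3 :: "(real^4) set" where
  "hyp3 = {x. lor x x = -1 \<and> x$4 > 0}"


section \<open>Regular surfaces\<close>

text \<open>For open \<open>U\<close> this is the class \<open>C\<^sup>k\<close>.\<close>

primrec Ck_on :: "nat \<Rightarrow> 'a::euclidean_space set \<Rightarrow> ('a \<Rightarrow> 'b::euclidean_space) \<Rightarrow> bool" where
  "Ck_on 0 U f \<longleftrightarrow> continuous_on U f"
| "Ck_on (Suc k) U f \<longleftrightarrow>
     (\<forall>x\<in>U. f differentiable (at x)) \<and> (\<forall>v. Ck_on k U (\<lambda>x. frechet_derivative f (at x) v))"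

text \<open>Embedded two-dimensional \<open>C\<^sup>3\<close> submanifolds of \<open>hyp3\<close>, through local parametrizations that
  are immersions and homeomorphisms onto relatively open subsets of \<open>S\<close>.  Since \<open>hyp3\<close> is itself an
  embedded submanifold of \<open>real^4\<close>, smoothness may be measured in \<open>real^4\<close>.\<close>

definition regular_surface :: "(real^4) set \<Rightarrow> bool" where
  "regular_surface S \<longleftrightarrow> S \<subseteq> hyp3 \<and>
     (\<forall>p\<in>S. \<exists>(U::(real \<times> real) set) W \<phi> \<psi>.
        open U \<and> open W \<and> p \<in> W \<and> Ck_on 3 U \<phi> \<and>
        homeomorphism U (S \<inter> W) \<phi> \<psi> \<and>
        (\<forall>u\<in>U. inj (frechet_derivative \<phi> (at u))))"

definition tangent_space :: "(real^4) set \<Rightarrow> real^4 \<Rightarrow> (real^4) set" where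
  "tangent_space M p =
     {w. \<exists>\<gamma> \<epsilon>. \<epsilon> > 0 \<and> (\<forall>t\<in>{-\<epsilon><..<\<epsilon>}. \<gamma> t \<in> M) \<and> \<gamma> 0 = p \<and>
           (\<gamma> has_vector_derivative w) (at 0)}"

text \<open>The \<open>lor\<close>-orthogonal projection onto a subspace \<open>V\<close> on which \<open>lor\<close> is nondegenerate.  Applied to
  a derivative in \<open>real^4\<close> with \<open>V\<close> the tangent space of \<open>hyp3\<close> (of a surface \<open>S\<close>), it gives the
  Levi-Civita covariant derivative of \<open>hyp3\<close> (of \<open>S\<close> with the induced metric).\<close>

definition tangential_part :: "(real^4) set \<Rightarrow> real^4 \<Rightarrow> real^4" where
  "tangential_part V u = (THE t. t \<in> V \<and> (\<forall>w\<in>V. lor (u - t) w = 0))"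


section \<open>Shape operator, mean curvature, biconservative surfaces\<close>

text \<open>A unit normal field, in \<open>hyp3\<close>, of the part of \<open>S\<close> inside \<open>W\<close>.\<close>

definition unit_normal_field ::
    "(real^4) set \<Rightarrow> (real^4) set \<Rightarrow> (real^4 \<Rightarrow> real^4) \<Rightarrow> bool" where
  "unit_normal_field S W N \<longleftrightarrow> N differentiable_on (S \<inter> W) \<and>
     (\<forall>q\<in>S \<inter> W. N q \<in> tangent_space hyp3 q \<and> lor (N q) (N q) = 1 \<and>
        (\<forall>w\<in>tangent_space S q. lor (N q) w = 0))"

text \<open>A derivative within \<open>S\<close> is determined only on vectors tangent to \<open>S\<close>.  Below it is used only
  on such vectors, so the choice made by \<^const>\<open>frechet_derivative\<close> is irrelevant.\<close>

definition shape_operator ::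
    "(real^4) set \<Rightarrow> (real^4 \<Rightarrow> real^4) \<Rightarrow> real^4 \<Rightarrow> real^4 \<Rightarrow> real^4" where
  "shape_operator S N p w =
     - tangential_part (tangent_space hyp3 p) (frechet_derivative N (at p within S) w)"

text \<open>The trace of the shape operator on the tangent plane, computed in any orthonormal basis.\<close>

definition mean_curvature :: "(real^4) set \<Rightarrow> (real^4 \<Rightarrow> real^4) \<Rightarrow> real^4 \<Rightarrow> real" where
  "mean_curvature S N p =
     (THE c. \<forall>a\<in>tangent_space S p. \<forall>b\<in>tangent_space S p.
        lor a a = 1 \<and> lor b b = 1 \<and> lor a b = 0 \<longrightarrow>
        c = lor (shape_operator S N p a) a + lor (shape_operator S N p b) b)"

definition has_surface_gradient ::
    "(real^4) set \<Rightarrow> (real^4 \<Rightarrow> real) \<Rightarrow> real^4 \<Rightarrow> real^4 \<Rightarrow> bool" where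
  "has_surface_gradient S f g p \<longleftrightarrow> g \<in> tangent_space S p \<and>
     (\<exists>D. (f has_derivative D) (at p within S) \<and> (\<forall>w\<in>tangent_space S p. lor g w = D w))"

text \<open>Replacing \<open>N\<close> by \<open>-N\<close> changes the sign of the shape operator and of the mean curvature, which
  leaves the equation below invariant; so one unit normal field near each point suffices.\<close>

definition biconservative :: "(real^4) set \<Rightarrow> bool" where
  "biconservative S \<longleftrightarrow>
     (\<forall>p\<in>S. \<exists>W N. open W \<and> p \<in> W \<and> unit_normal_field S W N \<and>
        (\<forall>q\<in>S \<inter> W. \<exists>g. has_surface_gradient S (mean_curvature S N) g q \<and>
           shape_operator S N q g = - (mean_curvature S N q / 2) *\<^sub>R g))"


section \<open>Completeness and geodesics of the induced metric\<close>

text \<open>\<^const>\<open>has_integral\<close> excludes curves whose speed is not integrable; a piecewise \<open>C\<^sup>1\<close> path in the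
  library's sense may have unbounded speed near a break point.\<close>

definition curve_lengths :: "(real^4) set \<Rightarrow> real^4 \<Rightarrow> real^4 \<Rightarrow> real set" where
  "curve_lengths S p q =
     {l. \<exists>\<gamma>. valid_path \<gamma> \<and> path_image \<gamma> \<subseteq> S \<and> pathstart \<gamma> = p \<and> pathfinish \<gamma> = q \<and>
        ((\<lambda>t. sqrt (lor (vector_derivative \<gamma> (at t)) (vector_derivative \<gamma> (at t))))
           has_integral l) {0..1}}"

definition intrinsic_dist :: "(real^4) set \<Rightarrow> real^4 \<Rightarrow> real^4 \<Rightarrow> ereal" where
  "intrinsic_dist S p q = (INF l\<in>curve_lengths S p q. ereal l)"

definition complete_surface :: "(real^4) set \<Rightarrow> bool" where
  "complete_surface S \<longleftrightarrow>
     (\<forall>x::nat \<Rightarrow> real^4.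
        (\<forall>n. x n \<in> S) \<and>
        (\<forall>\<epsilon>>0. \<exists>M. \<forall>m\<ge>M. \<forall>n\<ge>M. intrinsic_dist S (x m) (x n) < ereal \<epsilon>) \<longrightarrow>
        (\<exists>p\<in>S. (\<lambda>n. intrinsic_dist S (x n) p) \<longlonglongrightarrow> 0))"

definition geodesic :: "(real^4) set \<Rightarrow> (real \<Rightarrow> real^4) \<Rightarrow> bool" where
  "geodesic S \<gamma> \<longleftrightarrow>
     (\<exists>\<gamma>' \<gamma>''. \<forall>t. \<gamma> t \<in> S \<and>
        (\<gamma> has_vector_derivative \<gamma>' t) (at t) \<and> (\<gamma>' has_vector_derivative \<gamma>'' t) (at t) \<and>
        \<gamma>' t \<noteq> 0 \<and> tangential_part (tangent_space S (\<gamma> t)) (\<gamma>'' t) = 0)"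


section \<open>The standard biconservative surfaces\<close>

text \<open>\<open>C\<close> is the real constant on whose sign the three families depend.\<close>

definition radicand :: "real \<Rightarrow> real \<Rightarrow> real" where
  "radicand C \<kappa> = 16/9 * \<kappa>^2 - 16 * \<kappa>^4 + C * \<kappa> powr (7/2)"

definition kappa01 :: "real \<Rightarrow> real" where
  "kappa01 C = (THE \<kappa>. \<kappa> > 0 \<and> radicand C \<kappa> = 0)"

definition mu0 :: "real \<Rightarrow> real \<Rightarrow> real \<Rightarrow> real" where
  "mu0 C \<kappa>00 \<kappa> =
     (if C > 0 then
        (LBINT \<tau>=\<kappa>00..\<kappa>. 36 * sqrt C * \<tau> powr (7/4) /
           ((9 * C * \<tau> powr (3/2) + 16) * sqrt (radicand C \<tau>)))
      else if C < 0 then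
        (LBINT \<tau>=\<kappa>00..\<kappa>. 36 * sqrt (- C) * \<tau> powr (7/4) /
           ((9 * C * \<tau> powr (3/2) + 16) * sqrt (radicand C \<tau>)))
      else
        9/4 * (LBINT \<tau>=\<kappa>00..\<kappa>. \<tau> powr (3/4) / sqrt (1 - 9 * \<tau>^2)))"

definition mu01 :: "real \<Rightarrow> real \<Rightarrow> real" where
  "mu01 C \<kappa>00 = Lim (at_left (kappa01 C)) (mu0 C \<kappa>00)"

text \<open>In the next three definitions \<open>m\<close> is the value \<open>\<mu>(\<kappa>)\<close>, so that the boundary curve is obtained
  by substituting \<open>\<kappa> = kappa01 C\<close> and \<open>m = mu01 C \<kappa>00\<close>.\<close>

definition X_pos :: "real \<Rightarrow> real \<Rightarrow> real \<Rightarrow> real \<Rightarrow> real^4" where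
  "X_pos C m \<kappa> v =
     (let R = sqrt (9 * C * \<kappa> powr (3/2) + 16) / (3 * sqrt C * \<kappa> powr (3/4)) in
      vector [4 * cos v / (3 * sqrt C * \<kappa> powr (3/4)),
              4 * sin v / (3 * sqrt C * \<kappa> powr (3/4)),
              R * sinh m,
              R * cosh m])"

definition X_neg :: "real \<Rightarrow> real \<Rightarrow> real \<Rightarrow> real \<Rightarrow> real^4" where
  "X_neg C m \<kappa> v =
     (let R = sqrt (9 * C * \<kappa> powr (3/2) + 16) / (3 * sqrt (- C) * \<kappa> powr (3/4)) in
      vector [sqrt 2 * R * sin m + 4 * cosh v / (3 * sqrt (- C) * \<kappa> powr (3/4)),
              4 * sinh v / (3 * sqrt (- C) * \<kappa> powr (3/4)),
              R * cos m,
              R * sin m + 4 * sqrt 2 * cosh v / (3 * sqrt (- C) * \<kappa> powr (3/4))])"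

definition X_zero :: "real \<Rightarrow> real \<Rightarrow> real \<Rightarrow> real^4" where
  "X_zero m \<kappa> v =
     (let x = m / \<kappa> powr (3/4) in
      vector [2 powr (3/4) * \<kappa> powr (3/4) * (1 + x^2 + v^2) - 1 / (2 powr (11/4) * \<kappa> powr (3/4)),
              v,
              x,
              2 powr (3/4) * \<kappa> powr (3/4) * (1 + x^2 + v^2) + 1 / (2 powr (11/4) * \<kappa> powr (3/4))])"

definition X_std :: "real \<Rightarrow> real \<Rightarrow> real \<Rightarrow> real \<Rightarrow> real^4" where
  "X_std C m \<kappa> v = (if C > 0 then X_pos C m \<kappa> v else if C < 0 then X_neg C m \<kappa> v else X_zero m \<kappa> v)"

definition standard_surface :: "real \<Rightarrow> (real \<Rightarrow> real) \<Rightarrow> (real^4) set" where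
  "standard_surface C \<mu> = {X_std C (\<mu> \<kappa>) \<kappa> v |\<kappa> v. 0 < \<kappa> \<and> \<kappa> < kappa01 C}"

definition surface1 :: "real \<Rightarrow> real \<Rightarrow> (real^4) set" where
  "surface1 C \<kappa>00 = standard_surface C (mu0 C \<kappa>00)"

definition surface2 :: "real \<Rightarrow> real \<Rightarrow> (real^4) set" where
  "surface2 C \<kappa>00 = standard_surface C (\<lambda>\<kappa>. - mu0 C \<kappa>00 \<kappa> + 2 * mu01 C \<kappa>00)"

definition boundary_curve :: "real \<Rightarrow> real \<Rightarrow> (real^4) set" where
  "boundary_curve C \<kappa>00 = range (X_std C (mu01 C \<kappa>00) (kappa01 C))"

end

theory Submission
  imports Defs
begin

text \<open>
  Parametrize the profile curve by the angle \<open>\<theta>\<close> with \<open>sin \<theta> = 3 \<kappa> / sqrt (1 + 9 C \<kappa>\<^sup>3\<^sup>/\<^sup>2 / 16)\<close>, that is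
  \<open>cos\<^sup>2 \<theta> = radicand / (radicand + 16 \<kappa>\<^sup>4)\<close>.  The singular integral for \<open>\<mu>\<close> becomes the integral of a smooth
  function of \<open>\<theta>\<close> on \<open>]0, \<pi>[\<close>, and the two pieces and their common boundary become one smooth surface, swept
  out from its profile curve by a one-parameter group of isometries.  With \<open>\<epsilon> = sgn C\<close> the three cases
  differ only in the group, whose generator is a vector \<open>n\<close> with \<open>lor n n = \<epsilon>\<close>.  The profile curve and
  the parallels are lines of curvature with principal curvatures \<open>\<kappa>\<close> and \<open>-3 \<kappa>\<close>, so \<open>f = -2 \<kappa>\<close> and
  \<open>A (grad f) = \<kappa> grad f\<close>.  At \<open>\<theta> = \<pi>/2\<close> the radius of the parallels is stationary; hence the parallel \<open>B\<close>
  is a geodesic and \<open>grad f = 0\<close> along it.  For \<open>C < 0\<close> the integrand is at most \<open>1\<close>, so \<open>\<mu>\<close> varies by less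
  than \<open>\<pi>\<close> and the surface does not meet itself.  It is closed in \<open>real^4\<close>, hence complete.
\<close>

section \<open>Functions of class \<open>C\<^sup>k\<close>\<close>

text \<open>The parameter \<kappa> is unusable near \<open>B\<close>: it is largest there, and the
  integrand of \<mu> is singular. In terms of \<theta> the only singular factor of the integrand is
  1 / cos \<theta>, and the derivative of \<kappa> supplies the factor cos \<theta> that cancels it.
  In the standard surfaces the radius of the parallels is proportional to \<kappa>^(-3/4). Writing
  the radius as w^3 and \<kappa> as k / w^4, with 9 C k^(3/2) = 16 \<epsilon>, removes all
  fractional powers and leaves one equation w^2 (w^6 + \<epsilon>) sin^2 \<theta> = 9 k^2 for the
  three cases. Where w^6 + \<epsilon> is positive, w^2 (w^6 + \<epsilon>) increases with w, so w is
  a differentiable function of \<theta>; higher regularity comes from the differential equations of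
  the profile. A smooth immersion is not enough: charts must be homeomorphisms onto relatively open
  sets, so a point has to determine its profile parameter continuously. The gradient claim concerns
  every unit normal field, not only the one constructed, so a sign has to be shown locally
  constant.\<close>

lemma Ck_on_cong:
  assumes "open U" "\<And>x. x \<in> U \<Longrightarrow> f x = g x" "Ck_on k U f"
  shows "Ck_on k U g"
  using assms(2,3)
proof (induction k arbitrary: f g)
  case 0
  then show ?case by (simp cong: continuous_on_cong)
next
  case (Suc k)
  have der: "(f has_derivative frechet_derivative f (at x)) (at x)" if "x \<in> U" for x
    using Suc.prems(2) that by (simp add: frechet_derivative_works)
  have der': "(g has_derivative frechet_derivative f (at x)) (at x)" if "x \<in> U" for x
    by (rule has_derivative_transform_within_open[OF der[OF that] \<open>open U\<close> that Suc.prems(1)])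
  have "frechet_derivative f (at x) = frechet_derivative g (at x)" if "x \<in> U" for x
    using frechet_derivative_at[OF der'[OF that]] .
  note eq = this
  have "Ck_on k U (\<lambda>x. frechet_derivative g (at x) v)" for v
    by (rule Suc.IH[of "\<lambda>x. frechet_derivative f (at x) v" "\<lambda>x. frechet_derivative g (at x) v"])
      (use Suc.prems(2) in \<open>simp_all add: eq\<close>)
  then show ?case
    using der' by (auto simp: differentiable_def)
qed

text \<open>On an open set any known derivative agrees with the one selected by
  \<open>frechet_derivative\<close>, so smoothness can be proved with explicit formulas.\<close>

lemma Ck_on_SucI:
  assumes "open U" "\<And>x. x \<in> U \<Longrightarrow> (f has_derivative f' x) (at x)"
    and "\<And>v. Ck_on k U (\<lambda>x. f' x v)"
  shows "Ck_on (Suc k) U f"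
proof -
  have eq: "f' x = frechet_derivative f (at x)" if "x \<in> U" for x
    using frechet_derivative_at[OF assms(2)[OF that]] .
  have "Ck_on k U (\<lambda>x. frechet_derivative f (at x) v)" for v
    by (rule Ck_on_cong[OF assms(1) _ assms(3)[of v]]) (simp add: eq)
  then show ?thesis
    using assms(2) by (auto simp: differentiable_def)
qed

lemma Ck_on_Suc_has_derivative:
  "Ck_on (Suc k) U f \<Longrightarrow> x \<in> U \<Longrightarrow> (f has_derivative frechet_derivative f (at x)) (at x)"
  by (simp add: frechet_derivative_works)

lemma Ck_on_Suc_imp: "Ck_on (Suc k) U f \<Longrightarrow> Ck_on k U f"
proof (induction k arbitrary: f)
  case 0
  then show ?case
    by (auto intro!: differentiable_imp_continuous_on differentiable_at_imp_differentiable_on)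
next
  case (Suc k)
  then show ?case by (metis Ck_on.simps(2))
qed

lemma Ck_on_const: "Ck_on k U (\<lambda>x. c)"
  by (induction k arbitrary: c) auto

lemma Ck_on_add:
  assumes "open U" "Ck_on k U f" "Ck_on k U g"
  shows "Ck_on k U (\<lambda>x. f x + g x)"
  using assms(2,3)
proof (induction k arbitrary: f g)
  case 0
  then show ?case by (simp add: continuous_on_add)
next
  case (Suc k)
  show ?case
    using Suc by (intro Ck_on_SucI[OF \<open>open U\<close> has_derivative_add
          [OF Ck_on_Suc_has_derivative Ck_on_Suc_has_derivative]]) auto
qed

lemma Ck_on_scaleR:
  fixes f :: "'a::euclidean_space \<Rightarrow> real"
  assumes "open U" "Ck_on k U f" "Ck_on k U g"
  shows "Ck_on k U (\<lambda>x. f x *\<^sub>R g x)"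
  using assms(2,3)
proof (induction k arbitrary: f g)
  case 0
  then show ?case by (simp add: continuous_on_scaleR)
next
  case (Suc k)
  show ?case
    using Suc Ck_on_Suc_imp[OF Suc.prems(1)] Ck_on_Suc_imp[OF Suc.prems(2)]
    by (intro Ck_on_SucI[OF \<open>open U\<close> has_derivative_scaleR
          [OF Ck_on_Suc_has_derivative Ck_on_Suc_has_derivative]] Ck_on_add[OF \<open>open U\<close>]) auto
qed

lemma Ck_on_mult:
  fixes f g :: "'a::euclidean_space \<Rightarrow> real"
  shows "open U \<Longrightarrow> Ck_on k U f \<Longrightarrow> Ck_on k U g \<Longrightarrow> Ck_on k U (\<lambda>x. f x * g x)"
  using Ck_on_scaleR[of U k f g] by simp

lemma Ck_on_minus: "open U \<Longrightarrow> Ck_on k U f \<Longrightarrow> Ck_on k U (\<lambda>x. - f x)"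
  using Ck_on_scaleR[of U k "\<lambda>_. -1" f] by (simp add: Ck_on_const)

lemma Ck_on_diff: "open U \<Longrightarrow> Ck_on k U f \<Longrightarrow> Ck_on k U g \<Longrightarrow> Ck_on k U (\<lambda>x. f x - g x)"
  using Ck_on_add[of U k f "\<lambda>x. - g x"] by (simp add: Ck_on_minus)

lemma Ck_on_power:
  fixes f :: "'a::euclidean_space \<Rightarrow> real"
  shows "open U \<Longrightarrow> Ck_on k U f \<Longrightarrow> Ck_on k U (\<lambda>x. f x ^ m)"
  by (induction m) (auto simp: Ck_on_const intro: Ck_on_mult)

lemma Ck_on_inverse:
  fixes f :: "'a::euclidean_space \<Rightarrow> real"
  assumes "open U" "Ck_on k U f" "\<And>x. x \<in> U \<Longrightarrow> f x \<noteq> 0"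
  shows "Ck_on k U (\<lambda>x. inverse (f x))"
  using assms(2)
proof (induction k)
  case 0
  then show ?case using assms by (simp add: continuous_on_inverse)
next
  case (Suc k)
  note IH = Suc.IH[OF Ck_on_Suc_imp[OF Suc.prems]]
  have "((\<lambda>x. inverse (f x)) has_derivative
      (\<lambda>h. - (inverse (f x) * frechet_derivative f (at x) h * inverse (f x)))) (at x)" if "x \<in> U" for x
    using Deriv.has_derivative_inverse[OF assms(3)[OF that] Ck_on_Suc_has_derivative[OF Suc.prems that]] .
  then show ?case
    by (rule Ck_on_SucI[OF \<open>open U\<close>])
       (use Suc.prems IH in \<open>auto intro!: Ck_on_minus Ck_on_mult \<open>open U\<close>\<close>)
qed

lemma Ck_on_divide:
  fixes f g :: "'a::euclidean_space \<Rightarrow> real"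
  shows "open U \<Longrightarrow> Ck_on k U f \<Longrightarrow> Ck_on k U g \<Longrightarrow> (\<And>x. x \<in> U \<Longrightarrow> g x \<noteq> 0)
    \<Longrightarrow> Ck_on k U (\<lambda>x. f x / g x)"
  using Ck_on_mult[of U k f "\<lambda>x. inverse (g x)"] by (simp add: Ck_on_inverse divide_inverse)

lemmas Ck_on_intros = Ck_on_const Ck_on_add Ck_on_diff Ck_on_minus Ck_on_mult Ck_on_scaleR
  Ck_on_power Ck_on_divide

text \<open>One order of smoothness is gained from an ordinary derivative in one variable. This is
  the step that the later bootstrap of the profile functions repeats.\<close>

lemma Ck_on_Suc_fst:
  fixes U :: "(real \<times> real) set"
  assumes "open U" "\<And>x. x \<in> U \<Longrightarrow> (f has_vector_derivative f' (fst x)) (at (fst x))"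
    and "Ck_on k U (\<lambda>x. f' (fst x))"
  shows "Ck_on (Suc k) U (\<lambda>x. f (fst x))"
proof (rule Ck_on_SucI[OF \<open>open U\<close>])
  fix x :: "real \<times> real" assume "x \<in> U"
  show "((\<lambda>x. f (fst x)) has_derivative (\<lambda>v. fst v *\<^sub>R f' (fst x))) (at x)"
    by (rule has_derivative_compose[of fst fst])
       (use assms(2)[OF \<open>x \<in> U\<close>] in \<open>auto simp: has_vector_derivative_def
          intro!: bounded_linear_imp_has_derivative bounded_linear_fst\<close>)
next
  show "Ck_on k U (\<lambda>x. fst v *\<^sub>R f' (fst x))" for v :: "real \<times> real"
    by (intro Ck_on_scaleR Ck_on_const assms)
qed

lemma Ck_on_Suc_snd:
  fixes U :: "(real \<times> real) set"
  assumes "open U" "\<And>x. x \<in> U \<Longrightarrow> (f has_vector_derivative f' (snd x)) (at (snd x))"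
    and "Ck_on k U (\<lambda>x. f' (snd x))"
  shows "Ck_on (Suc k) U (\<lambda>x. f (snd x))"
proof (rule Ck_on_SucI[OF \<open>open U\<close>])
  fix x :: "real \<times> real" assume "x \<in> U"
  show "((\<lambda>x. f (snd x)) has_derivative (\<lambda>v. snd v *\<^sub>R f' (snd x))) (at x)"
    by (rule has_derivative_compose[of snd snd])
       (use assms(2)[OF \<open>x \<in> U\<close>] in \<open>auto simp: has_vector_derivative_def
          intro!: bounded_linear_imp_has_derivative bounded_linear_snd\<close>)
next
  show "Ck_on k U (\<lambda>x. snd v *\<^sub>R f' (snd x))" for v :: "real \<times> real"
    by (intro Ck_on_scaleR Ck_on_const assms)
qed


section \<open>Immersed charts\<close>

lemma at_within_Int_nhd: "p \<in> W \<Longrightarrow> open W \<Longrightarrow> at p within (S \<inter> W) = at p within S"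
  for p :: "'a::topological_space"
  by (rule at_within_nhd[of p W]) auto

text \<open>The dimensions of source and target differ, so the inverse function theorem does not
  apply directly. A left inverse \<open>L\<close> of \<open>D\<close> gives
  \<open>norm x \<le> c * norm (D x)\<close>; with continuity of \<open>\<psi>\<close> this bounds
  \<open>\<psi> z - u\<close> linearly by \<open>z - \<phi> u\<close>, and the first-order error of
  \<open>\<phi>\<close> is then pushed through \<open>L\<close>.\<close>

lemma chart_inverse_has_derivative:
  fixes \<phi> :: "'a::euclidean_space \<Rightarrow> 'b::euclidean_space"
  assumes hom: "homeomorphism U T \<phi> \<psi>" and "u \<in> U"
    and D: "(\<phi> has_derivative D) (at u)" and "inj D"
  obtains L where "bounded_linear L" "\<And>x. L (D x) = x"
    "(\<psi> has_derivative L) (at (\<phi> u) within T)"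
proof -
  have lin: "linear D" using D has_derivative_linear by blast
  obtain L where L: "linear L" "L \<circ> D = id"
    using linear_injective_left_inverse[OF lin \<open>inj D\<close>] by auto
  then have LD: "L (D x) = x" for x by (metis comp_apply id_apply)
  have bL: "bounded_linear L" using L(1) linear_conv_bounded_linear by blast
  obtain c where c: "c > 0" "\<And>x. norm (L x) \<le> norm x * c"
    using bounded_linear.pos_bounded[OF bL] by blast
  have low: "norm x \<le> c * norm (D x)" for x using c(2)[of "D x"] by (simp add: LD mult.commute)
  have "\<forall>e>0. \<exists>d>0. \<forall>z\<in>T. norm (z - \<phi> u) < d \<longrightarrow>
      norm (\<psi> z - \<psi> (\<phi> u) - L (z - \<phi> u)) \<le> e * norm (z - \<phi> u)"
  proof (intro allI impI)
    fix e :: real assume "e > 0"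
    \<comment> \<open>The bound \<open>1 / (2 * c)\<close> lets half of \<open>norm y\<close> be
      absorbed, which gives \<open>norm y \<le> 2 * c * norm (z - \<phi> u)\<close>; the bound
      \<open>e / (2 * c * c)\<close> then brings the final error down to \<open>e\<close>.\<close>
    define e1 where "e1 = min (e / (2 * c * c)) (1 / (2 * c))"
    have "e1 > 0" using \<open>e > 0\<close> c(1) by (simp add: e1_def)
    then obtain d1 where "d1 > 0" and
      d1: "\<And>y. norm (y - u) < d1 \<Longrightarrow> norm (\<phi> y - \<phi> u - D (y - u)) \<le> e1 * norm (y - u)"
      using D unfolding has_derivative_at_alt by blast
    have "continuous_on T \<psi>" using hom by (simp add: homeomorphism_def)
    moreover have "\<phi> u \<in> T" using hom \<open>u \<in> U\<close> by (auto simp: homeomorphism_def)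
    ultimately obtain d where "d > 0" and
      d: "\<And>z. z \<in> T \<Longrightarrow> dist z (\<phi> u) < d \<Longrightarrow> dist (\<psi> z) (\<psi> (\<phi> u)) < d1"
      using \<open>d1 > 0\<close> unfolding continuous_on_iff by blast
    have \<psi>u: "\<psi> (\<phi> u) = u" using hom \<open>u \<in> U\<close> by (simp add: homeomorphism_def)
    show "\<exists>d>0. \<forall>z\<in>T. norm (z - \<phi> u) < d \<longrightarrow>
      norm (\<psi> z - \<psi> (\<phi> u) - L (z - \<phi> u)) \<le> e * norm (z - \<phi> u)"
    proof (intro exI[of _ d] conjI ballI impI \<open>d > 0\<close>)
      fix z assume "z \<in> T" "norm (z - \<phi> u) < d"
      then have y: "norm (\<psi> z - u) < d1" using d \<psi>u by (simp add: dist_norm)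
      define y where "y = \<psi> z - u"
      have "\<phi> (\<psi> z) = z" using hom \<open>z \<in> T\<close> by (simp add: homeomorphism_def)
      then have b: "norm (z - \<phi> u - D y) \<le> e1 * norm y"
        using d1[OF y] by (simp add: y_def)
      have "norm y \<le> c * norm (D y)" by (rule low)
      also have "\<dots> \<le> c * (norm (z - \<phi> u) + e1 * norm y)"
        using b c(1) norm_triangle_ineq4[of "z - \<phi> u" "z - \<phi> u - D y"]
        by (intro mult_left_mono) auto
      also have "c * (e1 * norm y) \<le> c * (1 / (2 * c) * norm y)"
        using c(1) by (intro mult_left_mono mult_right_mono) (auto simp: e1_def)
      then have "c * (norm (z - \<phi> u) + e1 * norm y) \<le> c * norm (z - \<phi> u) + norm y / 2"
        using c(1) by (simp add: field_simps)
      finally have y2: "norm y \<le> 2 * c * norm (z - \<phi> u)" by simp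
      have "\<psi> z - \<psi> (\<phi> u) - L (z - \<phi> u) = L (D y - (z - \<phi> u))"
        using L(1) by (simp add: LD linear_diff \<psi>u y_def)
      then have "norm (\<psi> z - \<psi> (\<phi> u) - L (z - \<phi> u)) \<le> norm (D y - (z - \<phi> u)) * c"
        using c(2) by simp
      also have "\<dots> \<le> (e1 * norm y) * c"
        using b c(1) by (intro mult_right_mono) (auto simp: norm_minus_commute)
      also have "\<dots> \<le> (e1 * (2 * c * norm (z - \<phi> u))) * c"
        using y2 c(1) \<open>e1 > 0\<close> by (intro mult_right_mono mult_left_mono) auto
      also have "\<dots> = e1 * (2 * c * c * norm (z - \<phi> u))" by simp
      also have "\<dots> \<le> (e / (2 * c * c)) * (2 * c * c * norm (z - \<phi> u))"
        using c(1) by (intro mult_right_mono) (auto simp: e1_def)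
      also have "\<dots> = e * norm (z - \<phi> u)" using c(1) by simp
      finally show "norm (\<psi> z - \<psi> (\<phi> u) - L (z - \<phi> u)) \<le> e * norm (z - \<phi> u)" .
    qed
  qed
  then have "(\<psi> has_derivative L) (at (\<phi> u) within T)"
    using bL by (simp add: has_derivative_within_alt)
  then show thesis using that bL LD by blast
qed

lemma has_derivative_compose_into:
  assumes "(f has_derivative f') (at (g u) within S)" "(g has_derivative g') (at u)"
    and "open U" "u \<in> U" "\<And>x. x \<in> U \<Longrightarrow> g x \<in> S"
  shows "((\<lambda>x. f (g x)) has_derivative (\<lambda>v. f' (g' v))) (at u)"
proof -
  have "((\<lambda>x. f (g x)) has_derivative (\<lambda>v. f' (g' v))) (at u within U)"
    by (rule has_derivative_in_compose[OF has_derivative_at_withinI[OF assms(2)]])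
       (rule has_derivative_subset[OF assms(1)], use assms(5) in auto)
  then show ?thesis by (simp only: at_within_open[OF assms(4,3)])
qed

text \<open>For small times a curve in \<open>S\<close> lies in the chart and is unchanged by
  \<open>\<phi>\<close> after \<open>\<psi>\<close>, so uniqueness of derivatives forces
  \<open>w = D (L w)\<close>. Conversely, images of straight lines realise every vector of
  \<open>range D\<close>.\<close>

lemma tangent_space_chart:
  fixes \<phi> :: "real \<times> real \<Rightarrow> real^4"
  assumes hom: "homeomorphism U (S \<inter> W) \<phi> \<psi>" and "open U" "open W" "u \<in> U"
    and D: "(\<phi> has_derivative D) (at u)" and "inj D"
  shows "tangent_space S (\<phi> u) = range D"
proof
  have in': "\<phi> x \<in> S \<inter> W" if "x \<in> U" for x
    using hom that by (auto simp: homeomorphism_def)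
  obtain L where L: "bounded_linear L" "\<And>x. L (D x) = x"
    "(\<psi> has_derivative L) (at (\<phi> u) within (S \<inter> W))"
    using chart_inverse_has_derivative[OF hom \<open>u \<in> U\<close> D \<open>inj D\<close>] by blast
  have \<psi>u: "\<psi> (\<phi> u) = u" using hom \<open>u \<in> U\<close> by (simp add: homeomorphism_def)
  show "tangent_space S (\<phi> u) \<subseteq> range D"
  proof
    fix w assume "w \<in> tangent_space S (\<phi> u)"
    then obtain \<gamma> \<epsilon> where g: "\<epsilon> > 0" "\<forall>t\<in>{-\<epsilon><..<\<epsilon>}. \<gamma> t \<in> S" "\<gamma> 0 = \<phi> u"
      "(\<gamma> has_vector_derivative w) (at 0)"
      unfolding tangent_space_def by blast
    have g': "(\<gamma> has_derivative (\<lambda>x. x *\<^sub>R w)) (at 0)"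
      using g(4) by (simp add: has_vector_derivative_def)
    have "isCont \<gamma> 0" using g' has_derivative_continuous by blast
    then have "(\<gamma> \<longlongrightarrow> \<gamma> 0) (nhds 0)" by (simp add: isCont_def tendsto_at_iff_tendsto_nhds)
    then have "eventually (\<lambda>t. \<gamma> t \<in> W) (nhds 0)"
      using in'[OF \<open>u \<in> U\<close>] g(3) by (intro topological_tendstoD[OF _ \<open>open W\<close>]) auto
    then obtain A where A: "open A" "0 \<in> A" "\<And>t. t \<in> A \<Longrightarrow> \<gamma> t \<in> W"
      unfolding eventually_nhds by blast
    define A' where "A' = A \<inter> {-\<epsilon><..<\<epsilon>}"
    have A': "open A'" "0 \<in> A'" "\<And>t. t \<in> A' \<Longrightarrow> \<gamma> t \<in> S \<inter> W"
      using A g(1,2) by (auto simp: A'_def)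
    have "((\<lambda>t. \<psi> (\<gamma> t)) has_derivative (\<lambda>x. L (x *\<^sub>R w))) (at 0)"
      by (rule has_derivative_compose_into[OF _ g' A']) (use L(3) g(3) in auto)
    moreover have "(\<phi> has_derivative D) (at (\<psi> (\<gamma> 0)))" using D by (simp add: \<psi>u g(3))
    ultimately have "((\<lambda>t. \<phi> (\<psi> (\<gamma> t))) has_derivative (\<lambda>x. D (L (x *\<^sub>R w)))) (at 0)"
      by (rule has_derivative_compose)
    then have "(\<gamma> has_derivative (\<lambda>x. D (L (x *\<^sub>R w)))) (at 0)"
      by (rule has_derivative_transform_within_open[OF _ A'(1,2)])
         (use A'(3) hom in \<open>auto simp: homeomorphism_def\<close>)
    then have "(\<lambda>x. D (L (x *\<^sub>R w))) = (\<lambda>x. x *\<^sub>R w)"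
      by (rule has_derivative_unique[OF _ g'])
    from fun_cong[OF this, of 1] have "D (L w) = w" by simp
    then show "w \<in> range D" by (metis rangeI)
  qed
  show "range D \<subseteq> tangent_space S (\<phi> u)"
  proof clarify
    fix a
    define l where "l t = u + t *\<^sub>R a" for t :: real
    have l: "(l has_derivative (\<lambda>t. t *\<^sub>R a)) (at 0)"
      unfolding l_def by (auto intro!: derivative_eq_intros)
    have "(\<phi> has_derivative D) (at (l 0))" using D by (simp add: l_def)
    then have d: "((\<lambda>t. \<phi> (l t)) has_derivative (\<lambda>t. D (t *\<^sub>R a))) (at 0)"
      by (rule has_derivative_compose[OF l])
    have "D (t *\<^sub>R a) = t *\<^sub>R D a" for t
      using D by (simp add: has_derivative_linear linear_scale)
    with d have d: "((\<lambda>t. \<phi> (l t)) has_vector_derivative D a) (at 0)"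
      by (simp add: has_vector_derivative_def)
    have "open (l -` U)" by (rule open_vimage[OF \<open>open U\<close>]) (auto simp: l_def intro!: continuous_intros)
    moreover have "0 \<in> l -` U" using \<open>u \<in> U\<close> by (simp add: l_def)
    ultimately obtain e where e: "e > 0" "ball 0 e \<subseteq> l -` U" using open_contains_ball by blast
    have "t \<in> ball 0 e" if "t \<in> {-e<..<e}" for t
      using that by (auto simp: dist_real_def)
    then have "\<forall>t\<in>{-e<..<e}. \<phi> (l t) \<in> S"
      using in' e(2) by blast
    then show "D a \<in> tangent_space S (\<phi> u)"
      unfolding tangent_space_def
      using e(1) d by (intro CollectI exI[of _ "\<lambda>t. \<phi> (l t)"] exI[of _ e]) (auto simp: l_def)
  qed
qed

section \<open>The Lorentzian form and the tangent spaces of the hyperboloid\<close>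

interpretation lor: bounded_bilinear lor
proof -
  have "bilinear lor"
    unfolding bilinear_def by (auto intro!: linearI simp: lor_def algebra_simps)
  then show "bounded_bilinear lor" by (simp add: bilinear_conv_bounded_bilinear)
qed

lemmas lor_simps = lor.add_left lor.add_right lor.diff_left lor.diff_right lor.minus_left
  lor.minus_right lor.scaleR_left lor.scaleR_right lor.zero_left lor.zero_right

lemma lor_commute: "lor x y = lor y x"
  by (simp add: lor_def mult.commute)

text \<open>Cauchy-Schwarz for the first three coordinates, together with
  \<open>lor x x = -1\<close>, bounds their square sum for \<open>w\<close> by
  \<open>(x$4)^2 * lor w w\<close>. So the form is nonnegative on tangent vectors, and hyperbolic
  length controls Euclidean components up to the factor \<open>x$4\<close>.\<close>

lemma hyp3_orthogonal_bounds:
  assumes "x \<in> hyp3" "lor x w = 0"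
  shows "0 \<le> lor w w" "\<bar>w $ i\<bar> \<le> x$4 * sqrt (lor w w)" "\<bar>w $ 4\<bar> \<le> x$4 * sqrt (lor w w)"
    "\<bar>x $ i\<bar> \<le> x$4"
proof -
  define a where "a = (x$1)^2 + (x$2)^2 + (x$3)^2"
  define b where "b = (w$1)^2 + (w$2)^2 + (w$3)^2"
  have x4: "x$4 > 0" "a = (x$4)^2 - 1"
    using assms(1) by (auto simp: hyp3_def lor_def a_def power2_eq_square)
  have "(x$4 * w$4)^2 = (x$1 * w$1 + x$2 * w$2 + x$3 * w$3)^2"
    using assms(2) by (simp add: lor_def)
  also have "\<dots> \<le> a * b"
  proof -
    have "a * b - (x$1 * w$1 + x$2 * w$2 + x$3 * w$3)^2 =
      (x$1*w$2 - x$2*w$1)^2 + (x$1*w$3 - x$3*w$1)^2 + (x$2*w$3 - x$3*w$2)^2"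
      unfolding a_def b_def by (simp add: power2_eq_square algebra_simps)
    also have "\<dots> \<ge> 0" by simp
    finally show ?thesis by linarith
  qed
  finally have le: "(x$4)^2 * (w$4)^2 \<le> ((x$4)^2 - 1) * b"
    by (simp add: x4(2) power_mult_distrib)
  have b0: "b \<ge> 0" by (simp add: b_def)
  have lw: "lor w w = b - (w$4)^2" by (simp add: lor_def b_def power2_eq_square)
  have bl: "b \<le> (x$4)^2 * lor w w" using le by (simp add: lw algebra_simps)
  have "0 \<le> (x$4)^2 * lor w w" using bl b0 by linarith
  then show l0: "0 \<le> lor w w" using x4(1) by (simp add: zero_le_mult_iff)
  have w4: "(w$4)^2 \<le> (x$4)^2 * lor w w" using bl l0 by (simp add: lw)
  have i: "i = 1 \<or> i = 2 \<or> i = 3 \<or> i = 4" using exhaust_4 by auto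
  then have "(w$i)^2 \<le> (x$4)^2 * lor w w"
    using bl w4 zero_le_power2[of "w$1"] zero_le_power2[of "w$2"] zero_le_power2[of "w$3"]
    unfolding b_def by (elim disjE; hypsubst; linarith)
  then show "\<bar>w $ i\<bar> \<le> x$4 * sqrt (lor w w)"
    using x4(1) real_sqrt_le_mono[of "(w$i)^2" "(x$4)^2 * lor w w"] by (simp add: real_sqrt_mult)
  show "\<bar>w $ 4\<bar> \<le> x$4 * sqrt (lor w w)"
    using w4 x4(1) real_sqrt_le_mono[of "(w$4)^2" "(x$4)^2 * lor w w"] by (simp add: real_sqrt_mult)
  have "(x$i)^2 \<le> (x$4)^2"
    using i x4(2) zero_le_power2[of "x$1"] zero_le_power2[of "x$2"] zero_le_power2[of "x$3"]
    unfolding a_def by (elim disjE; hypsubst; linarith)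
  then show "\<bar>x $ i\<bar> \<le> x$4" using x4(1) abs_le_square_iff[of "x$i" "x$4"] by simp
qed

lemma hyp3_orthogonal_null:
  assumes "x \<in> hyp3" "lor x w = 0" "lor w w = 0"
  shows "w = 0"
proof (rule vec_eq_iff[THEN iffD2], intro allI)
  fix i
  show "w $ i = 0 $ i" using hyp3_orthogonal_bounds(2)[OF assms(1,2), of i] assms(3) by simp
qed

lemma lor_curve_orthogonal:
  assumes "(\<gamma> has_vector_derivative w) (at t)" "open A" "t \<in> A" "\<And>s. s \<in> A \<Longrightarrow> \<gamma> s \<in> hyp3"
  shows "lor (\<gamma> t) w = 0"
proof -
  have "((\<lambda>s. lor (\<gamma> s) (\<gamma> s)) has_vector_derivative (lor (\<gamma> t) w + lor w (\<gamma> t))) (at t)"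
    by (rule lor.has_vector_derivative[OF assms(1) assms(1)])
  moreover have "((\<lambda>s. lor (\<gamma> s) (\<gamma> s)) has_vector_derivative 0) (at t)"
    by (rule has_vector_derivative_transform_within_open[OF _ assms(2,3), of "\<lambda>_. -1"])
       (use assms(4) in \<open>auto simp: hyp3_def\<close>)
  ultimately show ?thesis
    using vector_derivative_unique_at lor_commute by fastforce
qed

lemma tangent_space_hyp3:
  assumes "q \<in> hyp3"
  shows "tangent_space hyp3 q = {w. lor q w = 0}"
proof (intro equalityI subsetI CollectI)
  fix w assume "w \<in> tangent_space hyp3 q"
  then obtain \<gamma> \<epsilon> where "\<epsilon> > 0" "\<forall>t\<in>{-\<epsilon><..<\<epsilon>}. \<gamma> t \<in> hyp3" "\<gamma> 0 = q"
    "(\<gamma> has_vector_derivative w) (at 0)"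
    unfolding tangent_space_def by blast
  then show "lor q w = 0" using lor_curve_orthogonal[of \<gamma> w 0 "{-\<epsilon><..<\<epsilon>}"] by auto
next
  fix w assume w: "w \<in> {w. lor q w = 0}"
  define k where "k = lor w w"
  \<comment> \<open>Central projection of the line through \<open>q\<close> in direction
    \<open>w\<close> onto the hyperboloid; on the line the form equals
    \<open>-1 + t^2 * k\<close>.\<close>
  define \<gamma> where "\<gamma> t = (1 / sqrt (1 - t^2 * k)) *\<^sub>R (q + t *\<^sub>R w)" for t
  have "((\<lambda>t::real. 1 - t^2 * k) \<longlongrightarrow> 1 - 0^2 * k) (at 0)"
    and "((\<lambda>t. q$4 + t * w$4) \<longlongrightarrow> q$4 + 0 * w$4) (at 0)"
    by (intro tendsto_intros)+
  moreover have "q$4 > 0" using assms by (simp add: hyp3_def)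
  ultimately have "eventually (\<lambda>t. 1 - t^2 * k > 0 \<and> q$4 + t * w$4 > 0) (at 0)"
    by (intro eventually_conj) (auto dest!: order_tendstoD(1)[where a=0])
  then have "eventually (\<lambda>t. 1 - t^2 * k > 0 \<and> q$4 + t * w$4 > 0) (nhds 0)"
    using \<open>q$4 > 0\<close> by (simp add: eventually_nhds_conv_at)
  then obtain e where e: "e > 0" "\<And>t. dist t 0 < e \<Longrightarrow> 1 - t^2 * k > 0 \<and> q$4 + t * w$4 > 0"
    unfolding eventually_nhds_metric by blast
  have "\<gamma> t \<in> hyp3" if "t \<in> {-e<..<e}" for t
  proof -
    have p: "1 - t^2 * k > 0" "q$4 + t * w$4 > 0" using e(2)[of t] that by auto
    have "lor (q + t *\<^sub>R w) (q + t *\<^sub>R w) = -1 + t^2 * k"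
      using w assms lor_commute[of w q] by (simp add: lor_simps hyp3_def k_def power2_eq_square algebra_simps)
    moreover have "lor (a *\<^sub>R z) (a *\<^sub>R z) = a^2 * lor z z" for a z
      by (simp add: lor_simps power2_eq_square)
    ultimately have "lor (\<gamma> t) (\<gamma> t) = (1 / sqrt (1 - t^2 * k))^2 * (-1 + t^2 * k)"
      by (simp only: \<gamma>_def)
    also have "\<dots> = -1" using p(1) by (simp add: power_divide divide_simps)
    finally show ?thesis using p by (simp add: hyp3_def \<gamma>_def)
  qed
  moreover have "(\<gamma> has_vector_derivative w) (at 0)"
    unfolding \<gamma>_def
    by (auto intro!: derivative_eq_intros simp: has_real_derivative_iff_has_vector_derivative[symmetric])
  ultimately show "w \<in> tangent_space hyp3 q"
    unfolding tangent_space_def using e(1)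
    by (intro CollectI exI[of _ \<gamma>] exI[of _ e]) (auto simp: \<gamma>_def)
qed

text \<open>Two candidates differ by a null vector orthogonal to \<open>q\<close>, and on such
  vectors the form is definite; this makes the definite description meaningful.\<close>

lemma tangential_part_eqI:
  assumes "q \<in> hyp3" "\<And>w. w \<in> V \<Longrightarrow> lor q w = 0" "\<And>w w'. w \<in> V \<Longrightarrow> w' \<in> V \<Longrightarrow> w - w' \<in> V"
    and "t \<in> V" "\<And>w. w \<in> V \<Longrightarrow> lor (u - t) w = 0"
  shows "tangential_part V u = t"
  unfolding tangential_part_def
proof (rule the_equality)
  show "t \<in> V \<and> (\<forall>w\<in>V. lor (u - t) w = 0)" using assms by blast
  fix s assume s: "s \<in> V \<and> (\<forall>w\<in>V. lor (u - s) w = 0)"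
  then have "s - t \<in> V" using assms by blast
  then have "lor (u - t) (s - t) - lor (u - s) (s - t) = 0" using s assms(5) by simp
  then have "lor (s - t) (s - t) = 0" by (simp add: lor_simps algebra_simps)
  then have "s - t = 0"
    using hyp3_orthogonal_null[OF assms(1)] assms(2) \<open>s - t \<in> V\<close> by blast
  then show "s = t" by simp
qed

lemma tangential_part_hyp3:
  "q \<in> hyp3 \<Longrightarrow> lor q u = 0 \<Longrightarrow> tangential_part (tangent_space hyp3 q) u = u"
  by (rule tangential_part_eqI) (auto simp: tangent_space_hyp3 lor_simps)

section \<open>Completeness\<close>

text \<open>Integrating the derivative of \<open>g\<close> along a path compares \<open>g\<close>
  with length. The factor 2 is what the quotients \<open>x$i / x$4\<close> require below.\<close>

lemma length_dominates:
  fixes g :: "real^4 \<Rightarrow> real"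
  assumes g: "\<And>x. x \<in> hyp3 \<Longrightarrow> (g has_derivative g' x) (at x)"
    and bd: "\<And>x w. x \<in> hyp3 \<Longrightarrow> lor x w = 0 \<Longrightarrow> \<bar>g' x w\<bar> \<le> 2 * sqrt (lor w w)"
    and S: "S \<subseteq> hyp3" and l: "l \<in> curve_lengths S p q"
  shows "\<bar>g q - g p\<bar> \<le> 2 * l"
proof -
  obtain \<gamma> where \<gamma>: "valid_path \<gamma>" "path_image \<gamma> \<subseteq> S" "pathstart \<gamma> = p" "pathfinish \<gamma> = q"
    "((\<lambda>t. sqrt (lor (vector_derivative \<gamma> (at t)) (vector_derivative \<gamma> (at t)))) has_integral l) {0..1}"
    using l by (auto simp: curve_lengths_def)
  obtain K where K: "finite K" "\<gamma> C1_differentiable_on ({0..1} - K)" and cont: "continuous_on {0..1} \<gamma>"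
    using \<gamma>(1) by (auto simp: valid_path_def piecewise_C1_differentiable_on_def)
  obtain D where D: "\<And>t. t \<in> {0..1} - K \<Longrightarrow> (\<gamma> has_vector_derivative D t) (at t)"
    using K(2) unfolding C1_differentiable_on_def by blast
  have hyp: "\<gamma> t \<in> hyp3" if "t \<in> {0..1}" for t
    using \<gamma>(2) S that unfolding path_image_def by blast
  \<comment> \<open>Besides the break points the end points are excluded: orthogonality of position
    and velocity is derived from a two-sided neighbourhood on which the path stays in
    \<open>hyp3\<close>.\<close>
  define K' where "K' = K \<union> {0, 1}"
  have K': "finite K'" using K(1) by (simp add: K'_def)
  have der: "((\<lambda>t. g (\<gamma> t)) has_vector_derivative g' (\<gamma> t) (D t)) (at t)" if "t \<in> {0<..<1} - K" for t
  proof -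
    have "(\<gamma> has_derivative (\<lambda>h. h *\<^sub>R D t)) (at t)" and g': "(g has_derivative g' (\<gamma> t)) (at (\<gamma> t))"
      using D[of t] g[OF hyp, of t] that by (auto simp: has_vector_derivative_def)
    from has_derivative_compose[OF this]
    show ?thesis
      using has_derivative_linear[OF g'] by (simp add: has_vector_derivative_def linear_scale)
  qed
  have "continuous_on {0..1} (\<lambda>t. g (\<gamma> t))"
    by (rule continuous_on_compose2[OF _ cont, of hyp3])
       (use hyp g in \<open>auto intro!: has_derivative_continuous_on intro: has_derivative_at_withinI\<close>)
  then have I: "((\<lambda>t. g' (\<gamma> t) (D t)) has_integral (g (\<gamma> 1) - g (\<gamma> 0))) {0..1}"
    using der by (intro fundamental_theorem_of_calculus_interior_strong[OF K(1)]) auto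
  define sp where "sp t = (if t \<in> K' then 0 else 2 * sqrt (lor (D t) (D t)))" for t
  define f where "f t = (if t \<in> K' then 0 else g' (\<gamma> t) (D t))" for t
  have f: "(f has_integral (g (\<gamma> 1) - g (\<gamma> 0))) {0..1}"
    by (rule has_integral_spike_finite[OF K' _ I]) (simp add: f_def)
  have sp: "(sp has_integral 2 * l) {0..1}"
  proof (rule has_integral_spike_finite[OF K' _ has_integral_mult_right[OF \<gamma>(5)]])
    fix t assume "t \<in> {0..1} - K'"
    then have "vector_derivative \<gamma> (at t) = D t"
      using D[of t] by (intro vector_derivative_at) (auto simp: K'_def)
    then show "sp t = 2 * sqrt (lor (vector_derivative \<gamma> (at t)) (vector_derivative \<gamma> (at t)))"
      using \<open>t \<in> {0..1} - K'\<close> by (simp add: sp_def)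
  qed
  have le: "\<bar>f t\<bar> \<le> sp t" if "t \<in> {0..1}" for t
  proof (cases "t \<in> K'")
    case False
    then have t: "t \<in> {0<..<1} - K" using that by (auto simp: K'_def)
    have "lor (\<gamma> t) (D t) = 0"
      by (rule lor_curve_orthogonal[of _ _ _ "{0<..<1}"]) (use t D[of t] hyp in auto)
    then show ?thesis using False bd[OF hyp[OF that]] by (simp add: f_def sp_def)
  qed (simp add: f_def sp_def)
  have "g (\<gamma> 1) - g (\<gamma> 0) \<le> 2 * l"
    by (rule has_integral_le[OF f sp]) (use le in force)
  moreover have "- (g (\<gamma> 1) - g (\<gamma> 0)) \<le> 2 * l"
    by (rule has_integral_le[OF has_integral_neg[OF f] sp]) (use le in force)
  ultimately show ?thesis
    using \<gamma>(3,4) by (simp add: pathstart_def pathfinish_def)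
qed

lemma intrinsic_dist_nonneg: "S \<subseteq> hyp3 \<Longrightarrow> 0 \<le> intrinsic_dist S p q"
  unfolding intrinsic_dist_def
  using length_dominates[of "\<lambda>_. 0" "\<lambda>_ _. 0" S _ p q]
  by (intro INF_greatest) (auto simp: hyp3_orthogonal_bounds)

lemma hyp3_ln_bound:
  assumes "x \<in> hyp3"
  shows "((\<lambda>x. ln (x$4)) has_derivative (\<lambda>w. w$4 / x$4)) (at x)"
    and "lor x w = 0 \<Longrightarrow> \<bar>w$4 / x$4\<bar> \<le> 2 * sqrt (lor w w)"
proof -
  have x4: "x$4 > 0" using assms by (simp add: hyp3_def)
  show "((\<lambda>x. ln (x$4)) has_derivative (\<lambda>w. w$4 / x$4)) (at x)"
    using x4 by (auto intro!: derivative_eq_intros bounded_linear_imp_has_derivative simp: field_simps)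
  assume "lor x w = 0"
  then have "\<bar>w$4\<bar> \<le> x$4 * sqrt (lor w w)" "0 \<le> lor w w"
    using hyp3_orthogonal_bounds[OF assms] by blast+
  moreover from this have "x$4 * sqrt (lor w w) \<le> x$4 * (2 * sqrt (lor w w))"
    using x4 by (intro mult_left_mono) auto
  ultimately show "\<bar>w$4 / x$4\<bar> \<le> 2 * sqrt (lor w w)"
    using x4 by (simp add: abs_divide pos_divide_le_eq mult_ac)
qed

lemma hyp3_quotient_bound:
  assumes "x \<in> hyp3"
  shows "((\<lambda>x. x$i / x$4) has_derivative (\<lambda>w. (w$i * x$4 - x$i * w$4) / (x$4)^2)) (at x)"
    and "lor x w = 0 \<Longrightarrow> \<bar>(w$i * x$4 - x$i * w$4) / (x$4)^2\<bar> \<le> 2 * sqrt (lor w w)"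
proof -
  have x4: "x$4 > 0" using assms by (simp add: hyp3_def)
  show "((\<lambda>x. x$i / x$4) has_derivative (\<lambda>w. (w$i * x$4 - x$i * w$4) / (x$4)^2)) (at x)"
    using x4 by (auto intro!: derivative_eq_intros bounded_linear_imp_has_derivative
        simp: field_simps power2_eq_square)
  assume "lor x w = 0"
  note b = hyp3_orthogonal_bounds[OF assms this]
  have "\<bar>w$i * x$4 - x$i * w$4\<bar> \<le> \<bar>w$i\<bar> * x$4 + \<bar>x$i\<bar> * \<bar>w$4\<bar>"
    using abs_triangle_ineq4[of "w$i * x$4" "x$i * w$4"] x4 by (simp add: abs_mult)
  also have "\<dots> \<le> (x$4 * sqrt (lor w w)) * x$4 + x$4 * (x$4 * sqrt (lor w w))"
    using b x4 by (intro add_mono mult_mono) auto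
  finally show "\<bar>(w$i * x$4 - x$i * w$4) / (x$4)^2\<bar> \<le> 2 * sqrt (lor w w)"
    using x4 by (simp add: abs_divide divide_le_eq power2_eq_square mult_ac)
qed

text \<open>By the two bounds above, \<open>ln x\<^sub>4\<close> and \<open>x\<^sub>i / x\<^sub>4\<close> are Lipschitz for the intrinsic distance, so that an
  intrinsic Cauchy sequence converges in \<open>real^4\<close>.\<close>

lemma complete_surfaceI:
  assumes S: "S \<subseteq> hyp3" "closed S"
    and loc: "\<And>x p. (\<And>n. x n \<in> S) \<Longrightarrow> p \<in> S \<Longrightarrow> x \<longlonglongrightarrow> p \<Longrightarrow> (\<lambda>n::nat. intrinsic_dist S (x n) p) \<longlonglongrightarrow> 0"
  shows "complete_surface S"
  unfolding complete_surface_def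
proof (intro allI impI, elim conjE)
  fix x :: "nat \<Rightarrow> real^4"
  assume x: "\<forall>n. x n \<in> S"
    and Cau: "\<forall>\<epsilon>>0. \<exists>M. \<forall>m\<ge>M. \<forall>n\<ge>M. intrinsic_dist S (x m) (x n) < ereal \<epsilon>"
  have conv: "convergent (\<lambda>n. g (x n))"
    if g: "\<And>x. x \<in> hyp3 \<Longrightarrow> (g has_derivative g' x) (at x)"
      "\<And>x w. x \<in> hyp3 \<Longrightarrow> lor x w = 0 \<Longrightarrow> \<bar>g' x w\<bar> \<le> 2 * sqrt (lor w w)" for g :: "real^4 \<Rightarrow> real" and g'
  proof (rule Cauchy_convergent, rule metric_CauchyI)
    fix e :: real assume "e > 0"
    then obtain M where M: "\<And>m n. m \<ge> M \<Longrightarrow> n \<ge> M \<Longrightarrow> intrinsic_dist S (x m) (x n) < ereal (e/2)"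
      using Cau by (meson half_gt_zero)
    have "dist (g (x m)) (g (x n)) < e" if mn: "m \<ge> M" "n \<ge> M" for m n
    proof -
      obtain l where "l \<in> curve_lengths S (x m) (x n)" "l < e/2"
        using M[OF mn] by (auto simp: intrinsic_dist_def INF_less_iff)
      moreover from this have "\<bar>g (x n) - g (x m)\<bar> \<le> 2 * l"
        using length_dominates[OF g S(1)] by blast
      ultimately show ?thesis unfolding dist_real_def by linarith
    qed
    then show "\<exists>M. \<forall>m\<ge>M. \<forall>n\<ge>M. dist (g (x m)) (g (x n)) < e" by blast
  qed
  obtain a where a: "(\<lambda>n. ln (x n $ 4)) \<longlonglongrightarrow> a"
    using conv[of "\<lambda>x. ln (x$4)" "\<lambda>x w. w$4 / x$4"] hyp3_ln_bound
    unfolding convergent_def by blast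
  have "\<exists>b. (\<lambda>n. x n $ i / x n $ 4) \<longlonglongrightarrow> b" for i
    using conv[of "\<lambda>x. x$i / x$4" "\<lambda>x w. (w$i * x$4 - x$i * w$4) / (x$4)^2"]
      hyp3_quotient_bound unfolding convergent_def by blast
  then obtain b where b: "\<And>i. (\<lambda>n. x n $ i / x n $ 4) \<longlonglongrightarrow> b i" by metis
  have "x n $ 4 > 0" for n using x S(1) by (auto simp: hyp3_def)
  then have eq: "x n $ i = x n $ i / x n $ 4 * exp (ln (x n $ 4))" for n i
    by (simp add: less_imp_neq[symmetric])
  have "(\<lambda>n. x n $ i) \<longlonglongrightarrow> b i * exp a" for i
    by (subst eq) (intro tendsto_intros a b)
  then have lim: "x \<longlonglongrightarrow> (\<chi> i. b i * exp a)"
    by (intro vec_tendstoI) simp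
  then have "(\<chi> i. b i * exp a) \<in> S"
    using closed_sequentially[OF S(2)] x by blast
  then show "\<exists>p\<in>S. (\<lambda>n. intrinsic_dist S (x n) p) \<longlonglongrightarrow> 0"
    using loc[of x, OF _ _ lim] x by blast
qed

text \<open>The comparison in the other direction. Near the limit a straight segment in the chart
  has an image of length at most a constant times its own, because the derivative is bounded on a
  compact ball and \<open>lor a a \<le> (norm a)^2\<close>.\<close>

lemma intrinsic_dist_chart_tendsto:
  fixes \<phi> :: "real \<times> real \<Rightarrow> real^4"
  assumes hom: "homeomorphism U (S \<inter> W) \<phi> \<psi>" and "open U" "open W" "Ck_on 1 U \<phi>" "S \<subseteq> hyp3"
    and p: "p \<in> S \<inter> W" and x: "\<And>n::nat. x n \<in> S" "x \<longlonglongrightarrow> p"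
  shows "(\<lambda>n. intrinsic_dist S (x n) p) \<longlonglongrightarrow> 0"
proof -
  define D where "D u = frechet_derivative \<phi> (at u)" for u
  have D: "(\<phi> has_derivative D u) (at u)" if "u \<in> U" for u
    unfolding D_def by (rule Ck_on_Suc_has_derivative[of 0]) (use assms that in auto)
  have contD: "continuous_on U (\<lambda>u. D u v)" for v
    using \<open>Ck_on 1 U \<phi>\<close> unfolding One_nat_def Ck_on.simps D_def by blast
  define u0 where "u0 = \<psi> p"
  have u0: "u0 \<in> U" "\<phi> u0 = p" using hom p by (auto simp: u0_def homeomorphism_def)
  obtain e where e: "e > 0" "cball u0 e \<subseteq> U"
    using \<open>open U\<close> u0(1) open_contains_cball by blast
  have "\<exists>K. \<forall>u\<in>cball u0 e. norm (D u v) \<le> K" for v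
    using compact_continuous_image[OF continuous_on_subset[OF contD e(2)], of v]
    by (auto dest!: compact_imp_bounded simp: bounded_iff)
  then obtain K where K: "\<And>u v. u \<in> cball u0 e \<Longrightarrow> norm (D u v) \<le> K v" by metis
  define c where "c = \<bar>K (1,0)\<bar> + \<bar>K (0,1)\<bar>"
  have bd: "norm (D u v) \<le> c * norm v" if u: "u \<in> cball u0 e" for u v
  proof -
    have lin: "linear (D u)" using D u e(2) has_derivative_linear by blast
    have "D u v = D u (fst v *\<^sub>R (1,0) + snd v *\<^sub>R (0,1))" by (simp add: scaleR_prod_def)
    also have "\<dots> = fst v *\<^sub>R D u (1,0) + snd v *\<^sub>R D u (0,1)"
      using lin by (simp only: linear_add linear_scale)
    finally have "norm (D u v) \<le> \<bar>fst v\<bar> * norm (D u (1,0)) + \<bar>snd v\<bar> * norm (D u (0,1))"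
      by (metis norm_scaleR norm_triangle_ineq)
    also have "\<dots> \<le> norm v * \<bar>K (1,0)\<bar> + norm v * \<bar>K (0,1)\<bar>"
      using K[OF u, of "(1,0)"] K[OF u, of "(0,1)"] norm_fst_le[of "fst v" "snd v"] norm_snd_le[of "snd v" "fst v"]
      by (intro add_mono mult_mono) (auto simp: prod.case_eq_if)
    finally show ?thesis by (simp add: c_def algebra_simps)
  qed
  have up: "intrinsic_dist S (\<phi> u) p \<le> ereal (c * norm (u0 - u))" if u: "u \<in> ball u0 e" for u
  proof -
    define l where "l t = u + t *\<^sub>R (u0 - u)" for t :: real
    define \<gamma> where "\<gamma> t = \<phi> (l t)" for t
    have lin: "l t \<in> cball u0 e" if "t \<in> {0..1}" for t
    proof -
      have "l t = (1 - t) *\<^sub>R u + t *\<^sub>R u0" by (simp add: l_def algebra_simps)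
      then show ?thesis
        using convex_cball[of u0 e] u that e(1) unfolding convex_alt
        by (metis atLeastAtMost_iff centre_in_cball less_imp_le mem_ball mem_cball)
    qed
    have contl: "continuous_on A l" for A by (auto simp: l_def intro!: continuous_intros)
    have der: "(\<gamma> has_vector_derivative D (l t) (u0 - u)) (at t)" if "t \<in> {0..1}" for t
    proof -
      have "(l has_derivative (\<lambda>h. h *\<^sub>R (u0 - u))) (at t)"
        unfolding l_def by (auto intro!: derivative_eq_intros)
      moreover have "l t \<in> U" using lin[OF that] e(2) by blast
      ultimately have "((\<lambda>x. \<phi> (l x)) has_derivative (\<lambda>x. D (l t) (x *\<^sub>R (u0 - u)))) (at t)"
        by (rule has_derivative_compose[OF _ D])
      then have "(\<gamma> has_derivative (\<lambda>h. D (l t) (h *\<^sub>R (u0 - u)))) (at t)" by (simp add: \<gamma>_def[abs_def])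
      moreover have "linear (D (l t))" using D lin[OF that] e(2) has_derivative_linear by blast
      ultimately show ?thesis by (simp add: has_vector_derivative_def linear_scale)
    qed
    have contd: "continuous_on {0..1} (\<lambda>t. D (l t) (u0 - u))"
      by (rule continuous_on_compose2[OF contD contl]) (use lin e(2) in auto)
    have "\<gamma> C1_differentiable_on {0..1}"
      unfolding C1_differentiable_on_def
      by (intro exI[of _ "\<lambda>t. D (l t) (u0 - u)"] conjI ballI der contd)
    then have vp: "valid_path \<gamma>" by (simp add: valid_path_def C1_differentiable_imp_piecewise)
    define sp where "sp t = sqrt (lor (D (l t) (u0 - u)) (D (l t) (u0 - u)))" for t
    have sp_eq: "sp t = sqrt (lor (vector_derivative \<gamma> (at t)) (vector_derivative \<gamma> (at t)))" if "t \<in> {0..1}" for t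
      by (simp only: vector_derivative_at[OF der[OF that]] sp_def)
    have "continuous_on {0..1} sp"
      unfolding sp_def by (intro continuous_intros lor.continuous_on contd)
    then have "(sp has_integral (integral {0..1} sp)) {0..1}"
      by (simp add: integrable_continuous_interval integrable_integral)
    moreover from this have "((\<lambda>t. sqrt (lor (vector_derivative \<gamma> (at t)) (vector_derivative \<gamma> (at t))))
        has_integral (integral {0..1} sp)) {0..1}"
      by (rule has_integral_eq[rotated]) (simp add: sp_eq)
    moreover have "path_image \<gamma> \<subseteq> S"
    proof
      fix y assume "y \<in> path_image \<gamma>"
      then obtain t where "t \<in> {0..1}" "y = \<phi> (l t)" by (auto simp: path_image_def \<gamma>_def)
      moreover from this have "l t \<in> U" using lin e(2) by blast
      ultimately show "y \<in> S" using hom by (auto simp: homeomorphism_def)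
    qed
    moreover have "pathstart \<gamma> = \<phi> u" "pathfinish \<gamma> = p"
      using u0 by (auto simp: pathstart_def pathfinish_def \<gamma>_def l_def)
    ultimately have mem: "integral {0..1} sp \<in> curve_lengths S (\<phi> u) p"
      unfolding curve_lengths_def using vp by blast
    have "lor a a \<le> (norm a)^2" for a :: "real^4"
      by (simp add: lor_def norm_vec_def L2_set_def sum_4 power2_eq_square)
    then have "sp t \<le> norm (D (l t) (u0 - u))" for t
      unfolding sp_def by (intro real_le_lsqrt) auto
    then have "sp t \<le> c * norm (u0 - u)" if "t \<in> {0..1}" for t
      using bd[OF lin[OF that]] order_trans by blast
    then have "integral {0..1} sp \<le> c * norm (u0 - u)"
      using has_integral_le[OF \<open>(sp has_integral (integral {0..1} sp)) {0..1}\<close>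
          has_integral_const_real[of "c * norm (u0 - u)" 0 1]] by simp
    then show ?thesis
      unfolding intrinsic_dist_def using mem by (meson INF_lower2 ereal_less_eq(3))
  qed
  have evW: "eventually (\<lambda>n. x n \<in> W) sequentially"
    using topological_tendstoD[OF x(2) \<open>open W\<close>] p by simp
  have "((\<lambda>n. \<psi> (x n)) \<longlongrightarrow> \<psi> p) sequentially"
  proof (rule continuous_on_tendsto_compose[OF _ x(2) p])
    show "continuous_on (S \<inter> W) \<psi>" using hom by (simp add: homeomorphism_def)
    show "eventually (\<lambda>n. x n \<in> S \<inter> W) sequentially" using evW x(1) by simp
  qed
  then have \<psi>: "(\<lambda>n. \<psi> (x n)) \<longlonglongrightarrow> u0" by (simp add: u0_def)
  then have "eventually (\<lambda>n. \<psi> (x n) \<in> ball u0 e) sequentially"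
    using topological_tendstoD[OF \<psi> open_ball, of u0 e] e(1) by simp
  then have "eventually (\<lambda>n. intrinsic_dist S (x n) p \<le> ereal (c * norm (u0 - \<psi> (x n)))) sequentially"
    using evW
  proof eventually_elim
    case (elim n)
    then have "\<phi> (\<psi> (x n)) = x n" using hom x(1) by (simp add: homeomorphism_def)
    then show ?case using up[OF elim(1)] by simp
  qed
  note up' = this
  have "(\<lambda>n. c * norm (u0 - \<psi> (x n))) \<longlonglongrightarrow> c * norm (u0 - u0)"
    by (intro tendsto_intros \<psi>)
  then have lim: "(\<lambda>n. ereal (c * norm (u0 - \<psi> (x n)))) \<longlonglongrightarrow> 0" by (simp add: zero_ereal_def)
  show ?thesis
    by (rule tendsto_sandwich[OF _ up' tendsto_const lim])
       (simp add: intrinsic_dist_nonneg[OF \<open>S \<subseteq> hyp3\<close>])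
qed

section \<open>The profile functions\<close>

lemma interval_integral_has_derivative:
  fixes f :: "real \<Rightarrow> real"
  assumes f: "continuous_on {a<..<b} f" and c: "c \<in> {a<..<b}" and x: "x \<in> {a<..<b}"
  shows "((\<lambda>u. LBINT y=c..u. f y) has_real_derivative f x) (at x)"
proof -
  define a' b' where "a' = (a + min c x) / 2" and "b' = (b + max c x) / 2"
  have ab: "a < a'" "a' < c" "a' < x" "c < b'" "x < b'" "b' < b"
    using c x by (auto simp: a'_def b'_def min_def max_def)
  have "((\<lambda>u. LBINT y=c..u. f y) has_vector_derivative f x) (at x within {a'..b'})"
    by (rule interval_integral_FTC2) (use ab f in \<open>auto intro: continuous_on_subset\<close>)
  then show ?thesis
    using ab at_within_Icc_at[of a' x b'] by (simp add: has_real_derivative_iff_has_vector_derivative)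
qed

definition radial_root :: "real \<Rightarrow> real \<Rightarrow> real" where
  "radial_root \<epsilon> y = (THE x. 0 < x \<and> 0 < x^6 + \<epsilon> \<and> x^2 * (x^6 + \<epsilon>) = y)"

lemma radial_poly_less:
  fixes x y \<epsilon> :: real
  assumes "0 < x" "0 < x^6 + \<epsilon>" "x < y"
  shows "x^2 * (x^6 + \<epsilon>) < y^2 * (y^6 + \<epsilon>)"
  using assms by (intro mult_strict_mono power_strict_mono add_strict_right_mono) auto

lemma radial_root_ex1:
  fixes y \<epsilon> :: real
  assumes "0 < y" "\<epsilon> \<in> {-1, 0, 1}"
  shows "\<exists>!x. 0 < x \<and> 0 < x^6 + \<epsilon> \<and> x^2 * (x^6 + \<epsilon>) = y"
proof (rule ex_ex1I)
  \<comment> \<open>The polynomial vanishes at \<open>a\<close>; for \<epsilon> = -1 this is its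
    positive zero 1. At \<open>b\<close> it is at least \<open>b\<close>, hence at least
    \<open>y\<close>.\<close>
  define a :: real where "a = (if \<epsilon> = -1 then 1 else 0)"
  define b where "b = 2 + y"
  have "a^2 * (a^6 + \<epsilon>) \<le> y" using assms by (auto simp: a_def)
  moreover have "y \<le> b^2 * (b^6 + \<epsilon>)"
  proof -
    have "1 \<le> b^6 + \<epsilon>" "b \<le> b^2"
      using assms power_increasing[of 1 6 b] self_le_power[of b 2] by (auto simp: b_def)
    then have "b * 1 \<le> b^2 * (b^6 + \<epsilon>)" using assms by (intro mult_mono) (auto simp: b_def)
    then show ?thesis using assms by (simp add: b_def)
  qed
  moreover have "a \<le> b" using assms by (auto simp: a_def b_def)
  moreover have "continuous_on {a..b} (\<lambda>x. x^2 * (x^6 + \<epsilon>))" by (intro continuous_intros)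
  ultimately obtain x where x: "a \<le> x" "x^2 * (x^6 + \<epsilon>) = y"
    using IVT'[of "\<lambda>x. x^2 * (x^6 + \<epsilon>)" a y b] by auto
  have "0 \<le> x" using x(1) by (auto simp: a_def split: if_splits)
  then have "0 < x" using x(2) assms(1) by (cases "x = 0") auto
  moreover have "0 < x^6 + \<epsilon>"
    using x(2) assms(1) \<open>0 < x\<close> by (simp add: zero_less_mult_iff flip: x(2))
  ultimately show "\<exists>x. 0 < x \<and> 0 < x^6 + \<epsilon> \<and> x^2 * (x^6 + \<epsilon>) = y" using x(2) by blast
next
  fix x x' assume "0 < x \<and> 0 < x^6 + \<epsilon> \<and> x^2 * (x^6 + \<epsilon>) = y"
    "0 < x' \<and> 0 < x'^6 + \<epsilon> \<and> x'^2 * (x'^6 + \<epsilon>) = y"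
  then show "x = x'"
    using radial_poly_less[of x \<epsilon> x'] radial_poly_less[of x' \<epsilon> x] by (cases x x' rule: linorder_cases) auto
qed

lemma radial_root:
  assumes "0 < y" "\<epsilon> \<in> {-1, 0, 1}"
  shows "0 < radial_root \<epsilon> y" "0 < (radial_root \<epsilon> y)^6 + \<epsilon>"
    "(radial_root \<epsilon> y)^2 * ((radial_root \<epsilon> y)^6 + \<epsilon>) = y"
  using theI'[OF radial_root_ex1[OF assms]] unfolding radial_root_def by blast+

lemma radial_root_eqI:
  assumes "\<epsilon> \<in> {-1, 0, 1}" "0 < x" "0 < x^6 + \<epsilon>" "x^2 * (x^6 + \<epsilon>) = y"
  shows "radial_root \<epsilon> y = x"
proof -
  have "0 < y" using assms by (auto simp flip: assms(4))
  then show ?thesis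
    using radial_root_ex1[of y \<epsilon>] radial_root[of y \<epsilon>] assms by blast
qed

lemma radial_root_deriv:
  assumes "0 < y" "\<epsilon> \<in> {-1, 0, 1}"
  defines "x \<equiv> radial_root \<epsilon> y"
  shows "(radial_root \<epsilon> has_real_derivative inverse (2 * x * (4 * x^6 + \<epsilon>))) (at y)"
proof (rule DERIV_inverse_function[where f = "\<lambda>x. x^2 * (x^6 + \<epsilon>)" and a = 0 and b = "y + 1"])
  note r = radial_root[OF assms(1,2), folded x_def]
  show "((\<lambda>x. x^2 * (x^6 + \<epsilon>)) has_real_derivative 2 * x * (4 * x^6 + \<epsilon>)) (at (radial_root \<epsilon> y))"
    unfolding x_def[symmetric]
    by (auto intro!: derivative_eq_intros simp: algebra_simps power_numeral_reduce)
  have "0 < x^6" using r(1) by simp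
  then have "0 < 4 * x^6 + \<epsilon>" using r(2) by linarith
  then show "2 * x * (4 * x^6 + \<epsilon>) \<noteq> 0" using r(1) by simp
  show "(radial_root \<epsilon> z)^2 * ((radial_root \<epsilon> z)^6 + \<epsilon>) = z" if "0 < z" "z < y + 1" for z
    using radial_root(3)[OF that(1) assms(2)] .
  show "isCont (radial_root \<epsilon>) y"
  proof -
    have "open {x::real. 0 < x \<and> 0 < x^6 + \<epsilon>}"
      by (intro open_Collect_conj open_Collect_less continuous_intros)
    moreover have "x \<in> {x. 0 < x \<and> 0 < x^6 + \<epsilon>}" using r by simp
    ultimately obtain d where d: "d > 0" "cball x d \<subseteq> {x. 0 < x \<and> 0 < x^6 + \<epsilon>}"
      using open_contains_cball by blast
    have "isCont (radial_root \<epsilon>) (x^2 * (x^6 + \<epsilon>))"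
    proof (rule isCont_inverse_function[where f = "\<lambda>z. z^2 * (z^6 + \<epsilon>)", OF d(1)])
      fix z assume "\<bar>z - x\<bar> \<le> d"
      then have "z \<in> {x. 0 < x \<and> 0 < x^6 + \<epsilon>}" using d(2) by (auto simp: dist_real_def abs_minus_commute)
      then show "radial_root \<epsilon> (z^2 * (z^6 + \<epsilon>)) = z" using radial_root_eqI[OF assms(2), of z] by simp
      show "isCont (\<lambda>z. z^2 * (z^6 + \<epsilon>)) z" by (intro continuous_intros)
    qed
    then show ?thesis by (simp add: r(3))
  qed
qed (use assms in auto)

locale radial =
  fixes \<epsilon> k :: real
  assumes eps: "\<epsilon> \<in> {-1, 0, 1}" and k_pos: "0 < k"
begin

text \<open>Here \<open>\<theta>\<close> is the angle between the profile curve and the direction of decreasing radius of the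
  parallels; \<open>S\<^sub>1\<close>, \<open>B\<close>, \<open>S\<^sub>2\<close> are \<open>\<theta> < \<pi>/2\<close>, \<open>\<theta> = \<pi>/2\<close>, \<open>\<theta> > \<pi>/2\<close>.  The radius is \<open>w\<^sup>3\<close>, \<open>K\<close> is the \<open>\<kappa>\<close>
  of the statement, \<open>M\<close> is \<open>\<mu> - \<mu>\<^sub>0\<^sub>1\<close> and \<open>\<sigma>\<close> is the speed of the profile curve.  A parallel has normal
  curvature \<open>P sin \<theta> / w\<^sup>3\<close> up to sign, with \<open>P\<^sup>2 = w\<^sup>6 + \<epsilon>\<close>; equating it to \<open>3 K = 3 k / w\<^sup>4\<close> gives the
  equation that defines \<open>w\<close>.\<close>

definition w :: "real \<Rightarrow> real" where "w \<theta> = radial_root \<epsilon> (9 * k^2 / (sin \<theta>)^2)"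
definition P :: "real \<Rightarrow> real" where "P \<theta> = 3 * k / (w \<theta> * sin \<theta>)"
definition Q :: "real \<Rightarrow> real" where "Q \<theta> = 4 * (w \<theta>)^6 + \<epsilon>"
definition K :: "real \<Rightarrow> real" where "K \<theta> = k / (w \<theta>)^4"
definition \<sigma> :: "real \<Rightarrow> real" where "\<sigma> \<theta> = 9 * k * (w \<theta>)^2 / ((sin \<theta>)^2 * Q \<theta>)"
definition M :: "real \<Rightarrow> real" where "M \<theta> = (LBINT t=pi/2..\<theta>. 3 * (w t)^3 / Q t)"
definition I :: "real set" where "I = {0<..<pi}"

lemma sin_pos: "\<theta> \<in> I \<Longrightarrow> 0 < sin \<theta>"
  by (simp add: I_def sin_gt_zero)

lemma w_props:
  assumes "\<theta> \<in> I"
  shows "0 < w \<theta>" "0 < (w \<theta>)^6 + \<epsilon>" "(w \<theta>)^2 * ((w \<theta>)^6 + \<epsilon>) = 9 * k^2 / (sin \<theta>)^2"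
  using radial_root[of "9 * k^2 / (sin \<theta>)^2", OF _ eps] sin_pos[OF assms] k_pos
  unfolding w_def by simp_all

lemma Q_pos: "\<theta> \<in> I \<Longrightarrow> 0 < Q \<theta>"
  using w_props(2)[of \<theta>] zero_less_power[OF w_props(1)[of \<theta>], of 6] unfolding Q_def by linarith

lemma P_pos: "\<theta> \<in> I \<Longrightarrow> 0 < P \<theta>"
  using w_props[of \<theta>] sin_pos[of \<theta>] k_pos by (simp add: P_def)

lemma P_square: "\<theta> \<in> I \<Longrightarrow> (P \<theta>)^2 = (w \<theta>)^6 + \<epsilon>"
  using w_props[of \<theta>] sin_pos[of \<theta>] by (simp add: P_def power_divide power_mult_distrib field_simps)

lemma K_pos: "\<theta> \<in> I \<Longrightarrow> 0 < K \<theta>"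
  using w_props[of \<theta>] k_pos by (simp add: K_def)

lemma \<sigma>_pos: "\<theta> \<in> I \<Longrightarrow> 0 < \<sigma> \<theta>"
  using w_props[of \<theta>] sin_pos[of \<theta>] Q_pos[of \<theta>] k_pos by (simp add: \<sigma>_def)

text \<open>Implicit differentiation of the defining equation. The derivative of
  \<open>x^2 * (x^6 + \<epsilon>)\<close> at \<open>w\<close> is \<open>2 * w * Q\<close>, which is
  where \<open>Q\<close> comes from.\<close>

lemma w_deriv:
  assumes "\<theta> \<in> I"
  shows "(w has_real_derivative - (9 * k^2 * cos \<theta>) / ((sin \<theta>)^3 * Q \<theta> * w \<theta>)) (at \<theta>)"
proof -
  have s: "sin \<theta> > 0" using sin_pos[OF assms] .
  have d: "((\<lambda>\<theta>. 9 * k^2 / (sin \<theta>)^2) has_real_derivative - (18 * k^2 * cos \<theta>) / (sin \<theta>)^3) (at \<theta>)"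
    using s by (auto intro!: derivative_eq_intros simp: field_simps power_numeral_reduce)
  have "0 < 9 * k^2 / (sin \<theta>)^2" using s k_pos by simp
  from DERIV_chain2[OF radial_root_deriv[OF this eps] d]
  have "(w has_real_derivative inverse (2 * w \<theta> * Q \<theta>) * (- (18 * k^2 * cos \<theta>) / (sin \<theta>)^3)) (at \<theta>)"
    by (simp add: w_def[abs_def] Q_def)
  also have "inverse (2 * w \<theta> * Q \<theta>) * (- (18 * k^2 * cos \<theta>) / (sin \<theta>)^3)
      = - (9 * k^2 * cos \<theta>) / ((sin \<theta>)^3 * Q \<theta> * w \<theta>)"
    by (simp add: field_simps)
  finally show ?thesis .
qed

lemma w_symmetric: "w (pi - \<theta>) = w \<theta>"
  by (simp add: w_def)

lemma continuous_on_w: "continuous_on I w"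
  using w_deriv by (intro DERIV_continuous_on) (auto intro: has_field_derivative_at_within)

lemma M_deriv: "\<theta> \<in> I \<Longrightarrow> (M has_real_derivative 3 * (w \<theta>)^3 / Q \<theta>) (at \<theta>)"
proof -
  assume "\<theta> \<in> I"
  have "Q t \<noteq> 0" if "t \<in> I" for t using Q_pos[OF that] by simp
  then have "continuous_on I (\<lambda>t. 3 * (w t)^3 / Q t)"
    unfolding Q_def by (intro continuous_intros continuous_on_w) auto
  then show ?thesis
    using \<open>\<theta> \<in> I\<close> unfolding M_def[abs_def] I_def
    by (intro interval_integral_has_derivative) auto
qed

lemma M_half_pi: "M (pi/2) = 0"
  by (simp add: M_def)

lemma M_less:
  assumes "a \<in> I" "b \<in> I" "a < b"
  shows "M a < M b"
proof (rule DERIV_pos_imp_increasing[OF assms(3)])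
  fix x assume "a \<le> x" "x \<le> b"
  then have "x \<in> I" using assms by (auto simp: I_def)
  then show "\<exists>y. (M has_real_derivative y) (at x) \<and> 0 < y"
    using M_deriv w_props Q_pos by (intro exI conjI) auto
qed

lemma inj_on_M: "inj_on M I"
  by (rule linorder_inj_onI) (use M_less in fastforce)+

text \<open>The radius depends on \<theta> only through sin \<theta>, so \<open>M\<close> has a
  slope symmetric about \<pi>/2 and vanishes there. This oddness is the passage from \<mu> to -\<mu>
  + 2 \<mu>01 between the two glued pieces.\<close>

lemma M_symmetric:
  assumes "\<theta> \<in> I"
  shows "M (pi - \<theta>) = - M \<theta>"
proof -
  have "((\<lambda>\<theta>. M (pi - \<theta>) + M \<theta>) has_real_derivative 0) (at x within I)" if "x \<in> I" for x
  proof -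
    have x': "pi - x \<in> I" using that by (auto simp: I_def)
    have "((\<lambda>\<theta>. pi - \<theta>) has_real_derivative -1) (at x)" by (auto intro!: derivative_eq_intros)
    from DERIV_chain2[OF M_deriv[OF x'] this]
    have "((\<lambda>\<theta>. M (pi - \<theta>)) has_real_derivative - (3 * (w x)^3 / Q x)) (at x)"
      by (simp add: w_symmetric Q_def)
    from DERIV_add[OF this M_deriv[OF that]] show ?thesis
      by (simp add: has_field_derivative_at_within)
  qed
  then obtain c where c: "\<And>x. x \<in> I \<Longrightarrow> M (pi - x) + M x = c"
    using has_field_derivative_zero_constant[of I "\<lambda>\<theta>. M (pi - \<theta>) + M \<theta>"] by (auto simp: I_def)
  have "pi/2 \<in> I" by (simp add: I_def)
  moreover have "pi - pi/2 = pi/2" by (simp add: field_simps)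
  ultimately have "c = 0" using c[of "pi/2"] M_half_pi by simp
  then show ?thesis using c[OF assms] by simp
qed

text \<open>For \<epsilon> = -1 one has \<open>w > 1\<close>, and \<open>Q - 3 * w^3\<close> factors
  as \<open>(4 * w^3 + 1) * (w^3 - 1)\<close>, so the slope of \<open>M\<close> lies strictly
  between 0 and 1. In this case \<open>M\<close> is a rotation angle, and the bound allows it to be
  recovered by \<open>arctan\<close>.\<close>

lemma M_bound:
  assumes "\<epsilon> = -1" "\<theta> \<in> I"
  shows "\<bar>M \<theta>\<bar> < pi/2"
proof -
  have slope: "0 < 3 * (w x)^3 / Q x \<and> 3 * (w x)^3 / Q x < 1" if "x \<in> I" for x
  proof -
    have "1 < w x"
    proof (rule ccontr)
      assume "\<not> 1 < w x"
      then have "(w x)^6 \<le> 1" using w_props(1)[OF that] by (intro power_le_one) auto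
      then show False using w_props(2)[OF that] assms(1) by simp
    qed
    then have "1 < (w x)^3" by (simp add: one_less_power)
    then have "0 < (4 * (w x)^3 + 1) * ((w x)^3 - 1)" by simp
    also have "\<dots> = 4 * (w x)^6 - 1 - 3 * (w x)^3"
      by (simp add: algebra_simps power_numeral_reduce)
    also have "\<dots> = Q x - 3 * (w x)^3" using assms(1) unfolding Q_def by linarith
    finally show ?thesis using Q_pos[OF that] w_props(1)[OF that] by simp
  qed
  have mvt: "\<bar>M b - M a\<bar> \<le> b - a" if "a < b" "a \<in> I" "b \<in> I" for a b
  proof -
    have "\<exists>z. a < z \<and> z < b \<and> M b - M a = (b - a) * (3 * (w z)^3 / Q z)"
      by (rule MVT2[OF that(1) M_deriv]) (use that in \<open>auto simp: I_def\<close>)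
    then obtain z where z: "a < z" "z < b" "M b - M a = (b - a) * (3 * (w z)^3 / Q z)" by blast
    then have s: "0 < 3 * (w z)^3 / Q z" "3 * (w z)^3 / Q z < 1"
      using slope[of z] that by (auto simp: I_def)
    have "(b - a) * (3 * (w z)^3 / Q z) \<le> (b - a) * 1"
      using s that(1) by (intro mult_left_mono) auto
    moreover have "0 \<le> (b - a) * (3 * (w z)^3 / Q z)"
      using s(1) that(1) by (intro mult_nonneg_nonneg) auto
    ultimately show ?thesis using z(3) by simp
  qed
  have "M \<theta> = 0" if "\<theta> = pi/2" using M_half_pi that by (simp only:)
  moreover have "\<theta> < pi/2 \<or> \<theta> = pi/2 \<or> pi/2 < \<theta>" by linarith
  ultimately show ?thesis
    using mvt[of \<theta> "pi/2"] mvt[of "pi/2" \<theta>] M_half_pi assms(2) by (auto simp: I_def)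
qed

lemma w_lower_bound: "\<exists>c>0. \<forall>\<theta>\<in>I. c \<le> w \<theta>"
\<comment> \<open>If \<open>w\<close> were below this threshold,
  \<open>w^2 * (w^6 + \<epsilon>)\<close> would be at most \<open>4 * k^2 * 2\<close>, whereas the
  defining equation makes it at least \<open>9 * k^2\<close>.\<close>
proof (intro exI[of _ "min 1 (2 * k)"] conjI ballI)
  fix \<theta> assume "\<theta> \<in> I"
  note w = w_props[OF this]
  show "min 1 (2 * k) \<le> w \<theta>"
  proof (rule ccontr)
    assume "\<not> min 1 (2 * k) \<le> w \<theta>"
    then have w1: "w \<theta> < 1" "w \<theta> < 2 * k" by auto
    have "(w \<theta>)^6 + \<epsilon> \<le> 2" using w1 w(1) power_le_one[of "w \<theta>" 6] eps by auto
    then have "(w \<theta>)^2 * ((w \<theta>)^6 + \<epsilon>) \<le> (2 * k)^2 * 2"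
      using w w1 by (intro mult_mono power_mono) auto
    moreover have "9 * k^2 \<le> 9 * k^2 / (sin \<theta>)^2"
      using sin_pos[OF \<open>\<theta> \<in> I\<close>] by (simp add: le_divide_eq mult_left_le power_le_one)
    moreover have "(2 * k)^2 = 4 * k^2" "0 < k^2" using k_pos by (auto simp: power_mult_distrib)
    ultimately show False using w(3) by linarith
  qed
qed (use k_pos in auto)

lemma \<sigma>_K: "\<theta> \<in> I \<Longrightarrow> \<sigma> \<theta> * K \<theta> = (P \<theta>)^2 / Q \<theta>"
  using w_props(1)[of \<theta>] sin_pos[of \<theta>] Q_pos[of \<theta>]
  by (simp add: P_def \<sigma>_def K_def field_simps power_numeral_reduce)

text \<open>The left side is the rate at which the frame \<open>h\<close>, \<open>e\<close> turns
  along the profile curve, and \<theta> itself grows at rate 1. The difference is speed times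
  curvature, so the identity says that the profile curve has curvature \<open>K\<close>.\<close>

lemma angle_speed_identity:
  assumes "\<theta> \<in> I"
  shows "\<sigma> \<theta> * (w \<theta>)^3 * sin \<theta> / P \<theta> = 1 - \<sigma> \<theta> * K \<theta>"
proof -
  have "\<sigma> \<theta> * (w \<theta>)^3 * sin \<theta> / P \<theta> = 3 * (w \<theta>)^6 / Q \<theta>"
    using w_props(1)[OF assms] sin_pos[OF assms] Q_pos[OF assms] k_pos
    by (simp add: \<sigma>_def P_def field_simps power_numeral_reduce)
  moreover have "\<sigma> \<theta> * K \<theta> = ((w \<theta>)^6 + \<epsilon>) / Q \<theta>" by (simp add: \<sigma>_K assms P_square)
  moreover have "3 * (w \<theta>)^6 / Q \<theta> + ((w \<theta>)^6 + \<epsilon>) / Q \<theta> = 1"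
    using Q_pos[OF assms] by (simp add: Q_def flip: add_divide_distrib)
  ultimately show ?thesis by linarith
qed

lemma w_deriv': "\<theta> \<in> I \<Longrightarrow> (w has_real_derivative - (\<sigma> \<theta> * P \<theta> * cos \<theta>) / (3 * (w \<theta>)^2)) (at \<theta>)"
  using w_deriv[of \<theta>] w_props(1)[of \<theta>] sin_pos[of \<theta>] Q_pos[of \<theta>]
  by (simp add: \<sigma>_def P_def field_simps power_numeral_reduce)

lemma w3_deriv: "\<theta> \<in> I \<Longrightarrow> ((\<lambda>\<theta>. (w \<theta>)^3) has_real_derivative - (\<sigma> \<theta> * P \<theta> * cos \<theta>)) (at \<theta>)"
  using w_props(1)[of \<theta>] by (auto intro!: derivative_eq_intros w_deriv')

text \<open>The quantity \<open>3 * k / w\<close> equals \<open>3 * K * w^3\<close>. It is the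
  product of \<open>n\<close> with the surface normal, hence the coefficient of the orbit vector in
  the transported normal.\<close>

lemma inverse_w_deriv:
  "\<theta> \<in> I \<Longrightarrow> ((\<lambda>\<theta>. 3 * k / w \<theta>) has_real_derivative \<sigma> \<theta> * K \<theta> * P \<theta> * cos \<theta>) (at \<theta>)"
  using w_props(1)[of \<theta>] 
  by (auto intro!: derivative_eq_intros w_deriv' simp: K_def field_simps power_numeral_reduce)

lemma P_sin: "\<theta> \<in> I \<Longrightarrow> P \<theta> * sin \<theta> = 3 * k / w \<theta>"
  using sin_pos[of \<theta>] by (simp add: P_def)

lemma inverse_P_deriv:
  assumes "\<theta> \<in> I"
  shows "((\<lambda>\<theta>. 1 / P \<theta>) has_real_derivative \<sigma> \<theta> * (w \<theta>)^3 * cos \<theta> / (P \<theta>)^2) (at \<theta>)"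
proof -
  note pos = w_props(1)[OF assms] sin_pos[OF assms] P_pos[OF assms] k_pos
  \<comment> \<open>This function is \<open>1 / P\<close> by definition of \<open>P\<close>, so no
    square root has to be differentiated.\<close>
  have "((\<lambda>\<theta>. w \<theta> * sin \<theta> / (3 * k)) has_real_derivative
      (- (\<sigma> \<theta> * P \<theta> * cos \<theta>) / (3 * (w \<theta>)^2) * sin \<theta> + w \<theta> * cos \<theta>) / (3 * k)) (at \<theta>)"
    using pos by (auto intro!: derivative_eq_intros w_deriv'[OF assms] simp: field_simps)
  also have "(- (\<sigma> \<theta> * P \<theta> * cos \<theta>) / (3 * (w \<theta>)^2) * sin \<theta> + w \<theta> * cos \<theta>) / (3 * k)
      = (1 - \<sigma> \<theta> * K \<theta>) * cos \<theta> * w \<theta> / (3 * k)"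
    using pos P_sin[OF assms] by (simp add: K_def field_simps power_numeral_reduce)
  also have "\<dots> = (\<sigma> \<theta> * (w \<theta>)^3 * sin \<theta> / P \<theta>) * cos \<theta> * w \<theta> / (3 * k)"
    by (simp only: angle_speed_identity[OF assms])
  also have "\<dots> = \<sigma> \<theta> * (w \<theta>)^3 * cos \<theta> / (P \<theta>)^2"
    using pos by (simp add: P_def field_simps power_numeral_reduce)
  finally show ?thesis by (simp add: P_def)
qed

text \<open>The factor cos \<theta> serves twice: it cancels the singularity of the integrand of
  \<mu>, and it makes the gradient of the mean curvature vanish on \<open>B\<close>.\<close>

lemma K_deriv:
  assumes "\<theta> \<in> I"
  shows "(K has_real_derivative 4 * \<sigma> \<theta> * K \<theta> * P \<theta> * cos \<theta> / (3 * (w \<theta>)^3)) (at \<theta>)"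
  unfolding K_def[abs_def]
  using w_props(1)[OF assms]
  by (auto intro!: derivative_eq_intros w_deriv'[OF assms] simp: K_def field_simps power_numeral_reduce)

lemma P_deriv:
  assumes "\<theta> \<in> I"
  shows "(P has_real_derivative - (\<sigma> \<theta> * (w \<theta>)^3 * cos \<theta>)) (at \<theta>)"
  using DERIV_inverse'[OF inverse_P_deriv[OF assms]] P_pos[OF assms]
  by (simp add: power2_eq_square)

text \<open>Two expressions for the component of the profile velocity along \<open>e\<close>: in
  each of the three models a change of \<open>M\<close> alone moves the point in direction
  \<open>e\<close> at rate \<open>P\<close>.\<close>

lemma M_slope: "\<theta> \<in> I \<Longrightarrow> 3 * (w \<theta>)^3 / Q \<theta> * P \<theta> = \<sigma> \<theta> * sin \<theta>"
  using w_props(1)[of \<theta>] sin_pos[of \<theta>] Q_pos[of \<theta>]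
  by (simp add: P_def \<sigma>_def field_simps power_numeral_reduce)

end

section \<open>One-parameter groups of isometries\<close>

text \<open>Solutions of \<open>D'' = 1 - \<epsilon> D\<close>, \<open>S = D'\<close>, \<open>C = S'\<close>: rotations, parabolic translations and boosts
  for \<open>\<epsilon> = 1, 0, -1\<close>.\<close>

definition Sg :: "real \<Rightarrow> real \<Rightarrow> real" where
  "Sg \<epsilon> v = (if \<epsilon> = 0 then v else if \<epsilon> > 0 then sin v else sinh v)"
definition Cg :: "real \<Rightarrow> real \<Rightarrow> real" where
  "Cg \<epsilon> v = (if \<epsilon> = 0 then 1 else if \<epsilon> > 0 then cos v else cosh v)"
definition Dg :: "real \<Rightarrow> real \<Rightarrow> real" where
  "Dg \<epsilon> v = (if \<epsilon> = 0 then v^2 / 2 else if \<epsilon> > 0 then 1 - cos v else cosh v - 1)"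

context
  fixes \<epsilon> :: real
  assumes eps: "\<epsilon> \<in> {-1, 0, 1}"
begin

lemma Cg_eq: "Cg \<epsilon> v = 1 - \<epsilon> * Dg \<epsilon> v"
  using eps by (auto simp: Cg_def Dg_def)

lemma Sg_square: "(Sg \<epsilon> v)^2 = 2 * Dg \<epsilon> v - \<epsilon> * (Dg \<epsilon> v)^2"
  using eps by (auto simp: Sg_def Dg_def sin_squared_eq sinh_square_eq power2_diff algebra_simps)

lemma Cg_Sg_square: "(Cg \<epsilon> v)^2 + \<epsilon> * (Sg \<epsilon> v)^2 = 1"
  using eps by (auto simp: Cg_def Sg_def cosh_square_eq)

lemma Dg_nonneg: "0 \<le> Dg \<epsilon> v"
  using eps cosh_real_ge_1[of v] by (auto simp: Dg_def)

lemma Dg_deriv: "(Dg \<epsilon> has_real_derivative Sg \<epsilon> v) (at v)"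
  using eps unfolding Dg_def[abs_def] Sg_def by (auto intro!: derivative_eq_intros)

lemma Sg_deriv: "(Sg \<epsilon> has_real_derivative Cg \<epsilon> v) (at v)"
  using eps unfolding Sg_def[abs_def] Cg_def by (auto intro!: derivative_eq_intros)

lemma Cg_deriv: "(Cg \<epsilon> has_real_derivative - \<epsilon> * Sg \<epsilon> v) (at v)"
  using eps unfolding Sg_def Cg_def[abs_def] by (auto intro!: derivative_eq_intros)

lemma Sg_diff: "Sg \<epsilon> (v - u) = Sg \<epsilon> v * Cg \<epsilon> u - Cg \<epsilon> v * Sg \<epsilon> u"
  using eps by (auto simp: Sg_def Cg_def sin_diff sinh_diff)

lemma Cg_diff: "Cg \<epsilon> (v - u) = Cg \<epsilon> v * Cg \<epsilon> u + \<epsilon> * Sg \<epsilon> v * Sg \<epsilon> u"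
  using eps by (auto simp: Sg_def Cg_def cos_diff cosh_diff)

lemma Dg_cong: "Sg \<epsilon> u = Sg \<epsilon> v \<Longrightarrow> Cg \<epsilon> u = Cg \<epsilon> v \<Longrightarrow> Dg \<epsilon> u = Dg \<epsilon> v"
  using eps by (auto simp: Sg_def Cg_def Dg_def)

text \<open>Rotations are reduced to one period; otherwise \<open>Sg\<close> is the identity or
  sinh, and |v| is at most |sinh v|. Thus bounded orbit coordinates come from bounded parameters, as
  compactness will require.\<close>

lemma Cg_Sg_small_representative:
  "\<exists>v'. \<bar>v'\<bar> \<le> pi + \<bar>Sg \<epsilon> v\<bar> \<and> Sg \<epsilon> v' = Sg \<epsilon> v \<and> Cg \<epsilon> v' = Cg \<epsilon> v"
proof (cases "\<epsilon> = 1")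
  case True
  obtain y where "- pi < y" "y \<le> pi" "sin y = sin v" "cos y = cos v"
    using sincos_principal_value[of v] by blast
  then show ?thesis using True by (intro exI[of _ y]) (auto simp: Sg_def Cg_def)
next
  case False
  have "\<bar>v\<bar> \<le> \<bar>sinh v\<bar>"
  proof -
    have mono: "y \<le> sinh y" if "0 \<le> y" for y :: real
    proof -
      have "sinh 0 - 0 \<le> sinh y - y"
        by (rule DERIV_nonneg_imp_nondecreasing[OF that, of "\<lambda>y. sinh y - y"])
           (auto intro!: derivative_eq_intros exI simp: cosh_real_ge_1)
      then show ?thesis by simp
    qed
    show ?thesis using mono[of v] mono[of "- v"] by (cases "0 \<le> v") auto
  qed
  then have "\<bar>v\<bar> \<le> pi + \<bar>Sg \<epsilon> v\<bar>"
    using False eps pi_gt_zero by (auto simp: Sg_def intro: order_trans)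
  then show ?thesis by blast
qed

text \<open>Only for rotations do several parameters give the same point; positivity of the cosine
  selects one within a quarter turn of \<open>u\<close>.\<close>

lemma Cg_Sg_near_representative:
  assumes "0 < Cg \<epsilon> (v - u)"
  shows "\<exists>v'. (\<epsilon> = 1 \<longrightarrow> \<bar>v' - u\<bar> < pi/2) \<and> Sg \<epsilon> v' = Sg \<epsilon> v \<and> Cg \<epsilon> v' = Cg \<epsilon> v"
proof (cases "\<epsilon> = 1")
  case True
  obtain y where y: "- pi < y" "y \<le> pi" "sin y = sin (v - u)" "cos y = cos (v - u)"
    using sincos_principal_value[of "v - u"] by blast
  have c: "0 < cos y" using assms True y by (simp add: Cg_def)
  have "\<bar>y\<bar> < pi/2"
  proof (rule ccontr)
    assume "\<not> \<bar>y\<bar> < pi/2"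
    then have "cos \<bar>y\<bar> \<le> cos (pi/2)" using y by (intro cos_monotone_0_pi_le) auto
    then show False using c by (simp add: cos_abs_real)
  qed
  moreover have "sin (u + y) = sin (u + (v - u))" "cos (u + y) = cos (u + (v - u))"
    by (simp_all only: sin_add cos_add y)
  ultimately show ?thesis using True by (intro exI[of _ "u + y"]) (auto simp: Sg_def Cg_def)
qed auto

text \<open>The quotients are tan, the identity and tanh, with inverses arctan, the identity and
  artanh; the window restricts tan to its principal branch.\<close>

lemma Sg_Cg_quotient_inverse:
  "\<exists>A. continuous_on ((\<lambda>v. Sg \<epsilon> v / Cg \<epsilon> v) ` {v. \<epsilon> = 1 \<longrightarrow> \<bar>v\<bar> < pi/2}) A \<and>
    (\<forall>v. (\<epsilon> = 1 \<longrightarrow> \<bar>v\<bar> < pi/2) \<longrightarrow> A (Sg \<epsilon> v / Cg \<epsilon> v) = v)"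
proof -
  consider "\<epsilon> = 1" | "\<epsilon> = 0" | "\<epsilon> = -1" using eps by auto
  then show ?thesis
  proof cases
    case 1
    have "arctan (sin v / cos v) = v" if "\<bar>v\<bar> < pi/2" for v
      using arctan_tan[of v] that by (simp add: tan_def abs_less_iff)
    then show ?thesis
      using 1 by (intro exI[of _ arctan]) (auto simp: Sg_def Cg_def intro!: continuous_intros)
  next
    case 2
    then show ?thesis by (intro exI[of _ id]) (auto simp: Sg_def Cg_def)
  next
    case 3
    have "continuous_on (range tanh) (artanh :: real \<Rightarrow> real)"
      by (rule continuous_on_artanh) (use tanh_real_bounds in auto)
    then show ?thesis
      using 3 by (intro exI[of _ artanh])
        (auto simp: Sg_def Cg_def tanh_def[symmetric] artanh_tanh_real)
  qed
qed

end

text \<open>Both the surface and its transported normal have this shape: a curve in the profile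
  plane plus a scalar function of \<theta> times the orbit vector.\<close>

lemma has_derivative_affine2:
  fixes a c :: "real \<Rightarrow> 'a::real_normed_vector"
  assumes a: "(a has_vector_derivative a') (at \<theta>)" and b: "(b has_real_derivative b') (at \<theta>)"
    and c: "(c has_vector_derivative c') (at v)"
  shows "((\<lambda>z. a (fst z) + b (fst z) *\<^sub>R c (snd z)) has_derivative
    (\<lambda>z. fst z *\<^sub>R (a' + b' *\<^sub>R c v) + snd z *\<^sub>R (b \<theta> *\<^sub>R c'))) (at (\<theta>, v))"
proof -
  have a': "((\<lambda>z. a (fst z)) has_derivative (\<lambda>z. fst z *\<^sub>R a')) (at (\<theta>, v))"
    by (rule has_derivative_compose[of fst fst])
       (use a in \<open>auto simp: has_vector_derivative_def intro!: bounded_linear_imp_has_derivative bounded_linear_fst\<close>)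
  have b': "((\<lambda>z. b (fst z)) has_derivative (\<lambda>z. fst z * b')) (at (\<theta>, v))"
    by (rule has_derivative_compose[of fst fst])
       (use b in \<open>auto simp: has_field_derivative_def mult_commute_abs intro!: bounded_linear_imp_has_derivative bounded_linear_fst\<close>)
  have c': "((\<lambda>z. c (snd z)) has_derivative (\<lambda>z. snd z *\<^sub>R c')) (at (\<theta>, v))"
    by (rule has_derivative_compose[of snd snd])
       (use c in \<open>auto simp: has_vector_derivative_def intro!: bounded_linear_imp_has_derivative bounded_linear_snd\<close>)
  show ?thesis
    by (rule has_derivative_eq_rhs[OF has_derivative_add[OF a' has_derivative_scaleR[OF b' c']]])
       (simp add: fun_eq_iff algebra_simps)
qed

section \<open>Biconservative surfaces generated by a profile curve\<close>

text \<open>The isometries \<open>lift v\<close> form a one-parameter group that fixes the vectors orthogonal to \<open>n\<close> and to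
  the second axis; it is elliptic, parabolic or hyperbolic for \<open>\<epsilon> = 1, 0, -1\<close>.  The profile curve \<open>\<gamma>\<close>
  lies in the hyperplane \<open>x$2 = 0\<close>, of which \<open>\<gamma>\<close>, \<open>h\<close>, \<open>e\<close> is a moving orthonormal frame, and \<open>w\<^sup>3 = lor n \<gamma>\<close>
  is the radius of the parallels.  The function \<open>\<zeta>\<close> recovers the parameter of the profile curve from a
  point of the surface; it makes the charts homeomorphisms.\<close>

abbreviation ax2 :: "real^4" where "ax2 \<equiv> axis 2 1"

lemma lor_ax2: "lor ax2 x = x $ 2" "lor x ax2 = x $ 2"
  by (simp_all add: lor_def axis_def)

locale profile = radial +
  fixes n :: "real^4" and \<gamma> e :: "real \<Rightarrow> real^4" and \<zeta> :: "real^4 \<Rightarrow> real"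
  assumes n2: "n $ 2 = 0" and n4: "n $ 4 \<le> 0" and nn: "lor n n = \<epsilon>"
    and \<gamma>2: "\<theta> \<in> I \<Longrightarrow> \<gamma> \<theta> $ 2 = 0" and \<gamma>4: "\<theta> \<in> I \<Longrightarrow> 0 < \<gamma> \<theta> $ 4" and e2: "\<theta> \<in> I \<Longrightarrow> e \<theta> $ 2 = 0"
    and \<gamma>\<gamma>: "\<theta> \<in> I \<Longrightarrow> lor (\<gamma> \<theta>) (\<gamma> \<theta>) = -1" and n\<gamma>: "\<theta> \<in> I \<Longrightarrow> lor n (\<gamma> \<theta>) = (w \<theta>)^3"
    and ee: "\<theta> \<in> I \<Longrightarrow> lor (e \<theta>) (e \<theta>) = 1" and ne: "\<theta> \<in> I \<Longrightarrow> lor n (e \<theta>) = 0"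
    and \<gamma>e: "\<theta> \<in> I \<Longrightarrow> lor (\<gamma> \<theta>) (e \<theta>) = 0"
    and \<gamma>_deriv0: "\<theta> \<in> I \<Longrightarrow> (\<gamma> has_vector_derivative
        \<sigma> \<theta> *\<^sub>R (sin \<theta> *\<^sub>R e \<theta> - (cos \<theta> / P \<theta>) *\<^sub>R (n + (w \<theta>)^3 *\<^sub>R \<gamma> \<theta>))) (at \<theta>)"
    and e_deriv0: "\<theta> \<in> I \<Longrightarrow> (e has_vector_derivative
        (3 * (w \<theta>)^3 / (Q \<theta> * P \<theta>)) *\<^sub>R (\<epsilon> *\<^sub>R \<gamma> \<theta> - (w \<theta>)^3 *\<^sub>R n)) (at \<theta>)"
    and \<zeta>_cont: "continuous_on
        {\<gamma> \<theta> + (w \<theta>)^3 *\<^sub>R (Sg \<epsilon> v *\<^sub>R ax2 - Dg \<epsilon> v *\<^sub>R n) | \<theta> v. \<theta> \<in> I} \<zeta>"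
    and \<zeta>_eq: "\<theta> \<in> I \<Longrightarrow> \<zeta> (\<gamma> \<theta> + (w \<theta>)^3 *\<^sub>R (Sg \<epsilon> v *\<^sub>R ax2 - Dg \<epsilon> v *\<^sub>R n)) = M \<theta>"
begin

text \<open>The normalized projection of \<open>n\<close> to the tangent space of the hyperboloid at
  \<gamma>: \<open>n + w^3 \<gamma>\<close> is orthogonal to \<gamma> and has squared length
  \<open>w^6 + \<epsilon> = P^2\<close>.\<close>

definition h :: "real \<Rightarrow> real^4" where "h \<theta> = (1 / P \<theta>) *\<^sub>R (n + (w \<theta>)^3 *\<^sub>R \<gamma> \<theta>)"
definition T :: "real \<Rightarrow> real^4" where "T \<theta> = sin \<theta> *\<^sub>R e \<theta> - cos \<theta> *\<^sub>R h \<theta>"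
definition \<nu> :: "real \<Rightarrow> real^4" where "\<nu> \<theta> = sin \<theta> *\<^sub>R h \<theta> + cos \<theta> *\<^sub>R e \<theta>"
text \<open>The displacement along the orbit of a point of the profile plane at radius 1;
  \<open>FF\<close> below is its derivative, the unit tangent of the parallels.\<close>

definition J :: "real \<Rightarrow> real^4" where "J v = Sg \<epsilon> v *\<^sub>R ax2 - Dg \<epsilon> v *\<^sub>R n"
definition FF :: "real \<Rightarrow> real^4" where "FF v = Cg \<epsilon> v *\<^sub>R ax2 - Sg \<epsilon> v *\<^sub>R n"
definition lift :: "real \<Rightarrow> real^4 \<Rightarrow> real^4" where
  "lift v x = x + lor n x *\<^sub>R J v + (x $ 2) *\<^sub>R (FF v - ax2)"
definition X :: "real \<times> real \<Rightarrow> real^4" where "X z = \<gamma> (fst z) + (w (fst z))^3 *\<^sub>R J (snd z)"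
definition TT :: "real \<times> real \<Rightarrow> real^4" where "TT z = lift (snd z) (T (fst z))"
definition NN :: "real \<times> real \<Rightarrow> real^4" where "NN z = lift (snd z) (\<nu> (fst z))"
definition surf :: "(real^4) set" where "surf = X ` (I \<times> UNIV)"

lemma n_decomp: "\<theta> \<in> I \<Longrightarrow> n = P \<theta> *\<^sub>R h \<theta> - (w \<theta>)^3 *\<^sub>R \<gamma> \<theta>"
  using P_pos[of \<theta>] by (simp add: h_def)

lemma \<gamma>_deriv: "\<theta> \<in> I \<Longrightarrow> (\<gamma> has_vector_derivative \<sigma> \<theta> *\<^sub>R T \<theta>) (at \<theta>)"
  using \<gamma>_deriv0 by (simp add: T_def h_def)

text \<open>The assumed equation involves the constant vector \<open>n\<close>; expanding
  \<open>n\<close> in \<gamma> and \<open>h\<close> turns it into an equation for the moving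
  frame.\<close>

lemma e_deriv:
  assumes "\<theta> \<in> I"
  shows "(e has_vector_derivative
    (\<sigma> \<theta> * sin \<theta>) *\<^sub>R \<gamma> \<theta> - (\<sigma> \<theta> * (w \<theta>)^3 * sin \<theta> / P \<theta>) *\<^sub>R h \<theta>) (at \<theta>)"
proof -
  note pos = w_props(1)[OF assms] sin_pos[OF assms] P_pos[OF assms] Q_pos[OF assms] k_pos
  have m: "3 * (w \<theta>)^3 / (Q \<theta> * P \<theta>) = \<sigma> \<theta> * sin \<theta> / (P \<theta>)^2"
    using pos by (simp add: P_def \<sigma>_def field_simps power_numeral_reduce)
  have "\<epsilon> *\<^sub>R \<gamma> \<theta> - (w \<theta>)^3 *\<^sub>R n = (\<epsilon> + (w \<theta>)^6) *\<^sub>R \<gamma> \<theta> - ((w \<theta>)^3 * P \<theta>) *\<^sub>R h \<theta>"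
    by (subst n_decomp[OF assms]) (simp add: algebra_simps power_numeral_reduce)
  then have "\<epsilon> *\<^sub>R \<gamma> \<theta> - (w \<theta>)^3 *\<^sub>R n = (P \<theta>)^2 *\<^sub>R \<gamma> \<theta> - ((w \<theta>)^3 * P \<theta>) *\<^sub>R h \<theta>"
    by (simp add: P_square[OF assms] add.commute)
  then have "(3 * (w \<theta>)^3 / (Q \<theta> * P \<theta>)) *\<^sub>R (\<epsilon> *\<^sub>R \<gamma> \<theta> - (w \<theta>)^3 *\<^sub>R n) =
    (\<sigma> \<theta> * sin \<theta>) *\<^sub>R \<gamma> \<theta> - (\<sigma> \<theta> * (w \<theta>)^3 * sin \<theta> / P \<theta>) *\<^sub>R h \<theta>"
    using pos unfolding m by (simp add: scaleR_diff_right power2_eq_square)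
  then show ?thesis using e_deriv0[OF assms] by simp
qed

lemma h_deriv:
  assumes "\<theta> \<in> I"
  shows "(h has_vector_derivative
    (\<sigma> \<theta> * (w \<theta>)^3 * sin \<theta> / P \<theta>) *\<^sub>R e \<theta> - (\<sigma> \<theta> * cos \<theta>) *\<^sub>R \<gamma> \<theta>) (at \<theta>)"
proof -
  note pos = P_pos[OF assms]
  let ?u = "(1 / P \<theta>) *\<^sub>R ((w \<theta>)^3 *\<^sub>R (\<sigma> \<theta> *\<^sub>R T \<theta>) + (- (\<sigma> \<theta> * P \<theta> * cos \<theta>)) *\<^sub>R \<gamma> \<theta>)"
  have "((\<lambda>\<theta>. n + (w \<theta>)^3 *\<^sub>R \<gamma> \<theta>) has_vector_derivative
      (w \<theta>)^3 *\<^sub>R (\<sigma> \<theta> *\<^sub>R T \<theta>) + (- (\<sigma> \<theta> * P \<theta> * cos \<theta>)) *\<^sub>R \<gamma> \<theta>) (at \<theta>)"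
    using has_vector_derivative_add[OF has_vector_derivative_const
      has_vector_derivative_scaleR[OF w3_deriv[OF assms] \<gamma>_deriv[OF assms]]] by simp
  from has_vector_derivative_scaleR[OF inverse_P_deriv[OF assms] this]
  have "(h has_vector_derivative ?u
     + (\<sigma> \<theta> * (w \<theta>)^3 * cos \<theta> / (P \<theta>)^2) *\<^sub>R (n + (w \<theta>)^3 *\<^sub>R \<gamma> \<theta>)) (at \<theta>)"
    by (simp add: h_def[abs_def])
  moreover have "n + (w \<theta>)^3 *\<^sub>R \<gamma> \<theta> = P \<theta> *\<^sub>R h \<theta>" using pos by (simp add: h_def)
  ultimately have "(h has_vector_derivative ?u
     + (\<sigma> \<theta> * (w \<theta>)^3 * cos \<theta> / (P \<theta>)^2) *\<^sub>R (P \<theta> *\<^sub>R h \<theta>)) (at \<theta>)" by simp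
  moreover have "?u
     + (\<sigma> \<theta> * (w \<theta>)^3 * cos \<theta> / (P \<theta>)^2) *\<^sub>R (P \<theta> *\<^sub>R h \<theta>)
     = (\<sigma> \<theta> * (w \<theta>)^3 * sin \<theta> / P \<theta>) *\<^sub>R e \<theta> - (\<sigma> \<theta> * cos \<theta>) *\<^sub>R \<gamma> \<theta>"
    using pos by (simp add: T_def algebra_simps power2_eq_square)
  ultimately show ?thesis by simp
qed

text \<open>In the plane of \<open>h\<close> and \<open>e\<close> the normal turns by the rate of
  the frame minus the rate 1 of \<theta>, the \<gamma>-components cancelling. The result is a
  multiple of \<open>T\<close>, so the profile curve is a line of curvature.\<close>

lemma \<nu>_deriv:
  assumes "\<theta> \<in> I"
  shows "(\<nu> has_vector_derivative - (\<sigma> \<theta> * K \<theta>) *\<^sub>R T \<theta>) (at \<theta>)"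
proof -
  define A where "A = \<sigma> \<theta> * (w \<theta>)^3 * sin \<theta> / P \<theta>"
  let ?u = "(sin \<theta> *\<^sub>R (A *\<^sub>R e \<theta> - (\<sigma> \<theta> * cos \<theta>) *\<^sub>R \<gamma> \<theta>) + cos \<theta> *\<^sub>R h \<theta>) +
      (cos \<theta> *\<^sub>R ((\<sigma> \<theta> * sin \<theta>) *\<^sub>R \<gamma> \<theta> - A *\<^sub>R h \<theta>) + (- sin \<theta>) *\<^sub>R e \<theta>)"
  have "(\<nu> has_vector_derivative ?u) (at \<theta>)"
    unfolding \<nu>_def[abs_def] A_def
    by (intro has_vector_derivative_add has_vector_derivative_scaleR h_deriv e_deriv assms DERIV_sin DERIV_cos)
  moreover have "?u = (A - 1) *\<^sub>R T \<theta>"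
    by (simp add: T_def algebra_simps)
  moreover have "A - 1 = - (\<sigma> \<theta> * K \<theta>)" using angle_speed_identity[OF assms] by (simp add: A_def)
  ultimately show ?thesis by simp
qed

lemma T2: "\<theta> \<in> I \<Longrightarrow> T \<theta> $ 2 = 0" and \<nu>2: "\<theta> \<in> I \<Longrightarrow> \<nu> \<theta> $ 2 = 0"
  by (simp_all add: h_def T_def \<nu>_def n2 \<gamma>2 e2)

lemma lor_h:
  assumes "\<theta> \<in> I"
  shows "lor (h \<theta>) (h \<theta>) = 1" "lor (\<gamma> \<theta>) (h \<theta>) = 0" "lor (h \<theta>) (e \<theta>) = 0" "lor n (h \<theta>) = P \<theta>"
proof -
  have P: "P \<theta> * P \<theta> = (w \<theta>)^6 + \<epsilon>" "P \<theta> \<noteq> 0"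
    using P_square[OF assms] P_pos[OF assms] by (auto simp: power2_eq_square)
  have g: "lor (\<gamma> \<theta>) n = (w \<theta>)^3" using n\<gamma>[OF assms] lor_commute by metis
  have ww: "(w \<theta>)^3 * (w \<theta>)^3 = (w \<theta>)^6" by (simp add: power_numeral_reduce)
  show nh: "lor n (h \<theta>) = P \<theta>"
    using P by (simp add: h_def lor_simps nn n\<gamma>[OF assms] ww divide_simps mult.commute)
  show gh: "lor (\<gamma> \<theta>) (h \<theta>) = 0"
    by (simp add: h_def lor_simps g \<gamma>\<gamma>[OF assms])
  show "lor (h \<theta>) (e \<theta>) = 0"
    by (simp add: h_def lor_simps ne[OF assms] \<gamma>e[OF assms])
  have "lor (h \<theta>) (h \<theta>) = (1 / P \<theta>) * (lor n (h \<theta>) + (w \<theta>)^3 * lor (\<gamma> \<theta>) (h \<theta>))"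
    by (subst (1) h_def) (simp only: lor_simps real_scaleR_def)
  then show "lor (h \<theta>) (h \<theta>) = 1" using P by (simp add: nh gh)
qed

lemma lor_frame:
  assumes "\<theta> \<in> I"
  shows "lor (T \<theta>) (T \<theta>) = 1" "lor (\<nu> \<theta>) (\<nu> \<theta>) = 1" "lor (T \<theta>) (\<nu> \<theta>) = 0"
    "lor (\<gamma> \<theta>) (T \<theta>) = 0" "lor (\<gamma> \<theta>) (\<nu> \<theta>) = 0"
    "lor n (T \<theta>) = - (P \<theta> * cos \<theta>)" "lor n (\<nu> \<theta>) = 3 * k / w \<theta>"
proof -
  note l = lor_h[OF assms] lor_h(3)[OF assms, unfolded lor_commute[of "h \<theta>"]] ee[OF assms] ne[OF assms] \<gamma>e[OF assms]
  have sc: "sin \<theta> * sin \<theta> + cos \<theta> * cos \<theta> = 1"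
    using sin_cos_squared_add[of \<theta>] by (simp add: power2_eq_square)
  show "lor (T \<theta>) (T \<theta>) = 1" "lor (\<nu> \<theta>) (\<nu> \<theta>) = 1" "lor (T \<theta>) (\<nu> \<theta>) = 0"
    "lor (\<gamma> \<theta>) (T \<theta>) = 0" "lor (\<gamma> \<theta>) (\<nu> \<theta>) = 0"
    "lor n (T \<theta>) = - (P \<theta> * cos \<theta>)" "lor n (\<nu> \<theta>) = 3 * k / w \<theta>"
    using sc P_sin[OF assms] by (simp_all add: T_def \<nu>_def lor_simps l algebra_simps)
qed

text \<open>By bilinearity this reduces to \<open>Cg = 1 - \<epsilon> * Dg\<close> and
  \<open>Sg^2 = 2 * Dg - \<epsilon> * Dg^2\<close>. Afterwards every relation between frame vectors
  needs checking only on the profile curve.\<close>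

lemma lor_lift: "lor (lift v x) (lift v y) = lor x y"
proof -
  have nx: "lor x n = lor n x" "lor y n = lor n y" using lor_commute by blast+
  note C = Cg_eq[OF eps, of v]
  have S: "Sg \<epsilon> v * Sg \<epsilon> v = 2 * Dg \<epsilon> v - \<epsilon> * Dg \<epsilon> v * Dg \<epsilon> v"
    using Sg_square[OF eps, of v] by (simp add: power2_eq_square)
  have JJ: "lor (J v) (J v) = 2 * Dg \<epsilon> v" 
    and JF: "lor (J v) (FF v - ax2) = 0" "lor (FF v - ax2) (J v) = 0"
    and F2: "lor (FF v - ax2) (FF v - ax2) = 2 * \<epsilon> * Dg \<epsilon> v"
    by (simp_all add: J_def FF_def lor_simps lor_ax2 n2 nn C S algebra_simps)
  have xJ: "lor z (J v) = Sg \<epsilon> v * z$2 - Dg \<epsilon> v * lor n z" "lor (J v) z = Sg \<epsilon> v * z$2 - Dg \<epsilon> v * lor n z"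
    and xF: "lor z (FF v - ax2) = - (\<epsilon> * Dg \<epsilon> v * z$2) - Sg \<epsilon> v * lor n z"
      "lor (FF v - ax2) z = - (\<epsilon> * Dg \<epsilon> v * z$2) - Sg \<epsilon> v * lor n z" for z
    by (simp_all add: J_def FF_def lor_simps lor_ax2 C lor_commute[of z n] algebra_simps)
  define G where "G = FF v - ax2"
  note l = JF[folded G_def] F2[folded G_def] xJ[of x] xJ[of y] xF[folded G_def, of x] xF[folded G_def, of y]
  show ?thesis
    unfolding lift_def G_def[symmetric]
    by (simp add: lor.add_left lor.add_right lor.scaleR_left lor.scaleR_right JJ l algebra_simps)
qed

lemma lift_plane: "x $ 2 = 0 \<Longrightarrow> lift v x = x + lor n x *\<^sub>R J v"
  by (simp add: lift_def)

lemma lift_ax2: "lift v ax2 = FF v"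
  by (simp add: lift_def lor_ax2 n2)

lemma X_eq_lift: "fst z \<in> I \<Longrightarrow> X z = lift (snd z) (\<gamma> (fst z))"
  by (simp add: X_def lift_plane \<gamma>2 n\<gamma>)

lemma frame:
  assumes "fst z \<in> I"
  shows "lor (X z) (X z) = -1" "lor (TT z) (TT z) = 1" "lor (NN z) (NN z) = 1" "lor (FF (snd z)) (FF (snd z)) = 1"
    "lor (X z) (TT z) = 0" "lor (X z) (NN z) = 0" "lor (X z) (FF (snd z)) = 0"
    "lor (TT z) (NN z) = 0" "lor (TT z) (FF (snd z)) = 0" "lor (NN z) (FF (snd z)) = 0"
  using assms unfolding X_eq_lift[OF assms] TT_def NN_def lift_ax2[symmetric] lor_lift
  by (simp_all add: \<gamma>\<gamma> lor_frame lor_ax2 \<gamma>2 T2 \<nu>2)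

lemma J_deriv: "(J has_vector_derivative FF v) (at v)"
  unfolding J_def[abs_def] FF_def
  by (rule derivative_eq_intros Sg_deriv[OF eps] Dg_deriv[OF eps] | simp)+

lemma X_deriv:
  assumes "fst z \<in> I"
  shows "(X has_derivative (\<lambda>x. fst x *\<^sub>R (\<sigma> (fst z) *\<^sub>R TT z) + snd x *\<^sub>R ((w (fst z))^3 *\<^sub>R FF (snd z)))) (at z)"
proof -
  \<comment> \<open>Transport adds \<open>lor n T = - (P * cos \<theta>)\<close> times
    \<open>J\<close> to \<open>T\<close>; multiplied by the speed this is the derivative of the
    radius \<open>w^3\<close>, so the transported tangent is the \<theta>-derivative of
    \<open>X\<close> divided by the speed.\<close>
  have "\<sigma> (fst z) *\<^sub>R TT z = \<sigma> (fst z) *\<^sub>R T (fst z) + (- (\<sigma> (fst z) * P (fst z) * cos (fst z))) *\<^sub>R J (snd z)"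
    by (simp add: TT_def lift_plane T2 assms lor_frame algebra_simps)
  then show ?thesis
    using has_derivative_affine2[OF \<gamma>_deriv[OF assms] w3_deriv[OF assms] J_deriv[of "snd z"]]
    by (simp add: X_def[abs_def])
qed

text \<open>Both partial derivatives are multiples of those of \<open>X\<close>, with factors
  \<open>- K\<close> and \<open>3 * K\<close>: meridians and parallels are lines of
  curvature.\<close>

lemma NN_deriv:
  assumes "fst z \<in> I"
  shows "(NN has_derivative (\<lambda>x. fst x *\<^sub>R (- (\<sigma> (fst z) * K (fst z)) *\<^sub>R TT z)
      + snd x *\<^sub>R ((3 * k / w (fst z)) *\<^sub>R FF (snd z)))) (at z)"
proof -
  have "- (\<sigma> (fst z) * K (fst z)) *\<^sub>R TT z = - (\<sigma> (fst z) * K (fst z)) *\<^sub>R T (fst z)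
      + (\<sigma> (fst z) * K (fst z) * P (fst z) * cos (fst z)) *\<^sub>R J (snd z)"
    by (simp add: TT_def lift_plane T2 assms lor_frame algebra_simps)
  then have "((\<lambda>z. \<nu> (fst z) + (3 * k / w (fst z)) *\<^sub>R J (snd z)) has_derivative
      (\<lambda>x. fst x *\<^sub>R (- (\<sigma> (fst z) * K (fst z)) *\<^sub>R TT z)
      + snd x *\<^sub>R ((3 * k / w (fst z)) *\<^sub>R FF (snd z)))) (at z)"
    using has_derivative_affine2[OF \<nu>_deriv[OF assms] inverse_w_deriv[OF assms] J_deriv[of "snd z"]]
    by simp
  moreover have "open (I \<times> (UNIV::real set))" by (simp add: I_def open_Times)
  moreover have "z \<in> I \<times> UNIV" using assms by (simp add: mem_Times_iff)
  ultimately show ?thesis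
    by (rule has_derivative_transform_within_open) (auto simp: NN_def lift_plane \<nu>2 lor_frame)
qed

text \<open>A bootstrap: the derivatives of \<open>w\<close>, \<gamma> and \<open>e\<close> are
  expressed through these same functions and sin, cos, with nonzero denominators, so continuity
  propagates to every order. The group functions form a closed system in the same way.\<close>

lemma X_smooth:
  assumes "open U" "U \<subseteq> I \<times> UNIV"
  shows "Ck_on m U X"
proof -
  note real_vec = has_real_derivative_iff_has_vector_derivative[symmetric]
  have in_I: "fst x \<in> I" if "x \<in> U" for x using assms(2) that by auto
  have trig: "Ck_on m U (\<lambda>x. Sg \<epsilon> (snd x)) \<and> Ck_on m U (\<lambda>x. Cg \<epsilon> (snd x)) \<and> Ck_on m U (\<lambda>x. Dg \<epsilon> (snd x))
      \<and> Ck_on m U (\<lambda>x. sin (fst x)) \<and> Ck_on m U (\<lambda>x. cos (fst x))"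
  proof (induction m)
    case 0
    have "isCont (Sg \<epsilon>) v" "isCont (Cg \<epsilon>) v" "isCont (Dg \<epsilon>) v" for v
      using Sg_deriv[OF eps] Cg_deriv[OF eps] Dg_deriv[OF eps] DERIV_isCont by blast+
    then have "continuous_on UNIV (Sg \<epsilon>)" "continuous_on UNIV (Cg \<epsilon>)" "continuous_on UNIV (Dg \<epsilon>)"
      by (simp_all add: continuous_at_imp_continuous_on)
    then show ?case
      by (auto intro!: continuous_intros intro: continuous_on_compose2[of UNIV _ U snd])
  next
    case (Suc m)
    have "Ck_on (Suc m) U (\<lambda>x. Sg \<epsilon> (snd x))"
      by (rule Ck_on_Suc_snd[OF assms(1), of _ "Cg \<epsilon>"])
         (use Suc Sg_deriv[OF eps] in \<open>auto simp: real_vec\<close>)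
    moreover have "Ck_on (Suc m) U (\<lambda>x. Dg \<epsilon> (snd x))"
      by (rule Ck_on_Suc_snd[OF assms(1), of _ "Sg \<epsilon>"])
         (use Suc Dg_deriv[OF eps] in \<open>auto simp: real_vec\<close>)
    moreover have "Ck_on (Suc m) U (\<lambda>x. Cg \<epsilon> (snd x))"
      by (rule Ck_on_Suc_snd[OF assms(1), of _ "\<lambda>v. - \<epsilon> * Sg \<epsilon> v"])
         (use Suc Cg_deriv[OF eps] in \<open>auto simp: real_vec
            intro!: Ck_on_intros assms(1)\<close>)
    moreover have "Ck_on (Suc m) U (\<lambda>x. sin (fst x))"
      by (rule Ck_on_Suc_fst[OF assms(1), of _ cos])
         (use Suc in \<open>auto simp: real_vec\<close>)
    moreover have "Ck_on (Suc m) U (\<lambda>x. cos (fst x))"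
      by (rule Ck_on_Suc_fst[OF assms(1), of _ "\<lambda>x. - sin x"])
         (use Suc in \<open>auto simp: real_vec
            intro!: Ck_on_intros assms(1)\<close>)
    ultimately show ?case by blast
  qed
  have "Ck_on m U (\<lambda>x. w (fst x)) \<and> Ck_on m U (\<lambda>x. \<gamma> (fst x)) \<and> Ck_on m U (\<lambda>x. e (fst x))"
    using trig
  proof (induction m)
    case 0
    have "continuous_on I w" "continuous_on I \<gamma>" "continuous_on I e"
      using w_deriv \<gamma>_deriv e_deriv
      by (auto intro!: continuous_at_imp_continuous_on
          intro: DERIV_isCont has_vector_derivative_continuous)
    then show ?case
      using in_I by (auto intro!: continuous_on_compose2[of I _ U fst] continuous_intros)
  next
    case (Suc m)
    have trig: "Ck_on m U (\<lambda>x. sin (fst x))" "Ck_on m U (\<lambda>x. cos (fst x))"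
      using Suc.prems Ck_on_Suc_imp by blast+
    have "Ck_on m U (\<lambda>x. Sg \<epsilon> (snd x))" "Ck_on m U (\<lambda>x. Cg \<epsilon> (snd x))" "Ck_on m U (\<lambda>x. Dg \<epsilon> (snd x))"
      using Suc.prems Ck_on_Suc_imp by blast+
    with Suc.IH trig have IH: "Ck_on m U (\<lambda>x. w (fst x))" "Ck_on m U (\<lambda>x. \<gamma> (fst x))" "Ck_on m U (\<lambda>x. e (fst x))"
      by blast+
    have nz: "w (fst x) \<noteq> 0" "sin (fst x) \<noteq> 0" "P (fst x) \<noteq> 0" "Q (fst x) \<noteq> 0" if "x \<in> U" for x
      using w_props(1)[OF in_I[OF that]] sin_pos[OF in_I[OF that]] P_pos[OF in_I[OF that]] Q_pos[OF in_I[OF that]]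
      by simp_all
    note intr = Ck_on_intros assms(1) IH trig
    have Q: "Ck_on m U (\<lambda>x. Q (fst x))" unfolding Q_def by (intro intr)
    have P: "Ck_on m U (\<lambda>x. P (fst x))" unfolding P_def by (intro intr) (use nz in auto)
    have \<sigma>: "Ck_on m U (\<lambda>x. \<sigma> (fst x))" unfolding \<sigma>_def by (intro intr Q) (use nz in auto)
    have h: "Ck_on m U (\<lambda>x. h (fst x))" unfolding h_def by (intro intr P) (use nz in auto)
    have T: "Ck_on m U (\<lambda>x. T (fst x))" unfolding T_def by (intro intr h)
    have "Ck_on (Suc m) U (\<lambda>x. w (fst x))"
    proof (rule Ck_on_Suc_fst[OF assms(1)])
      show "(w has_vector_derivative (- (\<sigma> (fst x) * P (fst x) * cos (fst x)) / (3 * (w (fst x))^2))) (at (fst x))"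
        if "x \<in> U" for x
        using w_deriv'[OF in_I[OF that]] by (simp add: has_real_derivative_iff_has_vector_derivative)
      show "Ck_on m U (\<lambda>x. - (\<sigma> (fst x) * P (fst x) * cos (fst x)) / (3 * (w (fst x))^2))"
        by (intro intr P \<sigma>) (use nz in auto)
    qed
    moreover have "Ck_on (Suc m) U (\<lambda>x. \<gamma> (fst x))"
    proof (rule Ck_on_Suc_fst[OF assms(1)])
      show "(\<gamma> has_vector_derivative \<sigma> (fst x) *\<^sub>R T (fst x)) (at (fst x))" if "x \<in> U" for x
        using \<gamma>_deriv[OF in_I[OF that]] .
      show "Ck_on m U (\<lambda>x. \<sigma> (fst x) *\<^sub>R T (fst x))" by (intro intr T \<sigma>)
    qed
    moreover have "Ck_on (Suc m) U (\<lambda>x. e (fst x))"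
    proof (rule Ck_on_Suc_fst[OF assms(1)])
      show "(e has_vector_derivative (\<sigma> (fst x) * sin (fst x)) *\<^sub>R \<gamma> (fst x)
          - (\<sigma> (fst x) * (w (fst x))^3 * sin (fst x) / P (fst x)) *\<^sub>R h (fst x)) (at (fst x))" if "x \<in> U" for x
        using e_deriv[OF in_I[OF that]] .
      show "Ck_on m U (\<lambda>x. (\<sigma> (fst x) * sin (fst x)) *\<^sub>R \<gamma> (fst x)
          - (\<sigma> (fst x) * (w (fst x))^3 * sin (fst x) / P (fst x)) *\<^sub>R h (fst x))"
        by (intro intr P \<sigma> h) (use nz in auto)
    qed
    ultimately show ?case by blast
  qed
  then show ?thesis
    using trig unfolding X_def J_def by (auto intro!: Ck_on_intros assms(1))
qed

end

section \<open>Charts, embeddedness and tangent planes of the swept surface\<close>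

context profile
begin

lemma I_open: "open I"
  by (simp add: I_def)

lemma n_X: "fst z \<in> I \<Longrightarrow> lor n (X z) = (w (fst z))^3 * Cg \<epsilon> (snd z)"
  by (simp add: X_def J_def lor_simps n\<gamma> lor_ax2 n2 nn Cg_eq[OF eps] algebra_simps)

lemma X_2: "fst z \<in> I \<Longrightarrow> X z $ 2 = (w (fst z))^3 * Sg \<epsilon> (snd z)"
  by (simp add: X_def J_def n2 \<gamma>2)

text \<open>\<open>lor n x\<close> and \<open>x $ 2\<close> act as polar coordinates on the orbits,
  so the radius is controlled by ambient coordinates; this is used to show that the surface is
  closed.\<close>

lemma X_radius: "fst z \<in> I \<Longrightarrow> (lor n (X z))^2 + \<epsilon> * (X z $ 2)^2 = (w (fst z))^6"
proof -
  assume z: "fst z \<in> I"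
  have "(lor n (X z))^2 + \<epsilon> * (X z $ 2)^2 = ((w (fst z))^3)^2 * ((Cg \<epsilon> (snd z))^2 + \<epsilon> * (Sg \<epsilon> (snd z))^2)"
    by (simp add: n_X[OF z] X_2[OF z] power_mult_distrib algebra_simps)
  then show ?thesis by (simp add: Cg_Sg_square[OF eps])
qed

lemma \<zeta>_X: "fst z \<in> I \<Longrightarrow> \<zeta> (X z) = M (fst z)"
  by (simp add: X_def J_def \<zeta>_eq)

lemma \<zeta>_surf: "continuous_on surf \<zeta>"
proof -
  have "surf = {\<gamma> \<theta> + (w \<theta>)^3 *\<^sub>R (Sg \<epsilon> v *\<^sub>R ax2 - Dg \<epsilon> v *\<^sub>R n) | \<theta> v. \<theta> \<in> I}"
    unfolding surf_def X_def[abs_def] J_def by force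
  then show ?thesis using \<zeta>_cont by simp
qed

text \<open>The angle is unique because \<zeta> reads off \<open>M\<close> and \<open>M\<close> is
  injective. The group parameter is unique only up to a period, which is why the conclusion concerns
  \<open>Sg\<close> and \<open>Cg\<close>.\<close>

lemma X_eqD:
  assumes "X z = X z'" "fst z \<in> I" "fst z' \<in> I"
  shows "fst z = fst z'" "Sg \<epsilon> (snd z) = Sg \<epsilon> (snd z')" "Cg \<epsilon> (snd z) = Cg \<epsilon> (snd z')"
proof -
  show eq: "fst z = fst z'"
    using \<zeta>_X[OF assms(2)] \<zeta>_X[OF assms(3)] assms inj_on_M by (auto dest: inj_onD)
  show "Sg \<epsilon> (snd z) = Sg \<epsilon> (snd z')" "Cg \<epsilon> (snd z) = Cg \<epsilon> (snd z')"
    using X_2[OF assms(2)] X_2[OF assms(3)] n_X[OF assms(2)] n_X[OF assms(3)] assms(1) eq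
      w_props(1)[OF assms(2)] by auto
qed

lemma J_FF_cong:
  assumes "Sg \<epsilon> v = Sg \<epsilon> v'" "Cg \<epsilon> v = Cg \<epsilon> v'"
  shows "J v = J v'" "FF v = FF v'"
  using assms Dg_cong[OF eps assms] by (simp_all add: J_def FF_def)

lemma X_cong: "fst z = fst z' \<Longrightarrow> Sg \<epsilon> (snd z) = Sg \<epsilon> (snd z') \<Longrightarrow> Cg \<epsilon> (snd z) = Cg \<epsilon> (snd z') \<Longrightarrow> X z = X z'"
  unfolding X_def using J_FF_cong by metis

text \<open>The parametrization is not injective for rotations, but the transported normal still
  depends on the point alone, so it defines a field on the surface.\<close>

lemma NN_cong: "X z = X z' \<Longrightarrow> fst z \<in> I \<Longrightarrow> fst z' \<in> I \<Longrightarrow> NN z = NN z'"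
  using X_eqD[of z z'] J_FF_cong[of "snd z" "snd z'"] by (simp add: NN_def lift_def)

lemma surfE: assumes "x \<in> surf" obtains z where "x = X z" "fst z \<in> I"
  using assms by (auto simp: surf_def)

lemma X_surf: "fst z \<in> I \<Longrightarrow> X z \<in> surf"
  by (auto simp: surf_def mem_Times_iff)

lemma surf_hyp3: "surf \<subseteq> hyp3"
proof
  fix x assume "x \<in> surf"
  then obtain z where z: "x = X z" "fst z \<in> I" by (rule surfE)
  have "X z $ 4 = \<gamma> (fst z) $ 4 + (w (fst z))^3 * (Dg \<epsilon> (snd z) * (- n $ 4))"
    by (simp add: X_def J_def axis_def)
  also have "\<dots> > 0"
    using \<gamma>4[OF z(2)] n4 Dg_nonneg[OF eps] w_props(1)[OF z(2)]
    by (intro add_pos_nonneg mult_nonneg_nonneg) auto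
  finally show "x \<in> hyp3" using frame(1)[OF z(2)] z(1) by (simp add: hyp3_def)
qed

lemma X_in_hyp3: "fst z \<in> I \<Longrightarrow> X z \<in> hyp3"
  using surf_hyp3 X_surf by blast

text \<open>For rotations the window is the half circle on which cos (v - v0) is positive; the other
  two groups act without periods and need no restriction.\<close>

definition U :: "real \<Rightarrow> (real \<times> real) set" where
  "U v0 = I \<times> {v. \<epsilon> = 1 \<longrightarrow> \<bar>v - v0\<bar> < pi/2}"
text \<open>A half-space: by the addition formula its linear form takes the value
  \<open>w^3 * Cg \<epsilon> (v - v0)\<close> at \<open>X (\<theta>, v)\<close>. For rotations this
  keeps the opposite half of each parallel out of the chart image.\<close>

definition W :: "real \<Rightarrow> (real^4) set" where
  "W v0 = {x. 0 < lor n x * Cg \<epsilon> v0 + \<epsilon> * (x $ 2) * Sg \<epsilon> v0}"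

lemma open_U: "open (U v0)"
proof (cases "\<epsilon> = 1")
  case True
  have "{v::real. \<bar>v - v0\<bar> < pi/2} = ball v0 (pi/2)" by (rule set_eqI) (simp only: mem_Collect_eq mem_ball dist_real_def abs_minus_commute[of v0])
  moreover have "U v0 = I \<times> {v. \<bar>v - v0\<bar> < pi/2}" using True unfolding U_def by blast
  ultimately show ?thesis by (simp add: I_def open_Times)
qed (simp add: U_def I_def open_Times)

lemma U_iff: "z \<in> U v0 \<longleftrightarrow> fst z \<in> I \<and> (\<epsilon> = 1 \<longrightarrow> \<bar>snd z - v0\<bar> < pi/2)"
  by (cases z) (simp add: U_def)

lemma U_fst: "z \<in> U v0 \<Longrightarrow> fst z \<in> I" and U_center: "fst z \<in> I \<Longrightarrow> z \<in> U (snd z)"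
  by (auto simp: U_def mem_Times_iff)

lemma open_W: "open (W v0)"
  unfolding W_def by (intro open_Collect_less continuous_intros lor.continuous_on)

lemma W_X: "fst z \<in> I \<Longrightarrow> X z \<in> W v0 \<longleftrightarrow> 0 < Cg \<epsilon> (snd z - v0)"
proof -
  assume z: "fst z \<in> I"
  have "lor n (X z) * Cg \<epsilon> v0 + \<epsilon> * (X z $ 2) * Sg \<epsilon> v0 = (w (fst z))^3 * Cg \<epsilon> (snd z - v0)"
    by (simp add: n_X[OF z] X_2[OF z] Cg_diff[OF eps] algebra_simps)
  then show ?thesis using w_props(1)[OF z] by (simp add: W_def zero_less_mult_iff)
qed

lemma X_continuous: "continuous_on (I \<times> UNIV) X"
  using X_smooth[of "I \<times> UNIV" 0] I_open by (simp add: open_Times)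

lemma U_W: "z \<in> U v0 \<Longrightarrow> X z \<in> W v0"
proof -
  assume z: "z \<in> U v0"
  have "0 < Cg \<epsilon> (snd z - v0)"
  proof (cases "\<epsilon> = 1")
    case True
    then have "\<bar>snd z - v0\<bar> < pi/2" using z unfolding U_iff by blast
    then have "0 < cos (snd z - v0)" by (intro cos_gt_zero_pi) linarith+
    then show ?thesis using True by (simp add: Cg_def)
  next
    case False
    then show ?thesis using eps by (auto simp: Cg_def)
  qed
  then show ?thesis using W_X U_fst[OF z] by simp
qed

text \<open>The inverse is explicit: \<theta> is obtained from \<zeta> by inverting the injective
  function \<open>M\<close>, and v from the ratio of the two orbit coordinates relative to v0. Both
  are continuous in the ambient point.\<close>

lemma chart: "\<exists>\<psi>. homeomorphism (U v0) (surf \<inter> W v0) X \<psi>"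
proof -
  have "continuous_on I M"
    using M_deriv by (intro DERIV_continuous_on) (auto intro: has_field_derivative_at_within)
  then obtain g where "homeomorphism I (M ` I) M g"
    using invariance_of_domain_homeomorphism[OF I_open _ _ inj_on_M] by auto
  then have g: "continuous_on (M ` I) g" "\<And>\<theta>. \<theta> \<in> I \<Longrightarrow> g (M \<theta>) = \<theta>"
    by (auto simp: homeomorphism_def)
  obtain A where A: "continuous_on ((\<lambda>v. Sg \<epsilon> v / Cg \<epsilon> v) ` {v. \<epsilon> = 1 \<longrightarrow> \<bar>v\<bar> < pi/2}) A"
    "\<And>v. (\<epsilon> = 1 \<longrightarrow> \<bar>v\<bar> < pi/2) \<Longrightarrow> A (Sg \<epsilon> v / Cg \<epsilon> v) = v"
    using Sg_Cg_quotient_inverse[OF eps] by blast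
  \<comment> \<open>On the surface the radius cancels and this is \<open>Sg / Cg\<close> at
    \<open>v - v0\<close>; the denominator is the form that \<open>W v0\<close> requires to be
    positive.\<close>
  define q where "q x = (x $ 2 * Cg \<epsilon> v0 - lor n x * Sg \<epsilon> v0) / (lor n x * Cg \<epsilon> v0 + \<epsilon> * (x $ 2) * Sg \<epsilon> v0)" for x
  define \<psi> where "\<psi> x = (g (\<zeta> x), v0 + A (q x))" for x
  have q: "q (X z) = Sg \<epsilon> (snd z - v0) / Cg \<epsilon> (snd z - v0)" if z: "fst z \<in> I" for z
  proof -
    have "q (X z) = ((w (fst z))^3 * Sg \<epsilon> (snd z - v0)) / ((w (fst z))^3 * Cg \<epsilon> (snd z - v0))"
      unfolding q_def n_X[OF z] X_2[OF z] Sg_diff[OF eps] Cg_diff[OF eps] by (simp add: algebra_simps)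
    then show ?thesis using w_props(1)[OF z] by simp
  qed
  have \<psi>: "\<psi> (X z) = z" if "z \<in> U v0" for z
    using that \<zeta>_X[OF U_fst[OF that]] q[OF U_fst[OF that]] g(2)[OF U_fst[OF that]] A(2)[of "snd z - v0"]
    by (auto simp: \<psi>_def U_def)
  have img: "\<exists>z\<in>U v0. x = X z" if "x \<in> surf \<inter> W v0" for x
  proof -
    from that obtain z where z: "x = X z" "fst z \<in> I" by (auto elim: surfE)
    then have "0 < Cg \<epsilon> (snd z - v0)" using W_X that by blast
    then obtain v' where v': "\<epsilon> = 1 \<longrightarrow> \<bar>v' - v0\<bar> < pi/2" "Sg \<epsilon> v' = Sg \<epsilon> (snd z)" "Cg \<epsilon> v' = Cg \<epsilon> (snd z)"
      using Cg_Sg_near_representative[OF eps] by blast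
    then have "X z = X (fst z, v')" by (intro X_cong) auto
    moreover have "(fst z, v') \<in> U v0" using v' z by (simp add: U_def)
    ultimately show ?thesis using z(1) by blast
  qed
  have eq: "X ` U v0 = surf \<inter> W v0"
    using img U_W U_fst unfolding surf_def by (fastforce simp: mem_Times_iff)
  have "homeomorphism (U v0) (surf \<inter> W v0) X \<psi>"
  proof (rule homeomorphismI)
    show "continuous_on (U v0) X"
      by (rule continuous_on_subset[OF X_continuous]) (use U_fst in \<open>auto simp: U_def\<close>)
    have "continuous_on (surf \<inter> W v0) (\<lambda>x. g (\<zeta> x))"
      by (rule continuous_on_compose2[OF g(1) continuous_on_subset[OF \<zeta>_surf]])
         (use \<zeta>_X in \<open>auto simp: surf_def\<close>)
    moreover have "continuous_on (surf \<inter> W v0) (\<lambda>x. A (q x))"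
    proof (rule continuous_on_compose2[OF A(1)])
      show "continuous_on (surf \<inter> W v0) q"
        unfolding q_def by (intro continuous_intros lor.continuous_on) (auto simp: W_def)
      show "q ` (surf \<inter> W v0) \<subseteq> (\<lambda>v. Sg \<epsilon> v / Cg \<epsilon> v) ` {v. \<epsilon> = 1 \<longrightarrow> \<bar>v\<bar> < pi/2}"
      proof clarify
        fix x assume "x \<in> surf" "x \<in> W v0"
        then obtain z where "z \<in> U v0" "x = X z" using img by blast
        then show "q x \<in> (\<lambda>v. Sg \<epsilon> v / Cg \<epsilon> v) ` {v. \<epsilon> = 1 \<longrightarrow> \<bar>v\<bar> < pi/2}"
          using q[OF U_fst] by (intro image_eqI[of _ _ "snd z - v0"]) (auto simp: U_def)
      qed
    qed
    ultimately show "continuous_on (surf \<inter> W v0) \<psi>"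
      unfolding \<psi>_def by (intro continuous_intros)
    show "X ` U v0 \<subseteq> surf \<inter> W v0" using eq by simp
    show "\<psi> ` (surf \<inter> W v0) \<subseteq> U v0"
      unfolding eq[symmetric] image_image using \<psi> by (intro image_subsetI) (simp only:)
    show "X (\<psi> y) = y" if "y \<in> surf \<inter> W v0" for y using eq \<psi> that by force
  qed (use \<psi> in auto)
  then show ?thesis by blast
qed

abbreviation "DX z \<equiv> (\<lambda>x. fst x *\<^sub>R (\<sigma> (fst z) *\<^sub>R TT z) + snd x *\<^sub>R ((w (fst z))^3 *\<^sub>R FF (snd z)))"

lemma lor_comb:
  assumes "fst z \<in> I"
  shows "lor (a *\<^sub>R TT z + b *\<^sub>R FF (snd z)) (TT z) = a" "lor (a *\<^sub>R TT z + b *\<^sub>R FF (snd z)) (FF (snd z)) = b"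
    "lor (a *\<^sub>R TT z + b *\<^sub>R FF (snd z)) (c *\<^sub>R TT z + d *\<^sub>R FF (snd z)) = a * c + b * d"
  using frame[OF assms] lor_commute[of "FF (snd z)" "TT z"] by (simp_all add: lor_simps)

lemma DX_inj:
  assumes "fst z \<in> I"
  shows "inj (DX z)"
proof (rule injI)
  fix x y assume eq: "DX z x = DX z y"
  have "fst x * \<sigma> (fst z) = lor (DX z x) (TT z)" "snd x * (w (fst z))^3 = lor (DX z x) (FF (snd z))" for x
    using lor_comb[OF assms, of "fst x * \<sigma> (fst z)" "snd x * (w (fst z))^3"] by simp_all
  then have "fst x * \<sigma> (fst z) = fst y * \<sigma> (fst z)" "snd x * (w (fst z))^3 = snd y * (w (fst z))^3"
    using eq by metis+
  then show "x = y" using \<sigma>_pos[OF assms] w_props(1)[OF assms] by (simp add: prod_eq_iff)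
qed

lemma regular: "regular_surface surf"
  unfolding regular_surface_def
proof (intro conjI ballI surf_hyp3)
  fix p assume "p \<in> surf"
  then obtain z where z: "p = X z" "fst z \<in> I" by (rule surfE)
  obtain \<psi> where \<psi>: "homeomorphism (U (snd z)) (surf \<inter> W (snd z)) X \<psi>" using chart by blast
  have "inj (frechet_derivative X (at u))" if "u \<in> U (snd z)" for u
    using DX_inj[OF U_fst[OF that]] frechet_derivative_at[OF X_deriv[OF U_fst[OF that]]] by simp
  moreover have "Ck_on 3 (U (snd z)) X"
    by (rule X_smooth[OF open_U]) (auto simp: U_def)
  ultimately show "\<exists>(U :: (real \<times> real) set) W \<phi> \<psi>. open U \<and> open W \<and> p \<in> W \<and> Ck_on 3 U \<phi> \<and>
      homeomorphism U (surf \<inter> W) \<phi> \<psi> \<and> (\<forall>u\<in>U. inj (frechet_derivative \<phi> (at u)))"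
    using open_U open_W U_W[OF U_center[OF z(2)]] z(1) \<psi>
    by (intro exI[of _ "U (snd z)"] exI[of _ "W (snd z)"] exI[of _ X] exI[of _ \<psi>]) auto
qed

lemma tangent_space_X:
  assumes "fst z \<in> I"
  shows "tangent_space surf (X z) = {a *\<^sub>R TT z + b *\<^sub>R FF (snd z) | a b. True}"
proof -
  obtain \<psi> where \<psi>: "homeomorphism (U (snd z)) (surf \<inter> W (snd z)) X \<psi>" using chart by blast
  have "tangent_space surf (X z) = range (DX z)"
    by (rule tangent_space_chart[OF \<psi> open_U open_W U_center[OF assms] X_deriv[OF assms] DX_inj[OF assms]])
  also have "\<dots> = {a *\<^sub>R TT z + b *\<^sub>R FF (snd z) | a b. True}"
  proof (intro equalityI subsetI)
    fix x assume "x \<in> {a *\<^sub>R TT z + b *\<^sub>R FF (snd z) | a b. True}"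
    then obtain a b where "x = a *\<^sub>R TT z + b *\<^sub>R FF (snd z)" by blast
    then have "x = DX z (a / \<sigma> (fst z), b / (w (fst z))^3)"
      using \<sigma>_pos[OF assms] w_props(1)[OF assms] by simp
    then show "x \<in> range (DX z)" by blast
  next
    fix x assume "x \<in> range (DX z)"
    then obtain y where "x = DX z y" by blast
    then have "x = (fst y * \<sigma> (fst z)) *\<^sub>R TT z + (snd y * (w (fst z))^3) *\<^sub>R FF (snd z)" by simp
    then show "x \<in> {a *\<^sub>R TT z + b *\<^sub>R FF (snd z) | a b. True}" by blast
  qed
  finally show ?thesis .
qed

section \<open>Unit normals, shape operator and mean curvature\<close>

lemma frame_expansion:
  assumes "fst z \<in> I"
  obtains a b c d where "y = a *\<^sub>R X z + b *\<^sub>R TT z + c *\<^sub>R FF (snd z) + d *\<^sub>R NN z"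
proof -
  define f :: "real^4 \<Rightarrow> real^4" where
    "f c = (c$1) *\<^sub>R X z + (c$2) *\<^sub>R TT z + (c$3) *\<^sub>R FF (snd z) + (c$4) *\<^sub>R NN z" for c
  note fr = frame[OF assms] frame(5-10)[OF assms, THEN trans[OF lor_commute]]
  have lin: "linear f" unfolding f_def by (intro linearI) (simp_all add: algebra_simps)
  have "c = 0" if "f c = 0" for c
  proof -
    have "lor (f c) (X z) = 0" "lor (f c) (TT z) = 0" "lor (f c) (FF (snd z)) = 0" "lor (f c) (NN z) = 0"
      using that by (simp_all add: lor_simps)
    then have "c$1 = 0" "c$2 = 0" "c$3 = 0" "c$4 = 0" by (simp_all add: f_def lor_simps fr)
    then show ?thesis by (simp add: vec_eq_iff forall_4)
  qed
  then have "inj f" using linear_injective_0[OF lin] by blast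
  then have "surj f" using linear_injective_imp_surjective[OF lin] by blast
  then obtain c where "y = f c" by blast
  then show thesis using that by (simp add: f_def)
qed

text \<open>The four frame vectors span the whole space, so orthogonality to three of them leaves a
  multiple of \<open>NN\<close>, and unit length leaves its sign. This handles arbitrary unit normal
  fields.\<close>

lemma normal_unique:
  assumes "fst z \<in> I" "lor (X z) y = 0" "lor y (TT z) = 0" "lor y (FF (snd z)) = 0" "lor y y = 1"
  shows "y = lor y (NN z) *\<^sub>R NN z" "lor y (NN z) = 1 \<or> lor y (NN z) = -1"
proof -
  obtain a b c d where y: "y = a *\<^sub>R X z + b *\<^sub>R TT z + c *\<^sub>R FF (snd z) + d *\<^sub>R NN z"
    using frame_expansion[OF assms(1)] by blast
  note fr = frame[OF assms(1)] frame(5-10)[OF assms(1), THEN trans[OF lor_commute]]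
  have "a = 0" "b = 0" "c = 0" using assms(2-4) by (simp_all add: y lor_simps fr)
  then have y: "y = d *\<^sub>R NN z" by (simp add: y)
  then show "y = lor y (NN z) *\<^sub>R NN z" by (simp add: lor_simps fr)
  have "d * d = 1" using assms(5) by (simp add: y lor_simps fr)
  then show "lor y (NN z) = 1 \<or> lor y (NN z) = -1"
    by (simp add: y lor_simps fr square_eq_1_iff)
qed

text \<open>The field is differentiated through the parametrization, where it is a fixed multiple of
  \<open>NN\<close>; uniqueness of the derivative then determines its value on every tangent vector,
  whichever derivative within the surface was chosen.\<close>

lemma shape_operator_X:
  assumes z: "fst z \<in> I" and V: "open V" "X z \<in> V"
    and N: "\<And>z'. fst z' \<in> I \<Longrightarrow> X z' \<in> V \<Longrightarrow> N (X z') = c *\<^sub>R NN z'"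
    and diff: "N differentiable (at (X z) within surf)"
  shows "shape_operator surf N (X z) (a *\<^sub>R TT z + b *\<^sub>R FF (snd z)) =
    (c * a * K (fst z)) *\<^sub>R TT z + (- 3 * c * b * K (fst z)) *\<^sub>R FF (snd z)"
proof -
  let ?DN = "\<lambda>x. fst x *\<^sub>R (- (\<sigma> (fst z) * K (fst z)) *\<^sub>R TT z)
      + snd x *\<^sub>R ((3 * k / w (fst z)) *\<^sub>R FF (snd z))"
  define D where "D = frechet_derivative N (at (X z) within surf)"
  have D: "(N has_derivative D) (at (X z) within surf)"
    using diff by (simp add: D_def frechet_derivative_works)
  define B where "B = (I \<times> UNIV) \<inter> X -` V"
  have "open B" unfolding B_def
    by (rule continuous_open_preimage[OF X_continuous _ V(1)]) (simp add: I_open open_Times)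
  have "z \<in> B" using z V by (simp add: B_def mem_Times_iff)
  have "((\<lambda>x. N (X x)) has_derivative (\<lambda>x. D (DX z x))) (at z)"
    by (rule has_derivative_compose_into[OF D X_deriv[OF z] \<open>open B\<close> \<open>z \<in> B\<close>])
       (auto simp: B_def surf_def)
  moreover have "((\<lambda>x. N (X x)) has_derivative (\<lambda>x. c *\<^sub>R ?DN x)) (at z)"
    by (rule has_derivative_transform_within_open[OF has_derivative_scaleR_right[OF NN_deriv[OF z]] \<open>open B\<close> \<open>z \<in> B\<close>])
       (use N in \<open>auto simp: B_def\<close>)
  ultimately have eq: "(\<lambda>x. D (DX z x)) = (\<lambda>x. c *\<^sub>R ?DN x)"
    by (rule has_derivative_unique)
  have w0: "w (fst z) \<noteq> 0" "\<sigma> (fst z) \<noteq> 0" using w_props(1)[OF z] \<sigma>_pos[OF z] by auto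
  have "D (a *\<^sub>R TT z + b *\<^sub>R FF (snd z)) = D (DX z (a / \<sigma> (fst z), b / (w (fst z))^3))"
    using w0 by simp
  also have "\<dots> = c *\<^sub>R ((a / \<sigma> (fst z)) *\<^sub>R (- (\<sigma> (fst z) * K (fst z)) *\<^sub>R TT z)
      + (b / (w (fst z))^3) *\<^sub>R ((3 * k / w (fst z)) *\<^sub>R FF (snd z)))"
    using fun_cong[OF eq, of "(a / \<sigma> (fst z), b / (w (fst z))^3)"] by simp
  also have "\<dots> = (- (c * a * K (fst z))) *\<^sub>R TT z + (3 * c * b * K (fst z)) *\<^sub>R FF (snd z)"
    using w0 by (simp add: algebra_simps K_def power_numeral_reduce)
  finally have D': "D (a *\<^sub>R TT z + b *\<^sub>R FF (snd z)) = (- (c * a * K (fst z))) *\<^sub>R TT z + (3 * c * b * K (fst z)) *\<^sub>R FF (snd z)" .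
  have "lor (X z) (D (a *\<^sub>R TT z + b *\<^sub>R FF (snd z))) = 0"
    unfolding D' by (simp add: lor_simps frame[OF z])
  from tangential_part_hyp3[OF X_in_hyp3[OF z] this] show ?thesis
    unfolding shape_operator_def D_def[symmetric] by (simp add: D')
qed

lemma mean_curvature_X:
  assumes z: "fst z \<in> I" and V: "open V" "X z \<in> V"
    and N: "\<And>z'. fst z' \<in> I \<Longrightarrow> X z' \<in> V \<Longrightarrow> N (X z') = c *\<^sub>R NN z'"
    and diff: "N differentiable (at (X z) within surf)"
  shows "mean_curvature surf N (X z) = - 2 * c * K (fst z)"
  unfolding mean_curvature_def
proof (rule the_equality)
  note sh = shape_operator_X[OF z V N diff]
  let ?A = "shape_operator surf N (X z)" and ?T = "tangent_space surf (X z)"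
  have tr: "- 2 * c * K (fst z) = lor (?A a) a + lor (?A b) b"
    if ab: "a \<in> ?T" "b \<in> ?T"
      "lor a a = 1" "lor b b = 1" "lor a b = 0" for a b
  proof -
    obtain a1 a2 where a: "a = a1 *\<^sub>R TT z + a2 *\<^sub>R FF (snd z)"
      using ab(1) tangent_space_X[OF z] by blast
    obtain b1 b2 where b: "b = b1 *\<^sub>R TT z + b2 *\<^sub>R FF (snd z)"
      using ab(2) tangent_space_X[OF z] by blast
    have o: "a1 * a1 + a2 * a2 = 1" "b1 * b1 + b2 * b2 = 1" "a1 * b1 + a2 * b2 = 0"
      using ab(3-5) by (simp_all add: a b lor_comb[OF z])
    \<comment> \<open>The coefficient matrix has orthonormal rows, hence orthonormal columns. This
      is the independence of the trace from the orthonormal basis.\<close>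
    have c1: "a1 * a1 + b1 * b1 = 1" using o by algebra
    then have c2: "a2 * a2 + b2 * b2 = 1" using o by algebra
    have "lor (?A a) a = c * K (fst z) * (a1 * a1) - 3 * c * K (fst z) * (a2 * a2)"
    proof -
      have "?A (a1 *\<^sub>R TT z + a2 *\<^sub>R FF (snd z)) =
          (c * a1 * K (fst z)) *\<^sub>R TT z + (- 3 * c * a2 * K (fst z)) *\<^sub>R FF (snd z)" by (rule sh)
      then show ?thesis unfolding a by (simp only: lor_comb(3)[OF z]) (simp add: algebra_simps)
    qed
    moreover have "lor (?A b) b = c * K (fst z) * (b1 * b1) - 3 * c * K (fst z) * (b2 * b2)"
    proof -
      have "?A (b1 *\<^sub>R TT z + b2 *\<^sub>R FF (snd z)) =
          (c * b1 * K (fst z)) *\<^sub>R TT z + (- 3 * c * b2 * K (fst z)) *\<^sub>R FF (snd z)" by (rule sh)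
      then show ?thesis unfolding b by (simp only: lor_comb(3)[OF z]) (simp add: algebra_simps)
    qed
    ultimately have "lor (?A a) a + lor (?A b) b =
      c * K (fst z) * (a1 * a1 + b1 * b1) - 3 * c * K (fst z) * (a2 * a2 + b2 * b2)"
      by (simp add: algebra_simps)
    then show ?thesis by (simp add: c1 c2)
  qed
  then show "\<forall>a\<in>?T. \<forall>b\<in>?T.
      lor a a = 1 \<and> lor b b = 1 \<and> lor a b = 0 \<longrightarrow>
      - 2 * c * K (fst z) = lor (?A a) a + lor (?A b) b"
    by blast
  have mem: "TT z = 1 *\<^sub>R TT z + 0 *\<^sub>R FF (snd z)" "FF (snd z) = 0 *\<^sub>R TT z + 1 *\<^sub>R FF (snd z)" by simp_all
  then have "TT z \<in> ?T" "FF (snd z) \<in> ?T"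
    unfolding tangent_space_X[OF z] by blast+
  then show "c' = - 2 * c * K (fst z)" if "\<forall>a\<in>?T. \<forall>b\<in>?T.
      lor a a = 1 \<and> lor b b = 1 \<and> lor a b = 0 \<longrightarrow>
      c' = lor (?A a) a + lor (?A b) b" for c'
    using that tr frame[OF z] by metis
qed

lemma gradient_X:
  assumes z: "fst z \<in> I" and V: "open V" "X z \<in> V"
    and N: "\<And>z'. fst z' \<in> I \<Longrightarrow> X z' \<in> V \<Longrightarrow> N (X z') = c *\<^sub>R NN z'"
    and diff: "\<And>q. q \<in> surf \<inter> V \<Longrightarrow> N differentiable (at q within surf)"
  shows "has_surface_gradient surf (mean_curvature surf N)
    ((- 8 * c * K (fst z) * P (fst z) * cos (fst z) / (3 * (w (fst z))^3)) *\<^sub>R TT z) (X z)"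
proof -
  \<comment> \<open>The arc length derivative of \<open>- 2 * c * K\<close> along the profile curve:
    the \<theta>-derivative divided by the speed.\<close>
  define g where "g = - 8 * c * K (fst z) * P (fst z) * cos (fst z) / (3 * (w (fst z))^3)"
  obtain \<psi> where \<psi>: "homeomorphism (U (snd z)) (surf \<inter> W (snd z)) X \<psi>" using chart by blast
  have zU: "z \<in> U (snd z)" using U_center[OF z] .
  obtain L where L: "bounded_linear L" "\<And>x. L (DX z x) = x"
    "(\<psi> has_derivative L) (at (X z) within (surf \<inter> W (snd z)))"
    using chart_inverse_has_derivative[OF \<psi> zU X_deriv[OF z] DX_inj[OF z]] by blast
  have L': "(\<psi> has_derivative L) (at (X z) within surf)"
    using L(3) at_within_Int_nhd[OF U_W[OF zU] open_W] by simp
  have \<psi>X: "\<psi> (X x) = x" if "x \<in> U (snd z)" for x using \<psi> that by (auto simp: homeomorphism_def)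
  have "((\<lambda>x. - 2 * c * K x) has_derivative (\<lambda>x. g * \<sigma> (fst z) * x)) (at (fst z))"
    using K_deriv[OF z] w_props(1)[OF z]
    by (auto intro!: derivative_eq_intros simp: has_field_derivative_def g_def field_simps)
  then have "((\<lambda>x. - 2 * c * K x) has_derivative (\<lambda>x. g * \<sigma> (fst z) * x)) (at (fst (\<psi> (X z))))"
    by (simp add: \<psi>X[OF zU])
  from has_derivative_compose[OF has_derivative_fst[OF L'] this]
  have f: "((\<lambda>q. - 2 * c * K (fst (\<psi> q))) has_derivative (\<lambda>x. g * \<sigma> (fst z) * fst (L x))) (at (X z) within surf)" .
  have "open (V \<inter> W (snd z))" using V(1) open_W by blast
  then obtain d where d: "d > 0" "ball (X z) d \<subseteq> V \<inter> W (snd z)"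
    using V(2) U_W[OF zU] open_contains_ball by blast
  have mc: "- 2 * c * K (fst (\<psi> q)) = mean_curvature surf N q" if "q \<in> surf" "dist q (X z) < d" for q
  proof -
    have q: "q \<in> V" "q \<in> surf \<inter> W (snd z)" using d(2) that by (auto simp: dist_commute subset_iff)
    then have "q \<in> X ` U (snd z)" using \<psi> by (simp add: homeomorphism_def)
    then obtain x where x: "x \<in> U (snd z)" "q = X x" by blast
    show ?thesis
      using mean_curvature_X[of x V N c] U_fst[OF x(1)] V N diff q x \<psi>X[OF x(1)] by auto
  qed
  have "(mean_curvature surf N has_derivative (\<lambda>x. g * \<sigma> (fst z) * fst (L x))) (at (X z) within surf)"
    by (rule has_derivative_transform_within[OF f d(1)]) (use mc z in \<open>auto simp: surf_def mem_Times_iff\<close>)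
  moreover have "lor (g *\<^sub>R TT z) y = g * \<sigma> (fst z) * fst (L y)" if y': "y \<in> tangent_space surf (X z)" for y
  proof -
    obtain a b where y: "y = a *\<^sub>R TT z + b *\<^sub>R FF (snd z)" using y' tangent_space_X[OF z] by blast
    also have "\<dots> = DX z (a / \<sigma> (fst z), b / (w (fst z))^3)"
      using \<sigma>_pos[OF z] w_props(1)[OF z] by simp
    finally have "L y = (a / \<sigma> (fst z), b / (w (fst z))^3)" using L(2) by metis
    then show ?thesis using \<sigma>_pos[OF z] frame[OF z] by (simp add: y lor_simps)
  qed
  moreover have "g *\<^sub>R TT z \<in> tangent_space surf (X z)"
    unfolding tangent_space_X[OF z] by (intro CollectI exI[of _ g] exI[of _ 0]) simp
  ultimately show ?thesis unfolding has_surface_gradient_def g_def[symmetric] by blast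
qed

text \<open>The chart inverse picks parameters differentiably, and \<open>NN\<close> is evaluated
  there; by \<open>NN_cong\<close> the value is the same for all parameters of the point.\<close>

lemma unit_normal_field_exists:
  assumes z: "fst z \<in> I"
  obtains N where "unit_normal_field surf (W (snd z)) N"
    "\<And>z'. fst z' \<in> I \<Longrightarrow> X z' \<in> W (snd z) \<Longrightarrow> N (X z') = NN z'"
proof -
  obtain \<psi> where \<psi>: "homeomorphism (U (snd z)) (surf \<inter> W (snd z)) X \<psi>" using chart by blast
  have ex: "\<exists>x\<in>U (snd z). q = X x" if "q \<in> surf \<inter> W (snd z)" for q
    using \<psi> that unfolding homeomorphism_def by blast
  have \<psi>X: "\<psi> (X x) = x" if "x \<in> U (snd z)" for x using \<psi> that by (auto simp: homeomorphism_def)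
  have "(\<lambda>q. NN (\<psi> q)) differentiable (at q within (surf \<inter> W (snd z)))" if q: "q \<in> surf \<inter> W (snd z)" for q
  proof -
    obtain x where x: "x \<in> U (snd z)" "q = X x" using ex[OF q] by blast
    obtain L where L: "(\<psi> has_derivative L) (at (X x) within (surf \<inter> W (snd z)))"
      using chart_inverse_has_derivative[OF \<psi> x(1) X_deriv[OF U_fst[OF x(1)]] DX_inj[OF U_fst[OF x(1)]]] by blast
    have "(NN has_derivative (\<lambda>y. fst y *\<^sub>R (- (\<sigma> (fst x) * K (fst x)) *\<^sub>R TT x)
      + snd y *\<^sub>R ((3 * k / w (fst x)) *\<^sub>R FF (snd x)))) (at (\<psi> (X x)))"
      using NN_deriv[OF U_fst[OF x(1)]] by (simp add: \<psi>X[OF x(1)])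
    from has_derivative_compose[OF L this] show ?thesis
      unfolding x(2) differentiable_def by blast
  qed
  then have "(\<lambda>q. NN (\<psi> q)) differentiable_on (surf \<inter> W (snd z))" by (simp add: differentiable_on_def)
  moreover have "NN (\<psi> q) \<in> tangent_space hyp3 q \<and> lor (NN (\<psi> q)) (NN (\<psi> q)) = 1 \<and>
      (\<forall>y\<in>tangent_space surf q. lor (NN (\<psi> q)) y = 0)" if q: "q \<in> surf \<inter> W (snd z)" for q
  proof -
    obtain x where x: "x \<in> U (snd z)" "q = X x" using ex[OF q] by blast
    note fr = frame[OF U_fst[OF x(1)]] lor_commute[of "NN x" "TT x"]
    show ?thesis
      using X_in_hyp3[OF U_fst[OF x(1)]]
      by (auto simp: x(2) \<psi>X[OF x(1)] tangent_space_hyp3 tangent_space_X[OF U_fst[OF x(1)]] lor_simps fr)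
  qed
  ultimately have "unit_normal_field surf (W (snd z)) (\<lambda>q. NN (\<psi> q))"
    by (simp add: unit_normal_field_def)
  moreover have "NN (\<psi> (X z')) = NN z'" if "fst z' \<in> I" "X z' \<in> W (snd z)" for z'
  proof -
    have "X z' \<in> surf \<inter> W (snd z)" using that by (auto simp: surf_def mem_Times_iff)
    then obtain x where x: "x \<in> U (snd z)" "X z' = X x" using ex by blast
    then show ?thesis using NN_cong[OF x(2) that(1) U_fst[OF x(1)]] \<psi>X[OF x(1)] by simp
  qed
  ultimately show thesis using that by blast
qed

lemma unit_normal_field_differentiable:
  "unit_normal_field S V N \<Longrightarrow> open V \<Longrightarrow> q \<in> S \<inter> V \<Longrightarrow> N differentiable (at q within S)"
  by (metis IntD2 at_within_Int_nhd differentiable_on_def unit_normal_field_def)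

lemma biconservative_surf: "biconservative surf"
  unfolding biconservative_def
proof
  fix p assume "p \<in> surf"
  then obtain z where z: "p = X z" "fst z \<in> I" by (rule surfE)
  obtain N where N: "unit_normal_field surf (W (snd z)) N"
    "\<And>z'. fst z' \<in> I \<Longrightarrow> X z' \<in> W (snd z) \<Longrightarrow> N (X z') = NN z'"
    using unit_normal_field_exists[OF z(2)] by blast
  have diff: "N differentiable (at q within surf)" if "q \<in> surf \<inter> W (snd z)" for q
    using unit_normal_field_differentiable[OF N(1) open_W that] .
  have "\<exists>g. has_surface_gradient surf (mean_curvature surf N) g q \<and>
      shape_operator surf N q g = - (mean_curvature surf N q / 2) *\<^sub>R g" if q: "q \<in> surf \<inter> W (snd z)" for q
  proof -
    obtain x where x: "q = X x" "fst x \<in> I" using q by (auto simp: surf_def)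
    have N': "N (X z') = 1 *\<^sub>R NN z'" if "fst z' \<in> I" "X z' \<in> W (snd z)" for z' using N(2)[OF that] by simp
    have xW: "X x \<in> W (snd z)" and d: "N differentiable (at (X x) within surf)" using q diff x(1) by auto
    define g where "g = - 8 * 1 * K (fst x) * P (fst x) * cos (fst x) / (3 * (w (fst x))^3)"
    have "has_surface_gradient surf (mean_curvature surf N) (g *\<^sub>R TT x) (X x)"
      unfolding g_def by (rule gradient_X[OF x(2) open_W xW N' diff])
    moreover have "mean_curvature surf N (X x) = - 2 * K (fst x)"
      using mean_curvature_X[OF x(2) open_W xW N' d] by simp
    moreover have "shape_operator surf N (X x) (g *\<^sub>R TT x) = (g * K (fst x)) *\<^sub>R TT x"
      using shape_operator_X[OF x(2) open_W xW N' d, of g 0] by simp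
    ultimately show ?thesis unfolding x(1) by (intro exI[of _ "g *\<^sub>R TT x"]) (simp add: mult.commute)
  qed
  then show "\<exists>W N. open W \<and> p \<in> W \<and> unit_normal_field surf W N \<and>
      (\<forall>q\<in>surf \<inter> W. \<exists>g. has_surface_gradient surf (mean_curvature surf N) g q \<and>
           shape_operator surf N q g = - (mean_curvature surf N q / 2) *\<^sub>R g)"
    using open_W N(1) U_W[OF U_center[OF z(2)]] z(1) by blast
qed

text \<open>Compared with the constructed field, an arbitrary unit normal field differs by a
  continuous sign. Near the given point the sign is constant, so the gradient formula applies, and
  its factor cos \<theta> is zero at \<pi>/2.\<close>

lemma gradient_vanishes:
  assumes V: "open V" and N: "unit_normal_field surf V N" and zV: "X (pi/2, v) \<in> V"
  shows "has_surface_gradient surf (mean_curvature surf N) 0 (X (pi/2, v))"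
proof -
  define z where "z = (pi/2, v)"
  have z: "fst z \<in> I" by (simp add: z_def I_def)
  obtain N0 where N0: "unit_normal_field surf (W (snd z)) N0"
    "\<And>z'. fst z' \<in> I \<Longrightarrow> X z' \<in> W (snd z) \<Longrightarrow> N0 (X z') = NN z'"
    using unit_normal_field_exists[OF z] by blast
  define s where "s q = lor (N q) (N0 q)" for q
  have Xs: "X x \<in> surf" if "fst x \<in> I" for x using that by (auto simp: surf_def mem_Times_iff)
  have s: "N (X x) = s (X x) *\<^sub>R NN x \<and> (s (X x) = 1 \<or> s (X x) = -1)"
    if x: "fst x \<in> I" "X x \<in> V \<inter> W (snd z)" for x
  proof -
    have "TT x = 1 *\<^sub>R TT x + 0 *\<^sub>R FF (snd x)" "FF (snd x) = 0 *\<^sub>R TT x + 1 *\<^sub>R FF (snd x)" by simp_all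
    then have "TT x \<in> tangent_space surf (X x)" "FF (snd x) \<in> tangent_space surf (X x)"
      unfolding tangent_space_X[OF x(1)] by blast+
    moreover have "X x \<in> surf \<inter> V" using Xs x by blast
    ultimately have n: "N (X x) \<in> tangent_space hyp3 (X x)" "lor (N (X x)) (TT x) = 0"
      "lor (N (X x)) (FF (snd x)) = 0" "lor (N (X x)) (N (X x)) = 1"
      using N unfolding unit_normal_field_def by blast+
    then have "lor (X x) (N (X x)) = 0" using tangent_space_hyp3[OF X_in_hyp3[OF x(1)]] by blast
    from normal_unique[OF x(1) this n(2-4)] show ?thesis using N0(2) x by (auto simp: s_def)
  qed
  have zW: "X z \<in> V \<inter> W (snd z)" using zV U_W[OF U_center[OF z]] by (simp add: z_def)
  have "continuous_on (surf \<inter> (V \<inter> W (snd z))) s"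
    unfolding s_def
    by (intro lor.continuous_on continuous_on_subset[OF differentiable_imp_continuous_on])
       (use N N0(1) in \<open>auto simp: unit_normal_field_def\<close>)
  \<comment> \<open>The values 1 and -1 are at distance 2, so closeness within 1 makes the sign
    constant.\<close>
  then obtain d where d: "d > 0" "\<And>q. q \<in> surf \<inter> (V \<inter> W (snd z)) \<Longrightarrow> dist q (X z) < d \<Longrightarrow> dist (s q) (s (X z)) < 1"
    using zW Xs[OF z] unfolding continuous_on_iff by (metis IntI zero_less_one)
  define B where "B = V \<inter> W (snd z) \<inter> ball (X z) d"
  have B: "open B" "X z \<in> B" using V open_W zW d(1) by (auto simp: B_def)
  have "N (X x) = s (X z) *\<^sub>R NN x" if x: "fst x \<in> I" "X x \<in> B" for x
  proof -
    have "dist (s (X x)) (s (X z)) < 1"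
      using d(2)[of "X x"] x Xs[OF x(1)] by (auto simp: B_def dist_commute)
    then have "s (X x) = s (X z)" using s[of x] s[OF z zW] x by (auto simp: B_def dist_real_def)
    then show ?thesis using s[of x] x by (auto simp: B_def)
  qed
  moreover have "N differentiable (at q within surf)" if "q \<in> surf \<inter> B" for q
    using unit_normal_field_differentiable[OF N V] that by (auto simp: B_def)
  ultimately have "has_surface_gradient surf (mean_curvature surf N)
    ((- 8 * s (X z) * K (fst z) * P (fst z) * cos (fst z) / (3 * (w (fst z))^3)) *\<^sub>R TT z) (X z)"
    by (rule gradient_X[OF z B])
  then show ?thesis by (simp add: z_def)
qed

text \<open>At \<pi>/2 one has \<open>lor n T = 0\<close>, so the group fixes \<open>T\<close>. The
  acceleration of the orbit is a combination of \<open>ax2\<close> and \<open>n\<close>, hence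
  orthogonal to \<open>T\<close>; it is orthogonal to \<open>FF\<close> because \<open>FF\<close>
  has constant length.\<close>

lemma geodesic_boundary: "geodesic surf (\<lambda>v. X (pi/2, v))"
  unfolding geodesic_def
proof (intro exI allI conjI)
  fix v :: real
  define z where "z = (pi/2, v)"
  let ?F' = "- (\<epsilon> * Sg \<epsilon> v) *\<^sub>R ax2 - Cg \<epsilon> v *\<^sub>R n"
  have z: "fst z \<in> I" by (simp add: z_def I_def)
  have w: "0 < w (pi/2)" using w_props(1)[OF z] by (simp add: z_def)
  show "X (pi/2, v) \<in> surf" using z by (auto simp: surf_def z_def)
  show "((\<lambda>v. X (pi/2, v)) has_vector_derivative (w (pi/2))^3 *\<^sub>R FF v) (at v)"
    unfolding X_def by (auto intro!: derivative_eq_intros J_deriv)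
  have FF': "(FF has_vector_derivative ?F') (at v)"
    unfolding FF_def[abs_def]
    by (rule derivative_eq_intros Sg_deriv[OF eps] Cg_deriv[OF eps] | simp)+
  show "((\<lambda>v. (w (pi/2))^3 *\<^sub>R FF v) has_vector_derivative
      (w (pi/2))^3 *\<^sub>R ?F') (at v)"
    by (auto intro!: derivative_eq_intros FF')
  show "(w (pi/2))^3 *\<^sub>R FF v \<noteq> 0"
    using frame(4)[OF z] w by (auto simp: z_def lor_simps)
  have nT: "lor n (T (pi/2)) = 0" "T (pi/2) $ 2 = 0" using lor_frame(6)[OF z] T2[OF z] by (simp_all add: z_def)
  then have TTz: "TT z = T (pi/2)" by (simp add: TT_def z_def lift_def)
  have orth: "lor ?F' (TT z) = 0"
    "lor ?F' (FF v) = 0"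
    by (simp_all add: TTz FF_def lor_simps lor_ax2 nT n2 nn)
  show "tangential_part (tangent_space surf (X (pi/2, v)))
      ((w (pi/2))^3 *\<^sub>R ?F') = 0"
    unfolding z_def[symmetric]
  proof (rule tangential_part_eqI[OF X_in_hyp3[OF z]])
    show "lor (X z) y = 0" if "y \<in> tangent_space surf (X z)" for y
      using that by (auto simp: tangent_space_X[OF z] lor_simps frame[OF z])
    show "y - y' \<in> tangent_space surf (X z)"
      if y: "y \<in> tangent_space surf (X z)" "y' \<in> tangent_space surf (X z)" for y y'
    proof -
      obtain a b a' b' where "y = a *\<^sub>R TT z + b *\<^sub>R FF (snd z)" "y' = a' *\<^sub>R TT z + b' *\<^sub>R FF (snd z)"
        using y unfolding tangent_space_X[OF z] by blast
      then have "y - y' = (a - a') *\<^sub>R TT z + (b - b') *\<^sub>R FF (snd z)" by (simp add: algebra_simps)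
      then show ?thesis unfolding tangent_space_X[OF z] by blast
    qed
    have "0 = 0 *\<^sub>R TT z + 0 *\<^sub>R FF (snd z)" by simp
    then show "0 \<in> tangent_space surf (X z)" unfolding tangent_space_X[OF z] by blast
    fix y assume "y \<in> tangent_space surf (X z)"
    then obtain a b where "y = a *\<^sub>R TT z + b *\<^sub>R FF v" unfolding tangent_space_X[OF z] by (auto simp: z_def)
    then show "lor ((w (pi/2))^3 *\<^sub>R ?F' - 0) y = 0"
      using orth by (simp only: lor.add_right lor.scaleR_right lor.scaleR_left diff_zero) simp
  qed
qed

text \<open>Properness up to periods. A bounded point has bounded radius, and the defining equation
  then keeps sin \<theta> away from 0; the lower bound for \<open>w\<close> turns the bound on
  \<open>x $ 2\<close> into one on \<open>Sg \<epsilon> v\<close>.\<close>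

lemma surf_bounded_compact: "\<exists>K. compact K \<and> K \<subseteq> I \<times> UNIV \<and> surf \<inter> cball 0 R \<subseteq> X ` K"
proof -
  obtain c where c: "c > 0" "\<And>\<theta>. \<theta> \<in> I \<Longrightarrow> c \<le> w \<theta>" using w_lower_bound by blast
  obtain B where B: "\<And>x. norm (lor n x) \<le> B * norm x" "B \<ge> 0"
    using bounded_linear.nonneg_bounded[OF lor.bounded_linear_right[of n]] by (metis mult.commute)
  \<comment> \<open>An upper bound for both \<open>w^6\<close> and \<open>w^2\<close>; the summand 1
    covers the case \<open>w \<le> 1\<close>. The equation for \<open>w\<close> then yields
    \<open>(3 * k / sin \<theta>)^2 \<le> R' * (R' + 1)\<close>, from which \<open>d\<close> is read
    off.\<close>
  define R' where "R' = 1 + (B * R)^2 + R^2"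
  define d where "d = arcsin (min 1 (3 * k / sqrt (R' * (R' + 1))))"
  have R'1: "R' \<ge> 1" by (simp add: R'_def)
  have "0 < min 1 (3 * k / sqrt (R' * (R' + 1)))" using R'1 k_pos by simp
  then have d: "0 < d" "d \<le> pi/2" "sin d \<le> 3 * k / sqrt (R' * (R' + 1))"
    using arcsin_less_arcsin[of 0 "min 1 (3 * k / sqrt (R' * (R' + 1)))"] arcsin_le_arcsin[of _ 1]
      arcsin_bounded[of "min 1 (3 * k / sqrt (R' * (R' + 1)))"]
    by (auto simp: d_def sin_arcsin)
  define b where "b = pi + \<bar>R\<bar> / c^3"
  define K' where "K' = {d..pi - d} \<times> {- b..b}"
  have "surf \<inter> cball 0 R \<subseteq> X ` K'"
  proof
    fix x assume "x \<in> surf \<inter> cball 0 R"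
    then obtain z where z: "x = X z" "fst z \<in> I" and xR: "norm x \<le> R" by (auto simp: surf_def)
    note w = w_props[OF z(2)] c(2)[OF z(2)]
    have "\<bar>lor n x\<bar> \<le> B * R" using B(1)[of x] mult_left_mono[OF xR B(2)] by simp
    then have l1: "(lor n x)^2 \<le> (B * R)^2" by (metis abs_ge_zero power2_abs power_mono)
    have x2: "\<bar>x $ 2\<bar> \<le> R" using component_le_norm_cart[of x 2] xR by linarith
    then have l2: "(x $ 2)^2 \<le> R^2" by (metis abs_ge_zero power2_abs power_mono)
    have "(w (fst z))^6 = (lor n x)^2 + \<epsilon> * (x $ 2)^2" using X_radius[OF z(2)] z(1) by simp
    also have "\<dots> \<le> (B * R)^2 + R^2"
      using l1 l2 eps by (auto intro: order_trans add_mono)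
    finally have w6: "(w (fst z))^6 \<le> R'" "(w (fst z))^6 + \<epsilon> \<le> R' + 1" using eps by (auto simp: R'_def)
    have "(w (fst z))^2 \<le> R'"
    proof (cases "w (fst z) \<le> 1")
      case True
      then show ?thesis using power_le_one[of "w (fst z)" 2] w(1) R'1 by simp
    next
      case False
      then have "(w (fst z))^2 \<le> (w (fst z))^6" by (intro power_increasing) auto
      then show ?thesis using w6 by simp
    qed
    then have "9 * k^2 / (sin (fst z))^2 \<le> R' * (R' + 1)"
      using w w6 R'1 unfolding w(3)[symmetric] by (intro mult_mono) auto
    then have "9 * k^2 \<le> R' * (R' + 1) * (sin (fst z))^2"
      using sin_pos[OF z(2)] by (simp add: pos_divide_le_eq)
    then have "(3 * k / sqrt (R' * (R' + 1)))^2 \<le> (sin (fst z))^2"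
      using R'1 by (simp add: power_divide power_mult_distrib pos_divide_le_eq mult.commute)
    then have "3 * k / sqrt (R' * (R' + 1)) \<le> sin (fst z)"
      by (rule power2_le_imp_le) (use sin_pos[OF z(2)] in simp)
    then have sd: "sin d \<le> sin (fst z)" using d by simp
    have "d \<le> fst z \<and> fst z \<le> pi - d"
    proof (rule ccontr)
      assume "\<not> (d \<le> fst z \<and> fst z \<le> pi - d)"
      then consider "fst z < d" | "pi - fst z < d" by linarith
      then show False
      proof cases
        case 1
        then show ?thesis using sin_monotone_2pi[of "fst z" d] d z(2) sd by (auto simp: I_def)
      next
        case 2
        then show ?thesis using sin_monotone_2pi[of "pi - fst z" d] d z(2) sd by (auto simp: I_def)
      qed
    qed
    moreover obtain v' where v': "\<bar>v'\<bar> \<le> pi + \<bar>Sg \<epsilon> (snd z)\<bar>" "Sg \<epsilon> v' = Sg \<epsilon> (snd z)" "Cg \<epsilon> v' = Cg \<epsilon> (snd z)"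
      using Cg_Sg_small_representative[OF eps] by blast
    moreover have "\<bar>Sg \<epsilon> (snd z)\<bar> \<le> \<bar>R\<bar> / c^3"
    proof -
      have "\<bar>Sg \<epsilon> (snd z)\<bar> * c^3 \<le> \<bar>Sg \<epsilon> (snd z)\<bar> * (w (fst z))^3"
        using w c(1) by (intro mult_left_mono power_mono) auto
      also have "\<dots> = \<bar>x $ 2\<bar>" using X_2[OF z(2)] z(1) w(1) by (simp add: abs_mult)
      also have "\<dots> \<le> \<bar>R\<bar>" using x2 by simp
      finally show ?thesis using c(1) by (simp add: pos_le_divide_eq)
    qed
    ultimately have "(fst z, v') \<in> K'" by (auto simp: K'_def b_def)
    moreover have "x = X (fst z, v')" unfolding z(1) by (rule X_cong) (use v' in auto)
    ultimately show "x \<in> X ` K'" by blast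
  qed
  moreover have "compact K'" by (simp add: K'_def compact_Times)
  moreover have "K' \<subseteq> I \<times> UNIV" using d by (auto simp: K'_def I_def)
  ultimately show ?thesis by blast
qed

lemma closed_surf: "closed surf"
  unfolding closed_sequential_limits
proof (intro allI impI, elim conjE)
  fix x :: "nat \<Rightarrow> real^4" and l assume x: "\<forall>n. x n \<in> surf" "x \<longlonglongrightarrow> l"
  then obtain R where R: "\<And>n. norm (x n) \<le> R"
    using convergent_imp_bounded[of x l] by (auto simp: bounded_iff)
  obtain K' where K': "compact K'" "K' \<subseteq> I \<times> UNIV" "surf \<inter> cball 0 R \<subseteq> X ` K'"
    using surf_bounded_compact by blast
  have "compact (X ` K')"
    by (rule compact_continuous_image[OF continuous_on_subset[OF X_continuous K'(2)] K'(1)])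
  then have "closed (X ` K')" by (rule compact_imp_closed)
  moreover have "x n \<in> X ` K'" for n using K'(3) x(1) R by auto
  ultimately have "l \<in> X ` K'" using closed_sequentially x(2) by blast
  then show "l \<in> surf" using K'(2) by (auto simp: surf_def)
qed

lemma complete_surf: "complete_surface surf"
proof (rule complete_surfaceI[OF surf_hyp3 closed_surf])
  fix x :: "nat \<Rightarrow> real^4" and p assume x: "\<And>n. x n \<in> surf" "p \<in> surf" "x \<longlonglongrightarrow> p"
  obtain z where z: "p = X z" "fst z \<in> I" by (rule surfE[OF x(2)])
  obtain \<psi> where \<psi>: "homeomorphism (U (snd z)) (surf \<inter> W (snd z)) X \<psi>" using chart by blast
  show "(\<lambda>n. intrinsic_dist surf (x n) p) \<longlonglongrightarrow> 0"
  proof (rule intrinsic_dist_chart_tendsto[OF \<psi> open_U open_W _ surf_hyp3 _ x(1,3)])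
    show "Ck_on 1 (U (snd z)) X" by (rule X_smooth[OF open_U]) (auto simp: U_def)
    show "p \<in> surf \<inter> W (snd z)" using x(2) z(1) U_W[OF U_center[OF z(2)]] by blast
  qed
qed

end

text \<open>The factor \<open>s\<close> lets the standard parameter differ from the group parameter
  by a scale depending on \<theta>, as happens for \<open>C = 0\<close>.\<close>

lemma (in profile) conclusion:
  assumes F: "\<And>\<theta> v. \<theta> \<in> I \<Longrightarrow> F \<theta> (s \<theta> * v) = \<gamma> \<theta> + (w \<theta>)^3 *\<^sub>R (Sg \<epsilon> v *\<^sub>R ax2 - Dg \<epsilon> v *\<^sub>R n)"
    and s: "\<And>\<theta>. \<theta> \<in> I \<Longrightarrow> s \<theta> \<noteq> 0"
    and S: "S = {F \<theta> v | \<theta> v. \<theta> \<in> I}" and B: "B = range (F (pi/2))"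
  shows "regular_surface S \<and> complete_surface S \<and> biconservative S \<and>
    (\<forall>W N. open W \<and> unit_normal_field S W N \<longrightarrow>
       (\<forall>p\<in>B \<inter> W. has_surface_gradient S (mean_curvature S N) 0 p)) \<and>
    (\<exists>\<gamma>. geodesic S \<gamma> \<and> range \<gamma> = B)"
proof -
  have FX: "F \<theta> v = X (\<theta>, v / s \<theta>)" if "\<theta> \<in> I" for \<theta> v
    using F[OF that, of "v / s \<theta>"] s[OF that] by (simp add: X_def J_def)
  have XF: "X (\<theta>, v) = F \<theta> (s \<theta> * v)" if "\<theta> \<in> I" for \<theta> v
    using FX[OF that, of "s \<theta> * v"] s[OF that] by simp
  have S: "S = surf"
  proof (intro equalityI subsetI)
    fix x assume "x \<in> S"
    then show "x \<in> surf" using S FX X_surf by auto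
  next
    fix x assume "x \<in> surf"
    then obtain z where z: "x = X z" "fst z \<in> I" by (rule surfE)
    then have "x = F (fst z) (s (fst z) * snd z)" using XF[OF z(2), of "snd z"] by simp
    then show "x \<in> S" using S z(2) by blast
  qed
  have half: "pi/2 \<in> I" by (simp add: I_def)
  have B: "B = range (\<lambda>v. X (pi/2, v))"
  proof (intro equalityI subsetI)
    fix x assume "x \<in> B"
    then show "x \<in> range (\<lambda>v. X (pi/2, v))" using B FX[OF half] by auto
  next
    fix x assume "x \<in> range (\<lambda>v. X (pi/2, v))"
    then show "x \<in> B" using B XF[OF half] by auto
  qed
  show ?thesis
    unfolding S B using regular complete_surf biconservative_surf gradient_vanishes geodesic_boundary by blast
qed

section \<open>The standard surfaces in the angle parameter\<close>

text \<open>For nonzero \<open>C\<close> the first condition determines \<open>k\<close> and makes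
  the powers of \<kappa> that occur in the formulas rational in \<open>w\<close>. For
  \<open>C = 0\<close> it leaves \<open>k\<close> free, and \<open>k = 1\<close> makes the radius
  \<open>w^3\<close> equal to \<kappa>^(-3/4).\<close>

locale standard_profile = radial +
  fixes C :: real
  assumes kC: "9 * C * k powr (3/2) = 16 * \<epsilon>" and k0: "C = 0 \<Longrightarrow> k = 1"
begin

lemma C_eps: "C > 0 \<longleftrightarrow> \<epsilon> = 1" "C < 0 \<longleftrightarrow> \<epsilon> = -1" "C = 0 \<longleftrightarrow> \<epsilon> = 0"
proof -
  have "0 < k powr (3/2)" using k_pos by simp
  then have "0 < C \<longleftrightarrow> 0 < \<epsilon>" "C < 0 \<longleftrightarrow> \<epsilon> < 0"
    using kC by (smt (verit, best) mult_pos_pos mult_neg_pos mult_le_0_iff zero_less_mult_iff mult_less_0_iff)+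
  then show "C > 0 \<longleftrightarrow> \<epsilon> = 1" "C < 0 \<longleftrightarrow> \<epsilon> = -1" "C = 0 \<longleftrightarrow> \<epsilon> = 0" using eps by auto
qed

lemma k_powr: "C \<noteq> 0 \<Longrightarrow> 3 * sqrt \<bar>C\<bar> * k powr (3/4) = 4"
proof -
  assume "C \<noteq> 0"
  have "9 * \<bar>C\<bar> * k powr (3/2) = \<bar>9 * C * k powr (3/2)\<bar>" by (simp add: abs_mult)
  also have "\<dots> = 16" using kC eps C_eps(3) \<open>C \<noteq> 0\<close> by auto
  finally have "9 * \<bar>C\<bar> * k powr (3/2) = 16" .
  moreover have "(k powr (3/4))^2 = k powr (3/2)"
    using k_pos by (simp add: power2_eq_square flip: powr_add)
  ultimately have "(3 * sqrt \<bar>C\<bar> * k powr (3/4))^2 = 4^2"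
    by (simp add: power_mult_distrib)
  from power2_eq_imp_eq[OF this] show ?thesis using k_pos by simp
qed

lemma power_powr_4: "0 < x \<Longrightarrow> (x^4) powr (3/4) = x^3" "0 < x \<Longrightarrow> (x^4) powr (3/2) = x^6" for x :: real
proof -
  assume x: "0 < x"
  have "x^4 = x powr 4" "x^3 = x powr 3" "x^6 = x powr 6" using x by simp_all
  then show "(x^4) powr (3/4) = x^3" "(x^4) powr (3/2) = x^6"
    using x by (simp_all only: powr_powr) simp_all
qed

lemma K_powr:
  assumes "0 < x"
  shows "(k / x^4) powr (3/4) = k powr (3/4) / x^3"
    "9 * C * (k / x^4) powr (3/2) = 16 * \<epsilon> / x^6"
    "C \<noteq> 0 \<Longrightarrow> 3 * sqrt \<bar>C\<bar> * (k / x^4) powr (3/4) = 4 / x^3"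
    "C = 0 \<Longrightarrow> (k / x^4) powr (3/4) = 1 / x^3"
proof -
  show a: "(k / x^4) powr (3/4) = k powr (3/4) / x^3"
    using k_pos assms by (simp add: powr_divide power_powr_4)
  have "(k / x^4) powr (3/2) = k powr (3/2) / x^6"
    using k_pos assms by (simp add: powr_divide power_powr_4)
  then show "9 * C * (k / x^4) powr (3/2) = 16 * \<epsilon> / x^6" by (simp flip: kC)
  show "3 * sqrt \<bar>C\<bar> * (k / x^4) powr (3/4) = 4 / x^3" if "C \<noteq> 0"
    by (simp only: a times_divide_eq_right k_powr[OF that])
  show "(k / x^4) powr (3/4) = 1 / x^3" if "C = 0" unfolding a using k0[OF that] by simp
qed

text \<open>The bracket vanishes exactly when \<open>x\<close> solves the radial equation with sin
  \<theta> = 1, so the zero of the radicand corresponds to \<theta> = \<pi>/2.\<close>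

lemma radicand_eq:
  assumes "0 < x"
  shows "radicand C (k / x^4) = 16/9 * (k / x^4)^2 * (x^6 + \<epsilon> - 9 * k^2 / x^2) / x^6"
proof -
  define \<kappa> where "\<kappa> = k / x^4"
  have "0 < \<kappa>" using assms k_pos by (simp add: \<kappa>_def)
  then have "\<kappa> powr (7/2) = \<kappa>^2 * \<kappa> powr (3/2)" using powr_add[of \<kappa> 2 "3/2"] by simp
  then have "radicand C \<kappa> = 16/9 * \<kappa>^2 * (1 + 9 * C * \<kappa> powr (3/2) / 16 - 9 * \<kappa>^2)"
    using \<open>0 < \<kappa>\<close> by (simp add: radicand_def algebra_simps power_numeral_reduce)
  also have "1 + 9 * C * \<kappa> powr (3/2) / 16 - 9 * \<kappa>^2 = (x^6 + \<epsilon> - 9 * k^2 / x^2) / x^6"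
    using assms unfolding \<kappa>_def K_powr(2)[OF assms] by (simp add: field_simps power_numeral_reduce)
  finally show ?thesis by (simp add: \<kappa>_def)
qed

lemma radial_parameter:
  assumes "0 < \<kappa>"
  obtains x where "0 < x" "\<kappa> = k / x^4"
proof
  have "0 < k / \<kappa>" using assms k_pos by simp
  then have "((k / \<kappa>) powr (1/4))^4 = k / \<kappa>"
    using assms k_pos by (simp add: powr_powr flip: powr_numeral)
  then show "\<kappa> = k / ((k / \<kappa>) powr (1/4))^4" using assms k_pos by simp
  show "0 < (k / \<kappa>) powr (1/4)" using assms k_pos by simp
qed

lemma half_pi_I: "pi/2 \<in> I"
  by (simp add: I_def)

lemma kappa01_eq: "kappa01 C = K (pi/2)"
  unfolding kappa01_def
proof (rule the_equality)
  note w = w_props[OF half_pi_I]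
  show "0 < K (pi/2) \<and> radicand C (K (pi/2)) = 0"
    using w K_pos[OF half_pi_I] unfolding K_def radicand_eq[OF w(1)] by (simp add: field_simps)
  fix \<kappa> assume \<kappa>: "0 < \<kappa> \<and> radicand C \<kappa> = 0"
  then obtain x where x: "0 < x" "\<kappa> = k / x^4" using radial_parameter[of \<kappa>] by blast
  have "x^6 + \<epsilon> - 9 * k^2 / x^2 = 0" using \<kappa> x(1) k_pos unfolding x(2) radicand_eq[OF x(1)] by simp
  then have e: "x^6 + \<epsilon> = 9 * k^2 / x^2" by simp
  then have "0 < x^6 + \<epsilon>" "x^2 * (x^6 + \<epsilon>) = 9 * k^2" using x(1) k_pos by simp_all
  then have "radial_root \<epsilon> (9 * k^2) = x" using radial_root_eqI[OF eps x(1)] by blast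
  then show "\<kappa> = K (pi/2)" by (simp add: K_def w_def x(2))
qed

lemma w_less:
  assumes "a \<in> I" "b \<in> I" "sin a < sin b"
  shows "w b < w a"
proof (rule ccontr)
  assume "\<not> w b < w a"
  then have "w a = w b \<or> w a < w b" by linarith
  then have "(w a)^2 * ((w a)^6 + \<epsilon>) \<le> (w b)^2 * ((w b)^6 + \<epsilon>)"
    using radial_poly_less[OF w_props(1,2)[OF assms(1)]] by fastforce
  then have "9 * k^2 / (sin a)^2 \<le> 9 * k^2 / (sin b)^2" using w_props(3) assms by simp
  moreover have "(sin a)^2 < (sin b)^2" "0 < (sin a)^2" "0 < (sin b)^2"
    using assms sin_pos[OF assms(1)] power_strict_mono[of "sin a" "sin b" 2] by auto
  then have "9 * k^2 / (sin b)^2 < 9 * k^2 / (sin a)^2"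
    using k_pos by (intro divide_strict_left_mono) auto
  ultimately show False by simp
qed

lemma K_less:
  assumes "a \<in> I" "b \<in> I" "sin a < sin b"
  shows "K a < K b"
  using w_less[OF assms] w_props(1)[OF assms(1)] w_props(1)[OF assms(2)] k_pos
  unfolding K_def by (intro divide_strict_left_mono power_strict_mono mult_pos_pos) auto

lemma sin_less_quarter: "0 \<le> a \<Longrightarrow> a < b \<Longrightarrow> b \<le> pi/2 \<Longrightarrow> sin a < sin b"
  using sin_monotone_2pi[of a b] by simp

lemma K_image: "K ` {0<..<pi/2} = {0<..<kappa01 C}"
proof (intro equalityI subsetI)
  fix y assume "y \<in> K ` {0<..<pi/2}"
  then obtain \<theta> where \<theta>: "y = K \<theta>" "0 < \<theta>" "\<theta> < pi/2" by auto
  then have "\<theta> \<in> I" by (simp add: I_def)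
  then show "y \<in> {0<..<kappa01 C}"
    using K_pos K_less[OF _ half_pi_I, of \<theta>] sin_less_quarter[of \<theta> "pi/2"] \<theta> by (simp add: kappa01_eq)
next
  fix y assume y: "y \<in> {0<..<kappa01 C}"
  then have "0 < y" by simp
  then obtain x where x: "0 < x" "y = k / x^4" by (rule radial_parameter)
  note w = w_props[OF half_pi_I]
  have "w (pi/2) < x"
  proof (rule ccontr)
    assume "\<not> w (pi/2) < x"
    then have "x^4 \<le> (w (pi/2))^4" using x(1) by (intro power_mono) auto
    then have "K (pi/2) \<le> y"
      unfolding K_def x(2) using x(1) w(1) k_pos by (intro divide_left_mono) auto
    then show False using y by (simp add: kappa01_eq)
  qed
  then have gt: "9 * k^2 < x^2 * (x^6 + \<epsilon>)" using radial_poly_less[OF w(1,2)] w(3) by simp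
  have "(w (pi/2))^6 < x^6" using \<open>w (pi/2) < x\<close> w(1) by (intro power_strict_mono) auto
  then have pos: "0 < x^6 + \<epsilon>" using w(2) by linarith
  \<comment> \<open>The value that \<open>3 * k / sin \<theta>\<close> must have if
    \<open>w \<theta> = x\<close>; it exceeds \<open>3 * k\<close> because \<open>x\<close> exceeds
    \<open>w (pi/2)\<close>, so the angle is an arcsine.\<close>
  define q where "q = sqrt (x^2 * (x^6 + \<epsilon>))"
  have q2: "q^2 = x^2 * (x^6 + \<epsilon>)" using pos x(1) by (simp add: q_def)
  have q: "3 * k < q" unfolding q_def using gt k_pos by (intro real_less_rsqrt) (simp add: power_mult_distrib)
  define \<theta> where "\<theta> = arcsin (3 * k / q)"
  have r: "0 < 3 * k / q" "3 * k / q < 1" using q k_pos by auto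
  have s: "sin \<theta> = 3 * k / q" unfolding \<theta>_def using r by (intro sin_arcsin) auto
  have "0 < \<theta>" "\<theta> < pi/2"
    using r arcsin_less_arcsin[of 0 "3 * k / q"] arcsin_less_arcsin[of "3 * k / q" 1] by (auto simp: \<theta>_def)
  moreover have "w \<theta> = x"
  proof -
    have "9 * k^2 / (sin \<theta>)^2 = q^2" using k_pos q by (simp add: s power_divide power_mult_distrib)
    then show ?thesis unfolding w_def using radial_root_eqI[OF eps x(1) pos] q2 by simp
  qed
  ultimately show "y \<in> K ` {0<..<pi/2}" using x(2) by (auto simp: K_def)
qed

definition integrand :: "real \<Rightarrow> real" where
  "integrand \<tau> = (if C = 0 then 9/4 * (\<tau> powr (3/4) / sqrt (1 - 9 * \<tau>^2))
     else 36 * sqrt \<bar>C\<bar> * \<tau> powr (7/4) / ((9 * C * \<tau> powr (3/2) + 16) * sqrt (radicand C \<tau>)))"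

lemma mu0_eq: "mu0 C \<kappa>00 \<kappa> = (LBINT \<tau>=\<kappa>00..\<kappa>. integrand \<tau>)"
proof (cases "C = 0")
  case True
  then have "\<not> 0 < C" "\<not> C < 0" by simp_all
  then show ?thesis
    unfolding mu0_def integrand_def[abs_def] if_P[OF True] by (simp only: if_False interval_lebesgue_integral_mult_right)
next
  case False
  then show ?thesis
    unfolding mu0_def integrand_def[abs_def] if_not_P[OF False] by (cases "0 < C") simp_all
qed

text \<open>Since \<open>9 * k^2 / w^2 = (P * sin \<theta>)^2\<close> and
  \<open>w^6 + \<epsilon> = P^2\<close>, the bracket in the radicand becomes
  \<open>(P * cos \<theta>)^2\<close>. The root is explicit because the cosine is positive on the
  first half of the interval.\<close>

lemma radicand_K:
  assumes "\<theta> \<in> {0<..<pi/2}"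
  shows "sqrt (radicand C (K \<theta>)) = 4/3 * K \<theta> * P \<theta> * cos \<theta> / (w \<theta>)^3"
    "9 * C * K \<theta> powr (3/2) + 16 = 16 * (P \<theta>)^2 / (w \<theta>)^6"
    "C = 0 \<Longrightarrow> 1 - 9 * (K \<theta>)^2 = (cos \<theta>)^2"
proof -
  have \<theta>: "\<theta> \<in> I" using assms by (simp add: I_def)
  have c: "0 < cos \<theta>" using assms by (intro cos_gt_zero_pi) auto
  note w = w_props[OF \<theta>] and P = P_pos[OF \<theta>] and K = K_pos[OF \<theta>]
  have e: "9 * k^2 / (w \<theta>)^2 = (P \<theta>)^2 * (sin \<theta>)^2"
    using P_sin[OF \<theta>] by (simp add: power_divide power_mult_distrib flip: power_mult_distrib[of "P \<theta>"])
  have "radicand C (K \<theta>) = 16/9 * (K \<theta>)^2 * ((P \<theta>)^2 - (P \<theta>)^2 * (sin \<theta>)^2) / (w \<theta>)^6"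
    unfolding K_def radicand_eq[OF w(1)] e P_square[OF \<theta>, symmetric] ..
  also have "\<dots> = (4/3 * K \<theta> * P \<theta> * cos \<theta> / (w \<theta>)^3)^2"
    using w(1) by (simp add: cos_squared_eq power_mult_distrib power_divide field_simps flip: power_mult)
  finally show "sqrt (radicand C (K \<theta>)) = 4/3 * K \<theta> * P \<theta> * cos \<theta> / (w \<theta>)^3"
    using K P c w(1) by (simp add: real_sqrt_unique)
  show "9 * C * K \<theta> powr (3/2) + 16 = 16 * (P \<theta>)^2 / (w \<theta>)^6"
    unfolding K_def K_powr(2)[OF w(1)] P_square[OF \<theta>] using w(1) by (simp add: field_simps)
  show "1 - 9 * (K \<theta>)^2 = (cos \<theta>)^2" if "C = 0"
  proof -
    have "(P \<theta>)^2 = (w \<theta>)^6" using P_square[OF \<theta>] C_eps(3) that by simp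
    then have "(w \<theta>)^6 * (sin \<theta>)^2 = 9 * k^2 / (w \<theta>)^2" using e by simp
    then have "(sin \<theta>)^2 = 9 * (K \<theta>)^2"
      using w(1) by (simp add: K_def field_simps power_numeral_reduce)
    then show ?thesis by (simp add: cos_squared_eq)
  qed
qed

text \<open>The only singular factor at \<pi>/2 is \<open>1 / cos \<theta>\<close>, so the product
  with the derivative of \<open>K\<close> extends across the boundary curve.\<close>

lemma integrand_K:
  assumes "\<theta> \<in> {0<..<pi/2}"
  shows "integrand (K \<theta>) = 9/4 * (w \<theta>)^6 / ((P \<theta>)^3 * cos \<theta>)"
proof -
  have \<theta>: "\<theta> \<in> I" using assms by (simp add: I_def)
  have c: "0 < cos \<theta>" using assms by (intro cos_gt_zero_pi) auto
  note w = w_props[OF \<theta>] and P = P_pos[OF \<theta>] and K = K_pos[OF \<theta>] and r = radicand_K[OF assms]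
  show ?thesis
  proof (cases "C = 0")
    case True
    have "(P \<theta>)^2 = ((w \<theta>)^3)^2" using P_square[OF \<theta>] C_eps(3) True by simp
    from power2_eq_imp_eq[OF this] have Pw: "P \<theta> = (w \<theta>)^3" using P w(1) by simp
    have kp: "K \<theta> powr (3/4) = 1 / (w \<theta>)^3" unfolding K_def by (rule K_powr(4)[OF w(1) True])
    have "integrand (K \<theta>) = 9/4 * (1 / (w \<theta>)^3 / cos \<theta>)"
      unfolding integrand_def if_P[OF True] r(3)[OF True] kp using c by simp
    then show ?thesis using w(1) by (simp add: Pw field_simps power_numeral_reduce)
  next
    case False
    have "K \<theta> powr (7/4) = K \<theta> * K \<theta> powr (3/4)" using K by (simp add: powr_mult_base)
    then have "36 * sqrt \<bar>C\<bar> * K \<theta> powr (7/4) = 12 * K \<theta> * (3 * sqrt \<bar>C\<bar> * K \<theta> powr (3/4))" by simp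
    also have "\<dots> = 12 * K \<theta> * (4 / (w \<theta>)^3)" using K_powr(3)[OF w(1) False] by (simp add: K_def)
    finally have n: "36 * sqrt \<bar>C\<bar> * K \<theta> powr (7/4) = 12 * K \<theta> * (4 / (w \<theta>)^3)" .
    show ?thesis
      using False w(1) P K c unfolding integrand_def n r(1,2)
      by (simp add: field_simps power_numeral_reduce)
  qed
qed

lemma continuous_on_integrand: "continuous_on {0<..<kappa01 C} integrand"
proof -
  have nz: "(C = 0 \<longrightarrow> 0 < 1 - 9 * \<tau>^2) \<and> 9 * C * \<tau> powr (3/2) + 16 \<noteq> 0 \<and> sqrt (radicand C \<tau>) \<noteq> 0 \<and> 0 < \<tau>"
    if \<tau>: "\<tau> \<in> {0<..<kappa01 C}" for \<tau>
  proof -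
    obtain \<theta> where \<theta>: "\<theta> \<in> {0<..<pi/2}" "\<tau> = K \<theta>" using \<tau> K_image by blast
    then have \<theta>I: "\<theta> \<in> I" by (simp add: I_def)
    have c: "0 < cos \<theta>" using \<theta>(1) by (intro cos_gt_zero_pi) auto
    show ?thesis
      using radicand_K[OF \<theta>(1)] \<theta>(2) c w_props(1)[OF \<theta>I] P_pos[OF \<theta>I] K_pos[OF \<theta>I] by simp
  qed
  show ?thesis
  proof (cases "C = 0")
    case True
    have "continuous_on {0<..<kappa01 C} (\<lambda>\<tau>. 9/4 * (\<tau> powr (3/4) / sqrt (1 - 9 * \<tau>^2)))"
      using nz True by (intro continuous_intros) fastforce+
    then show ?thesis unfolding integrand_def[abs_def] if_P[OF True] .
  next
    case False
    have "continuous_on {0<..<kappa01 C} (radicand C)"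
      unfolding radicand_def[abs_def] by (intro continuous_intros) auto
    then have "continuous_on {0<..<kappa01 C}
        (\<lambda>\<tau>. 36 * sqrt \<bar>C\<bar> * \<tau> powr (7/4) / ((9 * C * \<tau> powr (3/2) + 16) * sqrt (radicand C \<tau>)))"
      using nz by (intro continuous_intros) fastforce+
    then show ?thesis unfolding integrand_def[abs_def] if_not_P[OF False] .
  qed
qed

text \<open>After the substitution both sides have the same derivative, so they differ by a
  constant. As \<open>M\<close> vanishes at \<pi>/2, that constant is the limit \<mu>01, whatever
  base point \<kappa>00 was fixed.\<close>

lemma mu0_K:
  assumes "0 < \<kappa>00" "\<kappa>00 < kappa01 C" "\<theta> \<in> {0<..<pi/2}"
  shows "mu0 C \<kappa>00 (K \<theta>) = mu01 C \<kappa>00 + M \<theta>"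
proof -
  have "((\<lambda>\<theta>. mu0 C \<kappa>00 (K \<theta>) - M \<theta>) has_real_derivative 0) (at \<theta> within {0<..<pi/2})"
    if \<theta>: "\<theta> \<in> {0<..<pi/2}" for \<theta>
  proof -
    have \<theta>I: "\<theta> \<in> I" using \<theta> by (simp add: I_def)
    have c: "0 < cos \<theta>" using \<theta> by (intro cos_gt_zero_pi) auto
    let ?K' = "(4 * \<sigma> \<theta> * K \<theta> * P \<theta> * cos \<theta> / (3 * (w \<theta>)^3))"
    have "K \<theta> \<in> {0<..<kappa01 C}" using \<theta> K_image by blast
    then have "(mu0 C \<kappa>00 has_real_derivative integrand (K \<theta>)) (at (K \<theta>))"
      unfolding mu0_eq[abs_def]
      by (intro interval_integral_has_derivative[OF continuous_on_integrand]) (use assms in auto)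
    from DERIV_diff[OF DERIV_chain2[OF this K_deriv[OF \<theta>I]] M_deriv[OF \<theta>I]]
    have "((\<lambda>\<theta>. mu0 C \<kappa>00 (K \<theta>) - M \<theta>) has_real_derivative
        integrand (K \<theta>) * ?K' - 3 * (w \<theta>)^3 / Q \<theta>) (at \<theta>)" .
    moreover have "integrand (K \<theta>) * ?K' = 3 * (w \<theta>)^3 / Q \<theta>"
    proof -
      have "integrand (K \<theta>) * ?K'
          = 3 * (w \<theta>)^3 * (\<sigma> \<theta> * K \<theta>) / (P \<theta>)^2"
        using c P_pos[OF \<theta>I] w_props(1)[OF \<theta>I] unfolding integrand_K[OF \<theta>]
        by (simp add: field_simps power_numeral_reduce)
      then show ?thesis using P_pos[OF \<theta>I] by (simp add: \<sigma>_K[OF \<theta>I])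
    qed
    ultimately show ?thesis by (simp add: has_field_derivative_at_within)
  qed
  then obtain m where m: "\<And>\<theta>. \<theta> \<in> {0<..<pi/2} \<Longrightarrow> mu0 C \<kappa>00 (K \<theta>) - M \<theta> = m"
    using has_field_derivative_zero_constant[of "{0<..<pi/2}" "\<lambda>\<theta>. mu0 C \<kappa>00 (K \<theta>) - M \<theta>"] by auto
  have pos: "0 < kappa01 C" using assms by linarith
  \<comment> \<open>Continuity of \<open>M\<close> at \<pi>/2 controls angles close to \<pi>/2;
    since \<open>K\<close> increases on the first half, \<kappa> close to its upper end forces such
    an angle.\<close>
  have "(mu0 C \<kappa>00 \<longlongrightarrow> m) (at_left (kappa01 C))"
  proof (rule tendstoI)
    fix d :: real assume "0 < d"
    have "isCont M (pi/2)" using M_deriv[OF half_pi_I] by (rule DERIV_isCont)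
    then obtain r where r: "r > 0" "\<And>x. dist x (pi/2) < r \<Longrightarrow> dist (M x) (M (pi/2)) < d"
      using \<open>0 < d\<close> unfolding continuous_at_eps_delta dist_real_def by blast
    define \<theta>0 where "\<theta>0 = max (pi/4) (pi/2 - r/2)"
    have \<theta>0: "0 < \<theta>0" "\<theta>0 < pi/2" "pi/2 - r < \<theta>0" using r(1) by (auto simp: \<theta>0_def max_def)
    have "K \<theta>0 \<in> {0<..<kappa01 C}" using \<theta>0 K_image by (metis greaterThanLessThan_iff image_eqI)
    then have "K \<theta>0 < kappa01 C" by simp
    moreover have "dist (mu0 C \<kappa>00 y) m < d" if y: "K \<theta>0 < y" "y < kappa01 C" for y
    proof -
      have "0 < y" using y \<open>K \<theta>0 \<in> {0<..<kappa01 C}\<close> by simp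
      then obtain \<theta> where \<theta>: "\<theta> \<in> {0<..<pi/2}" "y = K \<theta>" 
        using y K_image \<open>0 < y\<close> by (metis greaterThanLessThan_iff image_iff)
      have "\<theta>0 < \<theta>"
      proof (rule ccontr)
        assume "\<not> \<theta>0 < \<theta>"
        then have "\<theta> = \<theta>0 \<or> \<theta> < \<theta>0" by linarith
        then show False
          using y \<theta> \<theta>0 K_less[of \<theta> \<theta>0] sin_less_quarter[of \<theta> \<theta>0] by (auto simp: I_def)
      qed
      then have "dist \<theta> (pi/2) < r" using \<theta> \<theta>0 by (auto simp: dist_real_def)
      then show ?thesis using r(2)[of \<theta>] m[OF \<theta>(1)] \<theta>(2) M_half_pi by (simp add: dist_real_def)
    qed
    ultimately show "eventually (\<lambda>y. dist (mu0 C \<kappa>00 y) m < d) (at_left (kappa01 C))"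
      unfolding eventually_at_left_field by blast
  qed
  then have "mu01 C \<kappa>00 = m" unfolding mu01_def by (intro tendsto_Lim) simp_all
  then show ?thesis using m[OF assms(3)] by simp
qed

text \<open>Replacing \<theta> by \<pi> - \<theta> keeps \<open>K\<close> and changes the sign of
  \<open>M\<close>, which turns the first surface into the second; \<theta> = \<pi>/2 supplies the
  boundary curve.\<close>

lemma glued_surface:
  assumes "0 < \<kappa>00" "\<kappa>00 < kappa01 C"
  defines "F \<equiv> \<lambda>\<theta>. X_std C (mu01 C \<kappa>00 + M \<theta>) (K \<theta>)"
  shows "boundary_curve C \<kappa>00 = range (F (pi/2))"
    "surface1 C \<kappa>00 \<union> boundary_curve C \<kappa>00 \<union> surface2 C \<kappa>00 = {F \<theta> v | \<theta> v. \<theta> \<in> I}"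
proof -
  let ?S1 = "{F \<theta> v | \<theta> v. \<theta> \<in> {0<..<pi/2}}" and ?S2 = "{F \<theta> v | \<theta> v. \<theta> \<in> {pi/2<..<pi}}"
  show B: "boundary_curve C \<kappa>00 = range (F (pi/2))"
    using M_half_pi by (simp add: boundary_curve_def F_def kappa01_eq)
  have ex: "\<exists>\<theta>\<in>{0<..<pi/2}. \<kappa> = K \<theta>" if "0 < \<kappa>" "\<kappa> < kappa01 C" for \<kappa>
  proof -
    have "\<kappa> \<in> K ` {0<..<pi/2}" using that by (simp add: K_image)
    then show ?thesis by blast
  qed
  have K: "0 < K \<theta> \<and> K \<theta> < kappa01 C" if "\<theta> \<in> {0<..<pi/2}" for \<theta>
  proof -
    have "K \<theta> \<in> {0<..<kappa01 C}" using that K_image by blast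
    then show ?thesis by simp
  qed
  have 1: "surface1 C \<kappa>00 = ?S1"
  proof (intro equalityI subsetI)
    fix x assume "x \<in> surface1 C \<kappa>00"
    then obtain \<kappa> v where "x = X_std C (mu0 C \<kappa>00 \<kappa>) \<kappa> v" "0 < \<kappa>" "\<kappa> < kappa01 C"
      unfolding surface1_def standard_surface_def by blast
    moreover from this obtain \<theta> where "\<theta> \<in> {0<..<pi/2}" "\<kappa> = K \<theta>" using ex by blast
    ultimately show "x \<in> ?S1" using mu0_K[OF assms(1,2)] unfolding F_def by force
  next
    fix x assume "x \<in> ?S1"
    then obtain \<theta> v where \<theta>: "x = F \<theta> v" "\<theta> \<in> {0<..<pi/2}" by blast
    then have "x = X_std C (mu0 C \<kappa>00 (K \<theta>)) (K \<theta>) v" using mu0_K[OF assms(1,2) \<theta>(2)] by (simp add: F_def)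
    then show "x \<in> surface1 C \<kappa>00" using K[OF \<theta>(2)] unfolding surface1_def standard_surface_def by blast
  qed
  have refl: "F (pi - \<theta>) v = X_std C (- mu0 C \<kappa>00 (K \<theta>) + 2 * mu01 C \<kappa>00) (K \<theta>) v"
    if "\<theta> \<in> {0<..<pi/2}" for \<theta> v
  proof -
    have "\<theta> \<in> I" using that by (simp add: I_def)
    then show ?thesis
      using mu0_K[OF assms(1,2) that] by (simp add: F_def M_symmetric K_def w_symmetric)
  qed
  have 2: "surface2 C \<kappa>00 = ?S2"
  proof (intro equalityI subsetI)
    fix x assume "x \<in> surface2 C \<kappa>00"
    then obtain \<kappa> v where x: "x = X_std C (- mu0 C \<kappa>00 \<kappa> + 2 * mu01 C \<kappa>00) \<kappa> v" "0 < \<kappa>" "\<kappa> < kappa01 C"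
      unfolding surface2_def standard_surface_def by blast
    moreover from this obtain \<theta> where \<theta>: "\<theta> \<in> {0<..<pi/2}" "\<kappa> = K \<theta>" using ex by blast
    ultimately have "x = F (pi - \<theta>) v" using refl[OF \<theta>(1)] by simp
    moreover have "pi - \<theta> \<in> {pi/2<..<pi}" using \<theta>(1) by auto
    ultimately show "x \<in> ?S2" by blast
  next
    fix x assume "x \<in> ?S2"
    then obtain \<theta> v where \<theta>: "x = F \<theta> v" "\<theta> \<in> {pi/2<..<pi}" by blast
    then have \<theta>': "pi - \<theta> \<in> {0<..<pi/2}" by auto
    then have "x = X_std C (- mu0 C \<kappa>00 (K (pi - \<theta>)) + 2 * mu01 C \<kappa>00) (K (pi - \<theta>)) v"
      using refl[OF \<theta>'] \<theta>(1) by simp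
    then show "x \<in> surface2 C \<kappa>00" using K[OF \<theta>'] unfolding surface2_def standard_surface_def by blast
  qed
  have I: "\<theta> \<in> I \<longleftrightarrow> \<theta> \<in> {0<..<pi/2} \<or> \<theta> = pi/2 \<or> \<theta> \<in> {pi/2<..<pi}" for \<theta>
    unfolding I_def greaterThanLessThan_iff using pi_gt_zero by linarith
  show "surface1 C \<kappa>00 \<union> boundary_curve C \<kappa>00 \<union> surface2 C \<kappa>00 = {F \<theta> v | \<theta> v. \<theta> \<in> I}"
    unfolding 1 2 B I by blast
qed

end

section \<open>Coordinates and the three explicit profile curves\<close>

lemma vector4_nth [simp]:
  "(vector [a, b, c, d] :: real^4) $ 1 = a" "(vector [a, b, c, d] :: real^4) $ 2 = b"
  "(vector [a, b, c, d] :: real^4) $ 3 = c" "(vector [a, b, c, d] :: real^4) $ 4 = d"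
  unfolding vector_def by simp_all

lemma vector4_eqI: "x $ 1 = y $ 1 \<Longrightarrow> x $ 2 = y $ 2 \<Longrightarrow> x $ 3 = y $ 3 \<Longrightarrow> x $ 4 = y $ 4 \<Longrightarrow> x = y"
  for x y :: "real^4"
  by (simp add: vec_eq_iff forall_4)

lemma has_vector_derivative_vector4:
  assumes "(a has_real_derivative a') (at t)" "(b has_real_derivative b') (at t)"
    "(c has_real_derivative c') (at t)" "(d has_real_derivative d') (at t)"
    and "v $ 1 = a'" "v $ 2 = b'" "v $ 3 = c'" "v $ 4 = d'"
  shows "((\<lambda>t. vector [a t, b t, c t, d t] :: real^4) has_vector_derivative v) (at t)"
proof -
  have eq: "vector [p, q, r, s] = p *\<^sub>R axis 1 1 + q *\<^sub>R axis 2 1 + r *\<^sub>R axis 3 1 + s *\<^sub>R (axis 4 1 :: real^4)" for p q r s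
    by (rule vector4_eqI) (simp_all add: axis_def)
  have "v = vector [a', b', c', d']" using assms(5-8) by (intro vector4_eqI) simp_all
  then show ?thesis
    unfolding eq using assms(1-4) by (auto intro!: derivative_eq_intros)
qed

lemma ax2_nth [simp]: "ax2 $ 1 = 0" "ax2 $ 2 = 1" "ax2 $ 3 = 0" "ax2 $ 4 = 0"
  by (simp_all add: axis_def)

lemma sqrt2_simps: "sqrt 2 * sqrt 2 = 2" "sqrt 2 * (sqrt 2 * a) = 2 * a"
proof -
  show "sqrt 2 * sqrt 2 = 2" by simp
  then show "sqrt 2 * (sqrt 2 * a) = 2 * a" by (simp only: mult.assoc[symmetric])
qed

context standard_profile
begin

lemma K_std: "\<theta> \<in> I \<Longrightarrow> K \<theta> powr (3/4) = k powr (3/4) / (w \<theta>)^3"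
  "\<theta> \<in> I \<Longrightarrow> C \<noteq> 0 \<Longrightarrow> 3 * sqrt \<bar>C\<bar> * K \<theta> powr (3/4) = 4 / (w \<theta>)^3"
  "\<theta> \<in> I \<Longrightarrow> C = 0 \<Longrightarrow> K \<theta> powr (3/4) = 1 / (w \<theta>)^3"
  using K_powr[OF w_props(1)[of \<theta>]] by (simp_all add: K_def)

lemma R_std:
  assumes "\<theta> \<in> I" "C \<noteq> 0"
  shows "sqrt (9 * C * K \<theta> powr (3/2) + 16) / (3 * sqrt \<bar>C\<bar> * K \<theta> powr (3/4)) = P \<theta>"
proof -
  note w = w_props(1)[OF assms(1)] and P = P_pos[OF assms(1)]
  have "9 * C * K \<theta> powr (3/2) + 16 = (4 * P \<theta> / (w \<theta>)^3)^2"
    unfolding K_def K_powr(2)[OF w] using w P_square[OF assms(1)]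
    by (simp add: field_simps flip: power_mult)
  then have "sqrt (9 * C * K \<theta> powr (3/2) + 16) = 4 * P \<theta> / (w \<theta>)^3"
    using w P by (simp add: real_sqrt_unique)
  then show ?thesis unfolding K_std(2)[OF assms] using w by simp
qed

lemma half_radius_std:
  assumes "\<theta> \<in> I" "C \<noteq> 0"
  shows "4 * a / (3 * sqrt \<bar>C\<bar> * K \<theta> powr (3/4)) = (w \<theta>)^3 * a"
  unfolding K_std(2)[OF assms] using w_props(1)[OF assms(1)] by simp

text \<open>The group rotates the first two coordinates and fixes the last two, where the point is
  \<open>P\<close> times (sinh m, cosh m); their quotient tanh m recovers \<open>M\<close>.\<close>

lemma profile_pos:
  fixes m0 :: real
  assumes "C > 0"
  defines "m \<equiv> \<lambda>\<theta>. m0 + M \<theta>"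
  shows "profile \<epsilon> k (axis 1 1) (\<lambda>\<theta>. vector [(w \<theta>)^3, 0, P \<theta> * sinh (m \<theta>), P \<theta> * cosh (m \<theta>)])
    (\<lambda>\<theta>. vector [0, 0, cosh (m \<theta>), sinh (m \<theta>)]) (\<lambda>x. artanh (x$3 / x$4) - m0)"
    (is "profile _ _ _ ?\<gamma> ?e ?\<zeta>")
proof
  have \<epsilon>: "\<epsilon> = 1" using assms C_eps by simp
  show "(axis 1 1 :: real^4) $ 2 = 0" "(axis 1 1 :: real^4) $ 4 \<le> 0" by (simp_all add: axis_def)
  show "lor (axis 1 1) (axis 1 1) = \<epsilon>" by (simp add: lor_def axis_def \<epsilon>)
  define Y where "Y = {?\<gamma> \<theta> + (w \<theta>)^3 *\<^sub>R (Sg \<epsilon> v *\<^sub>R ax2 - Dg \<epsilon> v *\<^sub>R axis 1 1) | \<theta> v. \<theta> \<in> I}"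
  have Y: "x $ 4 \<noteq> 0 \<and> x $ 3 / x $ 4 \<in> {-1<..<1}" if x: "x \<in> Y" for x
  proof -
    obtain \<theta> where \<theta>: "\<theta> \<in> I" "x $ 3 = P \<theta> * sinh (m \<theta>)" "x $ 4 = P \<theta> * cosh (m \<theta>)"
      using x unfolding Y_def by (auto simp: axis_def)
    then have "x $ 3 / x $ 4 = tanh (m \<theta>)" "x $ 4 \<noteq> 0"
      using P_pos[OF \<theta>(1)] by (simp_all add: tanh_def)
    then show ?thesis using tanh_real_bounds[of "m \<theta>"] by simp
  qed
  have "continuous_on Y (\<lambda>x. x $ 3 / x $ 4)" using Y by (intro continuous_intros) blast
  then have "continuous_on Y (\<lambda>x. artanh (x $ 3 / x $ 4))"
    by (rule continuous_on_compose2[OF continuous_on_artanh[OF order_refl]]) (use Y in blast)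
  then have "continuous_on Y (\<lambda>x. artanh (x $ 3 / x $ 4) - m0)"
    by (intro continuous_on_diff continuous_on_const)
  then show "continuous_on {?\<gamma> \<theta> + (w \<theta>)^3 *\<^sub>R (Sg \<epsilon> v *\<^sub>R ax2 - Dg \<epsilon> v *\<^sub>R axis 1 1) | \<theta> v. \<theta> \<in> I} ?\<zeta>"
    by (simp only: Y_def)
  fix \<theta> assume \<theta>: "\<theta> \<in> I"
  note w = w_props[OF \<theta>] and P = P_pos[OF \<theta>] and Q = Q_pos[OF \<theta>]
  have P2: "(P \<theta>)^2 = (w \<theta>)^6 + 1" using P_square[OF \<theta>] \<epsilon> by simp
  have ch: "(cosh (m \<theta>))^2 = (sinh (m \<theta>))^2 + 1" by (rule cosh_square_eq)
  have md: "(m has_real_derivative 3 * (w \<theta>)^3 / Q \<theta>) (at \<theta>)"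
    unfolding m_def by (auto intro!: derivative_eq_intros M_deriv[OF \<theta>])
  show "?\<gamma> \<theta> $ 2 = 0" "0 < ?\<gamma> \<theta> $ 4" "?e \<theta> $ 2 = 0" using P by simp_all
  show "lor (?\<gamma> \<theta>) (?\<gamma> \<theta>) = -1"
  proof -
    have "lor (?\<gamma> \<theta>) (?\<gamma> \<theta>) = (w \<theta>)^6 + (P \<theta>)^2 * ((sinh (m \<theta>))^2 - (cosh (m \<theta>))^2)"
      by (simp add: lor_def algebra_simps power_numeral_reduce)
    then show ?thesis by (simp add: ch P2)
  qed
  show "lor (axis 1 1) (?\<gamma> \<theta>) = (w \<theta>)^3" "lor (?e \<theta>) (?e \<theta>) = 1" "lor (axis 1 1) (?e \<theta>) = 0"
    "lor (?\<gamma> \<theta>) (?e \<theta>) = 0"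
    using ch by (simp_all add: lor_def axis_def power2_eq_square)
  define m' where "m' = 3 * (w \<theta>)^3 / Q \<theta>"
  have m': "m' = \<sigma> \<theta> * sin \<theta> / P \<theta>" using M_slope[OF \<theta>] P by (simp add: m'_def eq_divide_eq)
  have md': "(m has_real_derivative m') (at \<theta>)" using md by (simp add: m'_def)
  show "(?\<gamma> has_vector_derivative
      \<sigma> \<theta> *\<^sub>R (sin \<theta> *\<^sub>R ?e \<theta> - (cos \<theta> / P \<theta>) *\<^sub>R (axis 1 1 + (w \<theta>)^3 *\<^sub>R ?\<gamma> \<theta>))) (at \<theta>)"
  proof (rule has_vector_derivative_vector4[OF w3_deriv[OF \<theta>] DERIV_const
        DERIV_mult[OF P_deriv[OF \<theta>] has_field_derivative_sinh[OF md']]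
        DERIV_mult[OF P_deriv[OF \<theta>] has_field_derivative_cosh[OF md']]])
    have "1 + (w \<theta>)^3 * (w \<theta>)^3 = P \<theta> * P \<theta>" using P2 by (simp add: power_numeral_reduce)
    then show "(\<sigma> \<theta> *\<^sub>R (sin \<theta> *\<^sub>R ?e \<theta> - (cos \<theta> / P \<theta>) *\<^sub>R (axis 1 1 + (w \<theta>)^3 *\<^sub>R ?\<gamma> \<theta>))) $ 1
        = - (\<sigma> \<theta> * P \<theta> * cos \<theta>)"
      using P by (simp add: axis_def)
  qed (use P in \<open>simp_all add: axis_def m' algebra_simps\<close>)
  show "(?e has_vector_derivative
        (3 * (w \<theta>)^3 / (Q \<theta> * P \<theta>)) *\<^sub>R (\<epsilon> *\<^sub>R ?\<gamma> \<theta> - (w \<theta>)^3 *\<^sub>R axis 1 1)) (at \<theta>)"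
    by (rule has_vector_derivative_vector4[OF DERIV_const DERIV_const
          has_field_derivative_cosh[OF md] has_field_derivative_sinh[OF md]])
       (use P in \<open>simp_all add: axis_def \<epsilon>\<close>)
  show "artanh ((?\<gamma> \<theta> + (w \<theta>)^3 *\<^sub>R (Sg \<epsilon> v *\<^sub>R ax2 - Dg \<epsilon> v *\<^sub>R axis 1 1)) $ 3 /
      (?\<gamma> \<theta> + (w \<theta>)^3 *\<^sub>R (Sg \<epsilon> v *\<^sub>R ax2 - Dg \<epsilon> v *\<^sub>R axis 1 1)) $ 4) - m0 = M \<theta>" for v
    using P artanh_tanh_real[of "m \<theta>"] by (simp add: axis_def tanh_def m_def)
qed

lemma X_std_pos:
  assumes "C > 0" "\<theta> \<in> I"
  shows "X_std C m (K \<theta>) v = vector [(w \<theta>)^3, 0, P \<theta> * sinh m, P \<theta> * cosh m]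
    + (w \<theta>)^3 *\<^sub>R (Sg \<epsilon> v *\<^sub>R ax2 - Dg \<epsilon> v *\<^sub>R axis 1 1)"
proof -
  have "C \<noteq> 0" "\<bar>C\<bar> = C" "\<epsilon> = 1" using assms C_eps by auto
  then show ?thesis
    using R_std[OF assms(2)] half_radius_std[OF assms(2)] assms(1)
    by (intro vector4_eqI) (simp_all add: X_std_def X_pos_def Let_def Sg_def Dg_def axis_def algebra_simps)
qed

text \<open>Here \<open>n\<close> is timelike. The coordinates \<open>x$3\<close> and
  \<open>sqrt 2 * x$1 - x$4\<close> do not change along the orbits and equal \<open>P\<close> times
  (cos m, sin m). Turning this plane by \<open>- m0\<close> leaves the angle \<open>M\<close>, which
  lies in the range of \<open>arctan\<close> by \<open>M_bound\<close>.\<close>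

lemma profile_neg:
  fixes m0 :: real
  assumes "C < 0"
  defines "m \<equiv> \<lambda>\<theta>. m0 + M \<theta>" and "n \<equiv> vector [-1, 0, 0, - sqrt 2] :: real^4"
  shows "profile \<epsilon> k n
    (\<lambda>\<theta>. vector [sqrt 2 * P \<theta> * sin (m \<theta>) + (w \<theta>)^3, 0, P \<theta> * cos (m \<theta>), P \<theta> * sin (m \<theta>) + sqrt 2 * (w \<theta>)^3])
    (\<lambda>\<theta>. vector [sqrt 2 * cos (m \<theta>), 0, - sin (m \<theta>), cos (m \<theta>)])
    (\<lambda>x. arctan (((sqrt 2 * x$1 - x$4) * cos m0 - x$3 * sin m0) / (x$3 * cos m0 + (sqrt 2 * x$1 - x$4) * sin m0)))"
    (is "profile _ _ _ ?\<gamma> ?e ?\<zeta>")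
proof
  have \<epsilon>: "\<epsilon> = -1" using assms C_eps by simp
  show "n $ 2 = 0" "n $ 4 \<le> 0" by (simp_all add: n_def)
  show "lor n n = \<epsilon>" by (simp add: lor_def n_def \<epsilon> sqrt2_simps)
  let ?Y = "\<lambda>\<theta> v. ?\<gamma> \<theta> + (w \<theta>)^3 *\<^sub>R (Sg \<epsilon> v *\<^sub>R ax2 - Dg \<epsilon> v *\<^sub>R n)"
  let ?s = "\<lambda>x :: real^4. (sqrt 2 * x$1 - x$4) * cos m0 - x$3 * sin m0"
  let ?c = "\<lambda>x :: real^4. x$3 * cos m0 + (sqrt 2 * x$1 - x$4) * sin m0"
  have Y: "?s (?Y \<theta> v) = P \<theta> * sin (M \<theta>)" "?c (?Y \<theta> v) = P \<theta> * cos (M \<theta>)" for \<theta> v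
  proof -
    have trig: "sin (M \<theta>) = sin (m \<theta>) * cos m0 - cos (m \<theta>) * sin m0"
      "cos (M \<theta>) = cos (m \<theta>) * cos m0 + sin (m \<theta>) * sin m0"
      by (simp_all add: m_def flip: sin_diff cos_diff)
    show "?s (?Y \<theta> v) = P \<theta> * sin (M \<theta>)" "?c (?Y \<theta> v) = P \<theta> * cos (M \<theta>)"
      unfolding trig by (simp_all add: n_def algebra_simps sqrt2_simps)
  qed
  have "?c (?Y \<theta> v) \<noteq> 0" if "\<theta> \<in> I" for \<theta> v
  proof -
    have "0 < cos (M \<theta>)" using M_bound[OF \<epsilon> that] by (intro cos_gt_zero_pi) auto
    then show ?thesis using P_pos[OF that] by (simp only: Y) simp
  qed
  then show "continuous_on {?Y \<theta> v | \<theta> v. \<theta> \<in> I} ?\<zeta>"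
    by (intro continuous_intros) blast
  fix \<theta> assume \<theta>: "\<theta> \<in> I"
  note w = w_props[OF \<theta>] and P = P_pos[OF \<theta>] and Q = Q_pos[OF \<theta>]
  have P2: "(P \<theta>)^2 = (w \<theta>)^6 - 1" using P_square[OF \<theta>] \<epsilon> by simp
  have sc: "(cos (m \<theta>))^2 = 1 - (sin (m \<theta>))^2" by (rule cos_squared_eq)
  have md: "(m has_real_derivative 3 * (w \<theta>)^3 / Q \<theta>) (at \<theta>)"
    unfolding m_def by (auto intro!: derivative_eq_intros M_deriv[OF \<theta>])
  show "?\<gamma> \<theta> $ 2 = 0" "?e \<theta> $ 2 = 0" by simp_all
  show "0 < ?\<gamma> \<theta> $ 4"
  proof -
    \<comment> \<open>As \<epsilon> = -1, \<open>P\<close> is smaller than \<open>w^3\<close>, so a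
      negative \<open>P * sin m\<close> cannot outweigh \<open>sqrt 2 * w^3\<close>.\<close>
    have "(P \<theta>)^2 < ((w \<theta>)^3)^2" using P2 by (simp flip: power_mult)
    then have "P \<theta> < (w \<theta>)^3" by (rule power2_less_imp_less) (use w(1) in simp)
    moreover have "P \<theta> * (- sin (m \<theta>)) \<le> P \<theta> * 1" using P sin_ge_minus_one[of "m \<theta>"]
      by (intro mult_left_mono) auto
    moreover have "1 * (w \<theta>)^3 \<le> sqrt 2 * (w \<theta>)^3" using w(1) by (intro mult_right_mono) auto
    ultimately show ?thesis by simp
  qed
  show "lor (?\<gamma> \<theta>) (?\<gamma> \<theta>) = -1"
  proof -
    have "lor (?\<gamma> \<theta>) (?\<gamma> \<theta>) = (P \<theta>)^2 * (sin (m \<theta>))^2 + (P \<theta>)^2 * (cos (m \<theta>))^2 - (w \<theta>)^6"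
      by (simp add: lor_def algebra_simps power_numeral_reduce sqrt2_simps)
    also have "\<dots> = (P \<theta>)^2 * ((sin (m \<theta>))^2 + (cos (m \<theta>))^2) - (w \<theta>)^6" by (simp only: distrib_left)
    finally show ?thesis by (simp add: P2)
  qed
  show "lor n (?\<gamma> \<theta>) = (w \<theta>)^3" "lor n (?e \<theta>) = 0" "lor (?\<gamma> \<theta>) (?e \<theta>) = 0"
    by (simp_all add: lor_def n_def algebra_simps sqrt2_simps)
  show "lor (?e \<theta>) (?e \<theta>) = 1"
    using sc by (simp add: lor_def algebra_simps sqrt2_simps power2_eq_square)
  show "(?\<gamma> has_vector_derivative
      \<sigma> \<theta> *\<^sub>R (sin \<theta> *\<^sub>R ?e \<theta> - (cos \<theta> / P \<theta>) *\<^sub>R (n + (w \<theta>)^3 *\<^sub>R ?\<gamma> \<theta>))) (at \<theta>)"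
  proof -
    have PP: "(w \<theta>)^3 * (w \<theta>)^3 = P \<theta> * P \<theta> + 1" using P2 by (simp add: power_numeral_reduce)
    define m' where "m' = 3 * (w \<theta>)^3 / Q \<theta>"
    have m': "m' = \<sigma> \<theta> * sin \<theta> / P \<theta>" using M_slope[OF \<theta>] P by (simp add: m'_def eq_divide_eq)
    have md': "(m has_real_derivative m') (at \<theta>)" using md by (simp add: m'_def)
    have s': "((\<lambda>\<theta>. P \<theta> * sin (m \<theta>)) has_real_derivative
        - (\<sigma> \<theta> * (w \<theta>)^3 * cos \<theta>) * sin (m \<theta>) + \<sigma> \<theta> * sin \<theta> * cos (m \<theta>)) (at \<theta>)"
      using P by (auto intro!: derivative_eq_intros P_deriv[OF \<theta>] md' simp: m')
    have c': "((\<lambda>\<theta>. P \<theta> * cos (m \<theta>)) has_real_derivative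
        - (\<sigma> \<theta> * (w \<theta>)^3 * cos \<theta>) * cos (m \<theta>) - \<sigma> \<theta> * sin \<theta> * sin (m \<theta>)) (at \<theta>)"
      using P by (auto intro!: derivative_eq_intros P_deriv[OF \<theta>] md' simp: m')
    have nw: "(n + (w \<theta>)^3 *\<^sub>R ?\<gamma> \<theta>) = P \<theta> *\<^sub>R vector [sqrt 2 * (w \<theta>)^3 * sin (m \<theta>) + P \<theta>, 0,
        (w \<theta>)^3 * cos (m \<theta>), (w \<theta>)^3 * sin (m \<theta>) + sqrt 2 * P \<theta>]"
      using PP by (intro vector4_eqI) (simp_all add: n_def algebra_simps)
    have "(\<lambda>\<theta>. sqrt 2 * P \<theta> * sin (m \<theta>) + (w \<theta>)^3) = (\<lambda>\<theta>. sqrt 2 * (P \<theta> * sin (m \<theta>)) + (w \<theta>)^3)"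
      by (simp add: mult.assoc)
    then have a': "((\<lambda>\<theta>. sqrt 2 * P \<theta> * sin (m \<theta>) + (w \<theta>)^3) has_real_derivative
        sqrt 2 * (- (\<sigma> \<theta> * (w \<theta>)^3 * cos \<theta>) * sin (m \<theta>) + \<sigma> \<theta> * sin \<theta> * cos (m \<theta>)) + - (\<sigma> \<theta> * P \<theta> * cos \<theta>)) (at \<theta>)"
      using DERIV_add[OF DERIV_cmult[OF s', of "sqrt 2"] w3_deriv[OF \<theta>]] by simp
    show ?thesis unfolding nw
      by (rule has_vector_derivative_vector4[OF a' DERIV_const c'
            DERIV_add[OF s' DERIV_cmult[OF w3_deriv[OF \<theta>], of "sqrt 2"]]])
         (use P in \<open>simp_all add: algebra_simps\<close>)
  qed
  show "(?e has_vector_derivative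
        (3 * (w \<theta>)^3 / (Q \<theta> * P \<theta>)) *\<^sub>R (\<epsilon> *\<^sub>R ?\<gamma> \<theta> - (w \<theta>)^3 *\<^sub>R n)) (at \<theta>)"
  proof (rule has_vector_derivative_vector4)
    show "((\<lambda>\<theta>. sqrt 2 * cos (m \<theta>)) has_real_derivative sqrt 2 * (- sin (m \<theta>) * (3 * (w \<theta>)^3 / Q \<theta>))) (at \<theta>)"
      "((\<lambda>\<theta>. - sin (m \<theta>)) has_real_derivative - (cos (m \<theta>) * (3 * (w \<theta>)^3 / Q \<theta>))) (at \<theta>)"
      "((\<lambda>\<theta>. cos (m \<theta>)) has_real_derivative - sin (m \<theta>) * (3 * (w \<theta>)^3 / Q \<theta>)) (at \<theta>)"
      by (auto intro!: derivative_eq_intros md)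
    show "((\<lambda>_. 0) has_real_derivative 0) (at \<theta>)" by simp
  qed (use P Q in \<open>simp_all add: n_def \<epsilon> field_simps\<close>)
  show "?\<zeta> (?Y \<theta> v) = M \<theta>" for v
    using P M_bound[OF \<epsilon> \<theta>] arctan_tan[of "M \<theta>"] by (simp only: Y) (simp add: tan_def abs_less_iff)
qed

lemma X_std_neg:
  assumes "C < 0" "\<theta> \<in> I"
  shows "X_std C m (K \<theta>) v = vector [sqrt 2 * P \<theta> * sin m + (w \<theta>)^3, 0, P \<theta> * cos m, P \<theta> * sin m + sqrt 2 * (w \<theta>)^3]
    + (w \<theta>)^3 *\<^sub>R (Sg \<epsilon> v *\<^sub>R ax2 - Dg \<epsilon> v *\<^sub>R vector [-1, 0, 0, - sqrt 2])"
proof -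
  have C: "C \<noteq> 0" "\<bar>C\<bar> = - C" "\<not> 0 < C" "\<epsilon> = -1" using assms C_eps by auto
  have den: "3 * sqrt (- C) * K \<theta> powr (3/4) = 4 / (w \<theta>)^3"
    and R: "sqrt (9 * C * K \<theta> powr (3/2) + 16) / (3 * sqrt (- C) * K \<theta> powr (3/4)) = P \<theta>"
    using K_std(2)[OF assms(2) C(1)] R_std[OF assms(2) C(1)] unfolding C(2) by blast+
  have sd: "Sg \<epsilon> v = sinh v" "Dg \<epsilon> v = cosh v - 1" using C(4) by (simp_all add: Sg_def Dg_def)
  show ?thesis
    unfolding X_std_def X_neg_def Let_def if_not_P[OF C(3)] if_P[OF assms(1)] R
    unfolding den sd using w_props(1)[OF assms(2)] by (intro vector4_eqI) (simp_all add: algebra_simps)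
qed

text \<open>Here \<open>n\<close> is null, and \<open>lor n x\<close> is a multiple of
  \<open>x$4 - x$1\<close>, scaled so that it equals the radius \<open>w^3\<close>. It and
  \<open>x$3\<close> are constant along the orbits, and their quotient is m.\<close>

lemma profile_zero:
  fixes m0 :: real
  assumes "C = 0"
  defines "m \<equiv> \<lambda>\<theta>. m0 + M \<theta>" and "A \<equiv> 2 powr (3/4) :: real"
  defines "n \<equiv> vector [- 2 * A, 0, 0, - 2 * A] :: real^4"
  shows "profile \<epsilon> k n
    (\<lambda>\<theta>. vector [A * (1 / (w \<theta>)^3 + (w \<theta>)^3 * (m \<theta>)^2) - (w \<theta>)^3 / (4 * A), 0, (w \<theta>)^3 * m \<theta>,
                 A * (1 / (w \<theta>)^3 + (w \<theta>)^3 * (m \<theta>)^2) + (w \<theta>)^3 / (4 * A)])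
    (\<lambda>\<theta>. vector [2 * A * m \<theta>, 0, 1, 2 * A * m \<theta>]) (\<lambda>x. x$3 / lor n x - m0)"
    (is "profile _ _ _ ?\<gamma> ?e ?\<zeta>")
proof
  have \<epsilon>: "\<epsilon> = 0" using assms C_eps by simp
  have A: "0 < A" by (simp add: A_def)
  show "n $ 2 = 0" "n $ 4 \<le> 0" "lor n n = \<epsilon>" using A by (simp_all add: n_def lor_def \<epsilon>)
  let ?Y = "\<lambda>\<theta> v. ?\<gamma> \<theta> + (w \<theta>)^3 *\<^sub>R (Sg \<epsilon> v *\<^sub>R ax2 - Dg \<epsilon> v *\<^sub>R n)"
  have Y: "lor n (?Y \<theta> v) = (w \<theta>)^3" if "\<theta> \<in> I" for \<theta> v
  proof -
    define r where "r = (w \<theta>)^3"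
    have "0 < r" using w_props(1)[OF that] by (simp add: r_def)
    then show ?thesis using A unfolding r_def[symmetric] by (simp add: lor_def n_def field_simps)
  qed
  have "lor n (?Y \<theta> v) \<noteq> 0" if "\<theta> \<in> I" for \<theta> v
    using w_props(1)[OF that] by (simp only: Y[OF that]) simp
  then show "continuous_on {?Y \<theta> v | \<theta> v. \<theta> \<in> I} ?\<zeta>"
    by (intro continuous_intros lor.continuous_on) blast
  fix \<theta> assume \<theta>: "\<theta> \<in> I"
  note w = w_props[OF \<theta>] and P = P_pos[OF \<theta>] and Q = Q_pos[OF \<theta>]
  have P2: "(P \<theta>)^2 = ((w \<theta>)^3)^2" using P_square[OF \<theta>] \<epsilon> by (simp flip: power_mult)
  from power2_eq_imp_eq[OF this] have Pw: "P \<theta> = (w \<theta>)^3" using P w(1) by simp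
  have md: "(m has_real_derivative 3 * (w \<theta>)^3 / Q \<theta>) (at \<theta>)"
    unfolding m_def by (auto intro!: derivative_eq_intros M_deriv[OF \<theta>])
  show "?\<gamma> \<theta> $ 2 = 0" "?e \<theta> $ 2 = 0" by simp_all
  show "0 < ?\<gamma> \<theta> $ 4" using w(1) A by (simp add: add_nonneg_pos)
  define r where "r = (w \<theta>)^3"
  have r: "0 < r" using w(1) by (simp add: r_def)
  show "lor (?\<gamma> \<theta>) (?\<gamma> \<theta>) = -1" "lor n (?\<gamma> \<theta>) = (w \<theta>)^3" "lor (?\<gamma> \<theta>) (?e \<theta>) = 0"
    using A r unfolding r_def[symmetric] by (simp_all add: lor_def n_def field_simps power2_eq_square)
  show "lor (?e \<theta>) (?e \<theta>) = 1" "lor n (?e \<theta>) = 0" by (simp_all add: lor_def n_def)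
  show "(?\<gamma> has_vector_derivative
      \<sigma> \<theta> *\<^sub>R (sin \<theta> *\<^sub>R ?e \<theta> - (cos \<theta> / P \<theta>) *\<^sub>R (n + (w \<theta>)^3 *\<^sub>R ?\<gamma> \<theta>))) (at \<theta>)"
  proof -
    define m' where "m' = 3 * (w \<theta>)^3 / Q \<theta>"
    have md': "(m has_real_derivative m') (at \<theta>)" using md by (simp add: m'_def)
    have m': "m' = \<sigma> \<theta> * sin \<theta> / r" using M_slope[OF \<theta>] r by (simp add: m'_def Pw r_def field_simps)
    have r': "((\<lambda>\<theta>. (w \<theta>)^3) has_real_derivative - (\<sigma> \<theta> * r * cos \<theta>)) (at \<theta>)"
      using w3_deriv[OF \<theta>] by (simp add: Pw r_def)
    have x': "((\<lambda>\<theta>. (w \<theta>)^3 * m \<theta>) has_real_derivative - (\<sigma> \<theta> * r * cos \<theta>) * m \<theta> + m' * r) (at \<theta>)"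
      unfolding m'_def r_def by (rule DERIV_mult[OF r'[unfolded r_def] md])
    have y': "((\<lambda>\<theta>. A * (1 / (w \<theta>)^3 + (w \<theta>)^3 * (m \<theta>)^2)) has_real_derivative
        A * (\<sigma> \<theta> * cos \<theta> / r - \<sigma> \<theta> * r * cos \<theta> * (m \<theta>)^2 + 2 * r * m \<theta> * m')) (at \<theta>)"
    proof -
      have "((\<lambda>\<theta>. inverse ((w \<theta>)^3)) has_real_derivative
          - (inverse ((w \<theta>)^3) * (- (\<sigma> \<theta> * r * cos \<theta>)) * inverse ((w \<theta>)^3))) (at \<theta>)"
        by (rule DERIV_inverse'[OF r']) (use w(1) in simp)
      from DERIV_cmult[OF DERIV_add[OF this DERIV_mult[OF r' DERIV_power[OF md', of 2]]], of A]
      show ?thesis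
        using r by (simp add: divide_inverse[of 1] flip: r_def)
          (simp add: field_simps power2_eq_square)
    qed
    have z': "((\<lambda>\<theta>. (w \<theta>)^3 / (4 * A)) has_real_derivative - (\<sigma> \<theta> * r * cos \<theta>) / (4 * A)) (at \<theta>)"
      by (rule DERIV_cdivide[OF r'])
    show ?thesis
      by (rule has_vector_derivative_vector4[OF DERIV_diff[OF y' z'] DERIV_const x' DERIV_add[OF y' z']])
         (use A r in \<open>simp_all add: n_def Pw r_def[symmetric] m' field_simps power2_eq_square\<close>)
  qed
  show "(?e has_vector_derivative
        (3 * (w \<theta>)^3 / (Q \<theta> * P \<theta>)) *\<^sub>R (\<epsilon> *\<^sub>R ?\<gamma> \<theta> - (w \<theta>)^3 *\<^sub>R n)) (at \<theta>)"
    unfolding Pw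
    by (rule has_vector_derivative_vector4[OF DERIV_cmult[OF md] DERIV_const DERIV_const DERIV_cmult[OF md]])
       (use w(1) Q in \<open>simp_all add: n_def \<epsilon>\<close>)
  show "?Y \<theta> v $ 3 / lor n (?Y \<theta> v) - m0 = M \<theta>" for v
    using w(1) by (simp only: Y[OF \<theta>]) (simp add: m_def n_def)
qed

text \<open>The standard parameter is the second coordinate itself, while the group parameter is
  this coordinate divided by the radius; hence the factor \<open>w^3\<close>.\<close>

lemma X_std_zero:
  assumes "C = 0" "\<theta> \<in> I"
  defines "A \<equiv> 2 powr (3/4) :: real"
  shows "X_std C m (K \<theta>) ((w \<theta>)^3 * v) =
    vector [A * (1 / (w \<theta>)^3 + (w \<theta>)^3 * m^2) - (w \<theta>)^3 / (4 * A), 0, (w \<theta>)^3 * m,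
                 A * (1 / (w \<theta>)^3 + (w \<theta>)^3 * m^2) + (w \<theta>)^3 / (4 * A)]
    + (w \<theta>)^3 *\<^sub>R (Sg \<epsilon> v *\<^sub>R ax2 - Dg \<epsilon> v *\<^sub>R vector [- 2 * A, 0, 0, - 2 * A])"
proof -
  define r where "r = (w \<theta>)^3"
  have r: "0 < r" using w_props(1)[OF assms(2)] by (simp add: r_def)
  have A: "0 < A" by (simp add: A_def)
  have "\<epsilon> = 0" using C_eps assms(1) by simp
  have p: "2 powr (11/4) = 4 * A" using powr_add[of 2 2 "3/4::real"] by (simp add: A_def)
  have K: "K \<theta> powr (3/4) = 1 / r" using K_std(3)[OF assms(2,1)] by (simp add: r_def)
  show ?thesis
    using A r \<open>\<epsilon> = 0\<close> assms(1)
    unfolding X_std_def X_zero_def Let_def K p A_def[symmetric] r_def[symmetric]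
    by (intro vector4_eqI) (simp_all add: Sg_def Dg_def field_simps power2_eq_square)
qed

end

theorem theorem4p16:
  fixes C \<kappa>00 :: real and S1 S2 B S :: "(real^4) set"
  assumes "0 < \<kappa>00" and "\<kappa>00 < kappa01 C"
    and "S1 = surface1 C \<kappa>00" and "S2 = surface2 C \<kappa>00" and "B = boundary_curve C \<kappa>00"
    and "S = S1 \<union> B \<union> S2"
  shows "regular_surface S \<and> complete_surface S \<and> biconservative S \<and>
    (\<forall>W N. open W \<and> unit_normal_field S W N \<longrightarrow>
       (\<forall>p\<in>B \<inter> W. has_surface_gradient S (mean_curvature S N) 0 p)) \<and>
    (\<exists>\<gamma>. geodesic S \<gamma> \<and> range \<gamma> = B)"
proof -
  define \<epsilon> where "\<epsilon> = sgn C"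
  \<comment> \<open>For nonzero \<open>C\<close> this solves
    \<open>9 * \<bar>C\<bar> * k powr (3/2) = 16\<close>.\<close>
  define k where "k = (if C = 0 then 1 else (16 / (9 * \<bar>C\<bar>)) powr (2/3))"
  interpret standard_profile \<epsilon> k C
  proof
    show "\<epsilon> \<in> {-1, 0, 1}" by (simp add: \<epsilon>_def sgn_if)
    show "0 < k" by (simp add: k_def)
    show "9 * C * k powr (3/2) = 16 * \<epsilon>"
      by (cases "C = 0") (simp_all add: k_def \<epsilon>_def powr_powr sgn_if)
    show "C = 0 \<Longrightarrow> k = 1" by (simp add: k_def)
  qed
  note S = glued_surface[OF assms(1,2), folded assms(3-5), folded assms(6)]
  consider "C > 0" | "C < 0" | "C = 0" by linarith
  then show ?thesis
  proof cases
    case 1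
    show ?thesis
      by (rule profile.conclusion[OF profile_pos[OF 1, of "mu01 C \<kappa>00"] _ _ S(2,1), of "\<lambda>_. 1"])
         (simp_all add: X_std_pos[OF 1])
  next
    case 2
    show ?thesis
      by (rule profile.conclusion[OF profile_neg[OF 2, of "mu01 C \<kappa>00"] _ _ S(2,1), of "\<lambda>_. 1"])
         (simp_all add: X_std_neg[OF 2])
  next
    case 3
    show ?thesis
      by (rule profile.conclusion[OF profile_zero[OF 3, of "mu01 C \<kappa>00"] _ _ S(2,1), of "\<lambda>\<theta>. (w \<theta>)^3"])
         (simp add: X_std_zero[OF 3], use w_props(1) in fastforce)
  qed
qed

end
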